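(* Let $(R,\mathfrak m)$ be a $d$-dimensional Noetherian local ring, $d\ge1$, and let $M$ be a finite $R$-module with $\dim M=d$. Let $\mathcal I^{(1)},\ldots,\mathcal I^{(s)}$, $\mathcal I^{(i)}=\{I_n^{(i)}\}_{n\ge0}$, be graded $\mathfrak m$-primary families, and assume that each $\mathcal I^{(i)}$ is Noetherian. Let $\mathbf d=(d_1,\ldots,d_s)\in\mathbb N^s$ satisfy $d_1+\cdots+d_s=d$, and let $\mathbf x_\bullet=\{\mathbf x(n)\}_{n\gg0}$, $\mathbf x(n)=\{x_{ij}^{(n)}\}$, be a weak asymptotic joint reduction of type $\mathbf d$ with respect to $M$. Set $Q_n=(x_{ij}^{(n)}\mid 1\leq i\leq s,\ 1\leq j\leq d_i)$. Then there exists an integer $c\geq1$ such that $I_{cm}^{(i)}=\bigl(I_c^{(i)}\bigr)^m$ for every $1\leq i\leq s$ and every $m\geq0$, and for every sufficiently large $m$ one has $$e(Q_{cm};M)=m^d\,e\left(I_c^{(1)[d_1]},\ldots,I_c^{(s)[d_s]};M\right).$$ Consequently, $$e\left(\mathcal I^{(1)[d_1]},\ldots,\mathcal I^{(s)[d_s]};M\right)=\frac{1}{c^d}\,e\left(I_c^{(1)[d_1]},\ldots,I_c^{(s)[d_s]};M\right),$$ and, more precisely, for every sufficiently large $m$, $$\frac{e(Q_{cm};M)}{(cm)^d}=e\left(\mathcal I^{(1)[d_1]},\ldots,\mathcal I^{(s)[d_s]};M\right).$$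
   Context: $\mathbb N$ includes $0$. A graded $\mathfrak m$-primary family is a family $\mathcal I=\{I_n\}_{n\ge0}$ of ideals with $I_0=R$, $I_n$ $\mathfrak m$-primary for $n>0$, and $I_mI_n\subseteq I_{m+n}$. It is Noetherian if $\bigoplus_{n\ge0}I_nt^n$ is a finitely generated $R$-algebra. $e(I;M)=\lim_{n\to\infty} d!\,\ell_R(M/I^nM)/n^d$ ($d=\dim R$) is the Hilbert--Samuel multiplicity. Classical mixed multiplicities: for $\mathfrak m$-primary ideals $I_1,\ldots,I_s$, the function $\ell_R(M/I_1^{n_1}\cdots I_s^{n_s}M)$ agrees for all large $n_1,\dots,n_s$ with a polynomial whose homogeneous part of degree $d$ is $\sum_{d_1+\cdots+d_s=d}\frac{1}{d_1!\cdots d_s!}e(I_1^{[d_1]},\ldots,I_s^{[d_s]};M)n_1^{d_1}\cdots n_s^{d_s}$; this defines $e(I_1^{[d_1]},\ldots,I_s^{[d_s]};M)$ (the bracket means $I_i$ occurs $d_i$ times). Mixed multiplicities of families (Cutkosky): $P_M(n_1,\ldots,n_s)=\lim_{m\to\infty} e(I^{(1)}_{mn_1}\cdots I^{(s)}_{mn_s};M)/m^d$ exists and is a homogeneous real polynomial of degree $d$, and one defines $$P_M(n_1,\ldots,n_s)=\sum_{d_1+\cdots+d_s=d}\frac{d!}{d_1!\cdots d_s!}\,e\left(\mathcal I^{(1)[d_1]},\ldots,\mathcal I^{(s)[d_s]};M\right)n_1^{d_1}\cdots n_s^{d_s}.$$ Classical joint reduction with respect to $M$: for ideals $J_1,\ldots,J_q$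 and $x_i\in J_i$, $(x_1,\ldots,x_q)$ is a joint reduction of $(J_1,\ldots,J_q)$ with respect to $M$ if, with $H=\sum_{i}x_i\prod_{j\neq i}J_j$ and $L=J_1\cdots J_q$, one has $HL^rM=L^{r+1}M$ for some $r\geq0$. Weak asymptotic joint reduction of type $\mathbf r=(r_1,\ldots,r_s)$ with respect to $M$: a collection $\{\mathbf x(n)\}_{n\ge n_0}$ with $\mathbf x(n)=\{x_{ij}^{(n)}\mid 1\le i\le s,\ 1\le j\le r_i\}$, $x_{ij}^{(n)}\in I_n^{(i)}$, such that for every $n\ge n_0$ the tuple $\mathbf x(n)$ is a classical joint reduction with respect to $M$ of the list in which $I_n^{(i)}$ is repeated $r_i$ times ($i=1,\ldots,s$). *)

theory Defs
  imports
    Complex_Main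
    "HOL-Library.Extended_Nat"
    "HOL-Algebra.Ideal_Product"
    "HOL-Algebra.Ring_Divisibility"
    "HOL-Algebra.Generated_Rings"
    "HOL-Algebra.UnivPoly"
begin

text \<open>
  Rings and modules are those of HOL-Algebra. Products, powers and sums of ideals are taken in the
  commutative semiring \<^const>\<open>ideals_set\<close>, so that \<open>I [^]\<^bsub>ideals_set R\<^esub> 0 = carrier R\<close>. The families
  \<open>1, \<dots>, s\<close> of ideals are indexed by a finite type \<open>'k\<close>, and \<open>'k \<Rightarrow> nat\<close> plays the role of
  \<open>\<nat>\<^sup>s\<close>.
\<close>

section \<open>Local rings, dimension, length\<close>

locale noetherian_local_ring = noetherian_ring R + cring R for R (structure) +
  fixes \<mm> :: "'a set"
  assumes maximal: "maximalideal \<mm> R"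
    and maximal_unique: "maximalideal \<nn> R \<Longrightarrow> \<nn> = \<mm>"

text \<open>The zero ring, which has no primes, gets dimension 0; this is invisible in positive dimension.\<close>

definition krull_dim :: "('a, 'r) ring_scheme \<Rightarrow> enat" where
  "krull_dim R =
     (SUP n \<in> {n. \<exists>P. (\<forall>k\<le>n. primeideal (P k) R) \<and> (\<forall>k<n. P k \<subset> P (Suc k))}. enat n)"

definition annihilator :: "('a, 'r) ring_scheme \<Rightarrow> ('a, 'b, 'm) module_scheme \<Rightarrow> 'a set" where
  "annihilator R M = {a \<in> carrier R. \<forall>x \<in> carrier M. a \<odot>\<^bsub>M\<^esub> x = \<zero>\<^bsub>M\<^esub>}"

definition module_dim :: "('a, 'r) ring_scheme \<Rightarrow> ('a, 'b, 'm) module_scheme \<Rightarrow> enat" where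
  "module_dim R M = krull_dim (R Quot annihilator R M)"

definition gen_submodule ::
    "('a, 'r) ring_scheme \<Rightarrow> ('a, 'b, 'm) module_scheme \<Rightarrow> 'b set \<Rightarrow> 'b set" where
  "gen_submodule R M S = \<Inter>{N. submodule N R M \<and> S \<subseteq> N}"

definition finite_module :: "('a, 'r) ring_scheme \<Rightarrow> ('a, 'b, 'm) module_scheme \<Rightarrow> bool" where
  "finite_module R M \<longleftrightarrow>
     Module.module R M \<and> (\<exists>S \<subseteq> carrier M. finite S \<and> gen_submodule R M S = carrier M)"

definition ideal_smult ::
    "('a, 'r) ring_scheme \<Rightarrow> ('a, 'b, 'm) module_scheme \<Rightarrow> 'a set \<Rightarrow> 'b set" where
  "ideal_smult R M I = gen_submodule R M {a \<odot>\<^bsub>M\<^esub> x | a x. a \<in> I \<and> x \<in> carrier M}"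

text \<open>The fields \<open>mult\<close> and \<open>one\<close> of a module record carry no meaning.\<close>

definition quot_module :: "('a, 'b, 'm) module_scheme \<Rightarrow> 'b set \<Rightarrow> ('a, 'b set) module" where
  "quot_module M N =
     \<lparr>carrier = a_rcosets\<^bsub>M\<^esub> N, monoid.mult = undefined, one = undefined, zero = N, add = set_add M,
      smult = (\<lambda>a X. \<Union>x\<in>X. N +>\<^bsub>M\<^esub> (a \<odot>\<^bsub>M\<^esub> x))\<rparr>"

lemma (in module) quot_module_smult:
  assumes N: "submodule N R M" and a: "a \<in> carrier R" and x: "x \<in> carrier M"
  shows "a \<odot>\<^bsub>quot_module M N\<^esub> (N +>\<^bsub>M\<^esub> x) = N +>\<^bsub>M\<^esub> (a \<odot>\<^bsub>M\<^esub> x)"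
proof -
  interpret N: abelian_subgroup N M
    by (rule abelian_subgroupI3[OF additive_subgroup.intro[OF submodule.axioms(1)[OF N]]
          M.abelian_group_axioms])
  have eq: "N +>\<^bsub>M\<^esub> (a \<odot>\<^bsub>M\<^esub> y) = N +>\<^bsub>M\<^esub> (a \<odot>\<^bsub>M\<^esub> x)" if y: "y \<in> N +>\<^bsub>M\<^esub> x" for y
  proof -
    from y obtain h where h: "h \<in> N" "y = h \<oplus>\<^bsub>M\<^esub> x"
      by (auto simp: a_r_coset_def r_coset_def)
    have "a \<odot>\<^bsub>M\<^esub> y = a \<odot>\<^bsub>M\<^esub> h \<oplus>\<^bsub>M\<^esub> a \<odot>\<^bsub>M\<^esub> x"
      using h a x N.a_Hcarr smult_r_distr by simp
    moreover have "a \<odot>\<^bsub>M\<^esub> h \<in> N"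
      using submodule.smult_closed[OF N a h(1)] .
    ultimately have "a \<odot>\<^bsub>M\<^esub> y \<in> N +>\<^bsub>M\<^esub> (a \<odot>\<^bsub>M\<^esub> x)"
      by (auto simp: a_r_coset_def r_coset_def)
    from N.a_repr_independence'[OF this smult_closed[OF a x]] show ?thesis
      by (rule sym)
  qed
  have "x \<in> N +>\<^bsub>M\<^esub> x"
    using N.a_rcos_self x by simp
  then have "(\<Union>y\<in>N +>\<^bsub>M\<^esub> x. N +>\<^bsub>M\<^esub> (a \<odot>\<^bsub>M\<^esub> y)) = (\<Union>y\<in>N +>\<^bsub>M\<^esub> x. N +>\<^bsub>M\<^esub> (a \<odot>\<^bsub>M\<^esub> x))"
    using eq by (intro SUP_cong refl)
  also have "\<dots> = N +>\<^bsub>M\<^esub> (a \<odot>\<^bsub>M\<^esub> x)"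
    using \<open>x \<in> N +>\<^bsub>M\<^esub> x\<close> by (metis SUP_const empty_iff)
  finally show ?thesis
    by (simp only: quot_module_def module.simps)
qed

lemma (in module) quot_module_is_module:
  assumes N: "submodule N R M"
  shows "Module.module R (quot_module M N)"
proof -
  interpret N: abelian_subgroup N M
    by (rule abelian_subgroupI3[OF additive_subgroup.intro[OF submodule.axioms(1)[OF N]]
          M.abelian_group_axioms])
  let ?Q = "quot_module M N"
  have carr: "carrier ?Q = {N +>\<^bsub>M\<^esub> x | x. x \<in> carrier M}"
    by (auto simp: quot_module_def A_RCOSETS_def RCOSETS_def a_r_coset_def)
  have sum: "(N +>\<^bsub>M\<^esub> x) \<oplus>\<^bsub>?Q\<^esub> (N +>\<^bsub>M\<^esub> y) = N +>\<^bsub>M\<^esub> (x \<oplus>\<^bsub>M\<^esub> y)"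
    if "x \<in> carrier M" "y \<in> carrier M" for x y
    using that N.a_rcos_sum by (simp add: quot_module_def)
  have grp: "comm_group (add_monoid ?Q)"
    using N.a_factorgroup_is_comm_group
    unfolding A_FactGroup_def FactGroup_def quot_module_def A_RCOSETS_def set_add_def
      comm_group_def comm_monoid_def comm_monoid_axioms_def group_def group_axioms_def
      monoid_def Units_def partial_object.select_convs monoid.select_convs ring.select_convs .
  have "abelian_group ?Q"
    using grp by (simp add: abelian_group_def abelian_monoid_def abelian_group_axioms_def
        comm_group_def)
  moreover have "\<one> \<odot>\<^bsub>?Q\<^esub> X = X" if "X \<in> carrier ?Q" for X
    using that by (auto simp: carr quot_module_smult[OF N])
  moreover have "a \<odot>\<^bsub>?Q\<^esub> X \<in> carrier ?Q" if "a \<in> carrier R" "X \<in> carrier ?Q" for a X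
    using that by (auto simp: carr quot_module_smult[OF N])
  moreover have "(a \<oplus> b) \<odot>\<^bsub>?Q\<^esub> X = a \<odot>\<^bsub>?Q\<^esub> X \<oplus>\<^bsub>?Q\<^esub> b \<odot>\<^bsub>?Q\<^esub> X"
    if "a \<in> carrier R" "b \<in> carrier R" "X \<in> carrier ?Q" for a b X
    using that by (auto simp: carr quot_module_smult[OF N] sum smult_l_distr)
  moreover have "a \<odot>\<^bsub>?Q\<^esub> (X \<oplus>\<^bsub>?Q\<^esub> Y) = a \<odot>\<^bsub>?Q\<^esub> X \<oplus>\<^bsub>?Q\<^esub> a \<odot>\<^bsub>?Q\<^esub> Y"
    if "a \<in> carrier R" "X \<in> carrier ?Q" "Y \<in> carrier ?Q" for a X Y
    using that by (auto simp: carr quot_module_smult[OF N] sum smult_r_distr)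
  moreover have "(a \<otimes> b) \<odot>\<^bsub>?Q\<^esub> X = a \<odot>\<^bsub>?Q\<^esub> (b \<odot>\<^bsub>?Q\<^esub> X)"
    if "a \<in> carrier R" "b \<in> carrier R" "X \<in> carrier ?Q" for a b X
    using that by (auto simp: carr quot_module_smult[OF N] smult_assoc1)
  ultimately show ?thesis
    by (intro moduleI) (simp_all add: R.is_cring)
qed

definition module_length :: "('a, 'r) ring_scheme \<Rightarrow> ('a, 'b, 'm) module_scheme \<Rightarrow> enat" where
  "module_length R M =
     (SUP n \<in> {n. \<exists>C. (\<forall>k\<le>n. submodule (C k) R M) \<and> (\<forall>k<n. C k \<subset> C (Suc k))}. enat n)"

text \<open>\<open>\<ell>\<^sub>R(M/IM)\<close> as a real number. It is only meant for those \<open>I\<close> for which this length is finite;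
  \<open>the_enat \<infinity>\<close> is unspecified.\<close>

definition colength :: "('a, 'r) ring_scheme \<Rightarrow> ('a, 'b, 'm) module_scheme \<Rightarrow> 'a set \<Rightarrow> real" where
  "colength R M I = real (the_enat (module_length R (quot_module M (ideal_smult R M I))))"


section \<open>Graded families\<close>

definition radical_ideal :: "('a, 'r) ring_scheme \<Rightarrow> 'a set \<Rightarrow> 'a set" where
  "radical_ideal R I = {a \<in> carrier R. \<exists>n::nat. a [^]\<^bsub>R\<^esub> n \<in> I}"

definition primary_ideal :: "('a, 'r) ring_scheme \<Rightarrow> 'a set \<Rightarrow> bool" where
  "primary_ideal R I \<longleftrightarrow> ideal I R \<and> I \<noteq> carrier R \<and>
     (\<forall>a \<in> carrier R. \<forall>b \<in> carrier R. a \<otimes>\<^bsub>R\<^esub> b \<in> I \<longrightarrow> a \<in> I \<or> b \<in> radical_ideal R I)"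

definition primary_to :: "('a, 'r) ring_scheme \<Rightarrow> 'a set \<Rightarrow> 'a set \<Rightarrow> bool" where
  "primary_to R \<mm> I \<longleftrightarrow> primary_ideal R I \<and> radical_ideal R I = \<mm>"

definition graded_primary_family :: "('a, 'r) ring_scheme \<Rightarrow> 'a set \<Rightarrow> (nat \<Rightarrow> 'a set) \<Rightarrow> bool" where
  "graded_primary_family R \<mm> I \<longleftrightarrow>
     I 0 = carrier R \<and> (\<forall>n>0. primary_to R \<mm> (I n)) \<and>
     (\<forall>m n. I m \<otimes>\<^bsub>ideals_set R\<^esub> I n \<subseteq> I (m + n))"

text \<open>\<open>\<Oplus>\<^sub>n I\<^sub>n t\<^sup>n\<close> as a subalgebra of \<open>R[t]\<close>.\<close>

definition rees_algebra :: "('a, 'r) ring_scheme \<Rightarrow> (nat \<Rightarrow> 'a set) \<Rightarrow> ('a, nat \<Rightarrow> 'a) up_ring" where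
  "rees_algebra R I = (UP R)\<lparr>carrier := {p \<in> carrier (UP R). \<forall>n. coeff (UP R) p n \<in> I n}\<rparr>"

definition fin_gen_algebra :: "('a, 'r) ring_scheme \<Rightarrow> ('a, 'b, 'm) module_scheme \<Rightarrow> bool" where
  "fin_gen_algebra R A \<longleftrightarrow>
     (\<exists>F \<subseteq> carrier A. finite F \<and>
        generate_ring A ((\<lambda>a. a \<odot>\<^bsub>A\<^esub> \<one>\<^bsub>A\<^esub>) ` carrier R \<union> F) = carrier A)"

definition noetherian_family :: "('a, 'r) ring_scheme \<Rightarrow> (nat \<Rightarrow> 'a set) \<Rightarrow> bool" where
  "noetherian_family R I \<longleftrightarrow> fin_gen_algebra R (rees_algebra R I)"


section \<open>Multiplicities\<close>

definition hs_mult :: "('a, 'r) ring_scheme \<Rightarrow> ('a, 'b, 'm) module_scheme \<Rightarrow> 'a set \<Rightarrow> real" where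
  "hs_mult R M I = (let d = the_enat (krull_dim R) in
     lim (\<lambda>n::nat. fact d * colength R M (I [^]\<^bsub>ideals_set R\<^esub> n) / real n ^ d))"

text \<open>A real polynomial in the variables \<open>'k\<close> is given by its finitely supported family of
  coefficients, indexed by the exponent vectors.\<close>

definition poly_fun :: "(('k::finite \<Rightarrow> nat) \<Rightarrow> real) \<Rightarrow> ('k \<Rightarrow> nat) \<Rightarrow> real" where
  "poly_fun c n = (\<Sum>\<alpha> | c \<alpha> \<noteq> 0. c \<alpha> * (\<Prod>i\<in>UNIV. real (n i) ^ \<alpha> i))"

definition mixed_hilbert_coeffs ::
    "('a, 'r) ring_scheme \<Rightarrow> ('a, 'b, 'm) module_scheme \<Rightarrow> ('k::finite \<Rightarrow> 'a set) \<Rightarrow>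
     ('k \<Rightarrow> nat) \<Rightarrow> real" where
  "mixed_hilbert_coeffs R M I = (THE c. finite {\<alpha>. c \<alpha> \<noteq> 0} \<and>
     (\<exists>N. \<forall>n. (\<forall>i. N \<le> n i) \<longrightarrow>
        colength R M (\<Otimes>\<^bsub>ideals_set R\<^esub>i\<in>UNIV. I i [^]\<^bsub>ideals_set R\<^esub> n i) = poly_fun c n))"

text \<open>\<open>e(I\<^sub>1\<^sup>[\<^sup>d\<^sub>1\<^sup>], \<dots>, I\<^sub>s\<^sup>[\<^sup>d\<^sub>s\<^sup>]; M)\<close>, meaningful for \<open>d\<^sub>1 + \<dots> + d\<^sub>s = dim R\<close>.\<close>

definition mixed_mult ::
    "('a, 'r) ring_scheme \<Rightarrow> ('a, 'b, 'm) module_scheme \<Rightarrow> ('k::finite \<Rightarrow> 'a set) \<Rightarrow>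
     ('k \<Rightarrow> nat) \<Rightarrow> real" where
  "mixed_mult R M I ds = (\<Prod>i\<in>UNIV. fact (ds i)) * mixed_hilbert_coeffs R M I ds"

definition family_mult_fun ::
    "('a, 'r) ring_scheme \<Rightarrow> ('a, 'b, 'm) module_scheme \<Rightarrow> ('k::finite \<Rightarrow> nat \<Rightarrow> 'a set) \<Rightarrow>
     ('k \<Rightarrow> nat) \<Rightarrow> real" where
  "family_mult_fun R M I n = lim (\<lambda>m::nat.
     hs_mult R M (\<Otimes>\<^bsub>ideals_set R\<^esub>i\<in>UNIV. I i (m * n i)) / real m ^ the_enat (krull_dim R))"

definition family_mult_coeffs ::
    "('a, 'r) ring_scheme \<Rightarrow> ('a, 'b, 'm) module_scheme \<Rightarrow> ('k::finite \<Rightarrow> nat \<Rightarrow> 'a set) \<Rightarrow>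
     ('k \<Rightarrow> nat) \<Rightarrow> real" where
  "family_mult_coeffs R M I = (THE c. finite {\<alpha>. c \<alpha> \<noteq> 0} \<and>
     (\<forall>\<alpha>. c \<alpha> \<noteq> 0 \<longrightarrow> (\<Sum>i\<in>UNIV. \<alpha> i) = the_enat (krull_dim R)) \<and>
     (\<forall>n. family_mult_fun R M I n = poly_fun c n))"

definition family_mixed_mult ::
    "('a, 'r) ring_scheme \<Rightarrow> ('a, 'b, 'm) module_scheme \<Rightarrow> ('k::finite \<Rightarrow> nat \<Rightarrow> 'a set) \<Rightarrow>
     ('k \<Rightarrow> nat) \<Rightarrow> real" where
  "family_mixed_mult R M I ds =
     (\<Prod>i\<in>UNIV. fact (ds i)) / fact (the_enat (krull_dim R)) * family_mult_coeffs R M I ds"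


section \<open>Joint reductions\<close>

text \<open>The tuple is indexed by an arbitrary finite set \<open>K\<close>; its order plays no role.\<close>

definition joint_reduction ::
    "('a, 'r) ring_scheme \<Rightarrow> ('a, 'b, 'm) module_scheme \<Rightarrow> 'i set \<Rightarrow> ('i \<Rightarrow> 'a) \<Rightarrow> ('i \<Rightarrow> 'a set) \<Rightarrow>
     bool" where
  "joint_reduction R M K x J \<longleftrightarrow> (\<forall>i\<in>K. x i \<in> J i) \<and>
     (let H = (\<Oplus>\<^bsub>ideals_set R\<^esub>i\<in>K.
                 (PIdl\<^bsub>R\<^esub> (x i)) \<otimes>\<^bsub>ideals_set R\<^esub> (\<Otimes>\<^bsub>ideals_set R\<^esub>j\<in>K - {i}. J j));
          L = (\<Otimes>\<^bsub>ideals_set R\<^esub>i\<in>K. J i)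
      in \<exists>r::nat. ideal_smult R M (H \<otimes>\<^bsub>ideals_set R\<^esub> (L [^]\<^bsub>ideals_set R\<^esub> r)) =
                  ideal_smult R M (L [^]\<^bsub>ideals_set R\<^esub> Suc r))"

definition type_index :: "('k \<Rightarrow> nat) \<Rightarrow> ('k \<times> nat) set" where
  "type_index r = (SIGMA i:UNIV. {1..r i})"

definition weak_asymp_joint_reduction ::
    "('a, 'r) ring_scheme \<Rightarrow> ('a, 'b, 'm) module_scheme \<Rightarrow> ('k::finite \<Rightarrow> nat \<Rightarrow> 'a set) \<Rightarrow>
     ('k \<Rightarrow> nat) \<Rightarrow> nat \<Rightarrow> (nat \<Rightarrow> 'k \<times> nat \<Rightarrow> 'a) \<Rightarrow> bool" where
  "weak_asymp_joint_reduction R M I r n0 x \<longleftrightarrow>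
     (\<forall>n\<ge>n0. joint_reduction R M (type_index r) (x n) (\<lambda>(i, j). I i n))"

end

theory Submission
  imports Defs "HOL-Library.Function_Algebras" "HOL-Computational_Algebra.Polynomial"
begin

text \<open>
  Rees' theorem \<open>e(x; M) = e(J\<^sub>1, \<dots>, J\<^sub>d; M)\<close> for a joint reduction \<open>x\<close> is proved without superficial elements
  and without Koszul homology. For a multigraded family \<open>U(n) \<subseteq> M\<close> the iterated difference of
  \<open>\<ell>(M/U(n))\<close> along \<open>x\<^sub>1, \<dots>, x\<^sub>d\<close> is computed one step at a time: multiplication by \<open>x\<^sub>k\<close> turns a
  difference of lengths into the length of a cokernel minus that of a kernel. Up to a subquotient of
  \<open>U\<close>, both are again of the form \<open>N/U'(n)\<close> with \<open>N\<close> a cokernel or kernel of \<open>x\<^sub>k\<close>, so that the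
  difference becomes the multiplicity symbol \<open>\<chi>(x; M)\<close> of Northcott and Wright, which does not depend on
  \<open>U\<close>. The error terms vanish in large degrees because, by Artin--Rees, every subquotient of \<open>\<Oplus> J\<^sup>n M\<close>
  annihilated by a joint reduction does. Applied to \<open>J\<^sup>n M\<close> and to \<open>Q\<^sup>n M\<close>, this gives both sides of
  Rees' theorem, and the second case also bounds the degrees of Hilbert polynomials by \<open>d\<close>.

  A Noetherian family satisfies \<open>I\<^sub>n = I\<^sub>w I\<^sub>n\<^sub>-\<^sub>w\<close> for some \<open>w\<close> and all large \<open>n\<close>, by the pigeonhole
  principle applied to the degrees of a product of generators; a multiple \<open>c\<close> of \<open>w\<close> then has
  \<open>I\<^sub>c\<^sub>m = I\<^sub>c\<^sup>m\<close>. Since the families need not be decreasing, the mixed multiplicities of the families are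
  obtained by squeezing \<open>I\<^sub>n\<close> between powers of \<open>I\<^sub>c\<close> with exponents \<open>n/c + O(1)\<close>.
\<close>

section \<open>The lattice of submodules\<close>

text \<open>Everything takes place inside the one module \<open>M\<close>. A subquotient is a pair
  of submodules, its length is the length of an interval in the modular lattice of submodules, and a
  graded module is a family of submodules indexed by multidegrees. Kernels and cokernels of
  multiplication are again intervals, so inductions that pass to them never leave the setting. The
  obstacle is that the kernel of x on M/U(n) is not of the form N/U'(n). It contains such a piece,
  coming from the kernel of x on \<open>M\<close>, and x carries what is left into a subquotient of
  U. For this reason \<open>difs_len_vanish\<close> precedes \<open>difs_len_eq_chi\<close>. A
  second obstacle: the ideal Q generated by a joint reduction with respect to \<open>M\<close>
  satisfies \<mm>^N M \<subseteq> QM for some N, but need not be \<mm>-primary. Ideals are therefore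
  compared through their action on \<open>M\<close>, and the predicate \<open>cof\<close> takes the
  place of being \<mm>-primary.\<close>

context module
begin

text \<open>\<open>act\<close> and \<open>col\<close> are direct and inverse image under
  multiplication by \<open>a\<close>, so \<open>col a A\<close> is the colon module A : a. They form
  a Galois connection (\<open>act_le_iff\<close>).\<close>

definition act :: "'a \<Rightarrow> 'c set \<Rightarrow> 'c set" where
  "act a A = (\<lambda>z. a \<odot>\<^bsub>M\<^esub> z) ` A"

definition col :: "'a \<Rightarrow> 'c set \<Rightarrow> 'c set" where
  "col a A = {z \<in> carrier M. a \<odot>\<^bsub>M\<^esub> z \<in> A}"

definition sm :: "'c set \<Rightarrow> bool" where
  "sm A \<longleftrightarrow> submodule A R M"

abbreviation pl :: "'c set \<Rightarrow> 'c set \<Rightarrow> 'c set" (infixl "\<boxplus>" 65) where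
  "A \<boxplus> B \<equiv> A <+>\<^bsub>M\<^esub> B"

lemma smI:
  assumes "A \<subseteq> carrier M" "\<zero>\<^bsub>M\<^esub> \<in> A" "\<And>x y. x \<in> A \<Longrightarrow> y \<in> A \<Longrightarrow> x \<oplus>\<^bsub>M\<^esub> y \<in> A"
    "\<And>a x. a \<in> carrier R \<Longrightarrow> x \<in> A \<Longrightarrow> a \<odot>\<^bsub>M\<^esub> x \<in> A"
  shows "sm A"
  unfolding sm_def
proof (rule submoduleI)
  fix x assume x: "x \<in> A"
  then have "(\<ominus>\<^bsub>R\<^esub> \<one>\<^bsub>R\<^esub>) \<odot>\<^bsub>M\<^esub> x = \<ominus>\<^bsub>M\<^esub> x"
    using assms(1) by (subst smult_l_minus) auto
  moreover have "(\<ominus>\<^bsub>R\<^esub> \<one>\<^bsub>R\<^esub>) \<odot>\<^bsub>M\<^esub> x \<in> A"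
    using assms(4) x by simp
  ultimately show "\<ominus>\<^bsub>M\<^esub> x \<in> A" by simp
qed (use assms in auto)

lemma
  assumes "sm A"
  shows sm_carr: "A \<subseteq> carrier M"
    and sm_zero: "\<zero>\<^bsub>M\<^esub> \<in> A"
    and sm_add: "x \<in> A \<Longrightarrow> y \<in> A \<Longrightarrow> x \<oplus>\<^bsub>M\<^esub> y \<in> A"
    and sm_minus: "x \<in> A \<Longrightarrow> \<ominus>\<^bsub>M\<^esub> x \<in> A"
    and sm_smult: "a \<in> carrier R \<Longrightarrow> x \<in> A \<Longrightarrow> a \<odot>\<^bsub>M\<^esub> x \<in> A"
proof -
  note E = submoduleE[OF assms[unfolded sm_def]]
  show "A \<subseteq> carrier M" using E(1) .
  show "\<zero>\<^bsub>M\<^esub> \<in> A"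
    using E(1,2,4) smult_l_null R.zero_closed by (metis all_not_in_conv subsetD)
  show "x \<in> A \<Longrightarrow> y \<in> A \<Longrightarrow> x \<oplus>\<^bsub>M\<^esub> y \<in> A" using E(5) .
  show "x \<in> A \<Longrightarrow> \<ominus>\<^bsub>M\<^esub> x \<in> A" using E(3) .
  show "a \<in> carrier R \<Longrightarrow> x \<in> A \<Longrightarrow> a \<odot>\<^bsub>M\<^esub> x \<in> A" using E(4) .
qed

lemma sm_mem: "sm A \<Longrightarrow> x \<in> A \<Longrightarrow> x \<in> carrier M"
  using sm_carr by blast

lemma sm_diff: "sm A \<Longrightarrow> x \<in> A \<Longrightarrow> y \<in> A \<Longrightarrow> x \<ominus>\<^bsub>M\<^esub> y \<in> A"
  by (simp add: a_minus_def sm_add sm_minus)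

lemma pl_iff: "z \<in> A \<boxplus> B \<longleftrightarrow> (\<exists>x\<in>A. \<exists>y\<in>B. z = x \<oplus>\<^bsub>M\<^esub> y)"
  by (auto simp: set_add_def set_mult_def)

lemma sm_carrier [simp]: "sm (carrier M)"
  by (simp add: sm_def carrier_is_submodule)

lemma sm_bot [simp]: "sm {\<zero>\<^bsub>M\<^esub>}"
  by (rule smI) auto

lemma sm_int [simp]: "sm A \<Longrightarrow> sm B \<Longrightarrow> sm (A \<inter> B)"
  by (rule smI) (auto dest: sm_mem simp: sm_zero sm_add sm_smult)

lemma sm_pl [simp]:
  assumes "sm A" "sm B" shows "sm (A \<boxplus> B)"
proof (rule smI)
  show "A \<boxplus> B \<subseteq> carrier M" using assms by (auto simp: pl_iff sm_mem)
  show "\<zero>\<^bsub>M\<^esub> \<in> A \<boxplus> B" using assms sm_zero[of A] sm_zero[of B] by (force simp: pl_iff)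
next
  fix x y assume "x \<in> A \<boxplus> B" "y \<in> A \<boxplus> B"
  then obtain a b a' b' where *: "a \<in> A" "b \<in> B" "a' \<in> A" "b' \<in> B"
    and e: "x = a \<oplus>\<^bsub>M\<^esub> b" "y = a' \<oplus>\<^bsub>M\<^esub> b'" by (auto simp: pl_iff)
  have "x \<oplus>\<^bsub>M\<^esub> y = (a \<oplus>\<^bsub>M\<^esub> a') \<oplus>\<^bsub>M\<^esub> (b \<oplus>\<^bsub>M\<^esub> b')"
    using * assms by (simp add: e sm_mem M.a_ac)
  then show "x \<oplus>\<^bsub>M\<^esub> y \<in> A \<boxplus> B" using * assms unfolding pl_iff by (metis sm_add)
next
  fix r x assume r: "r \<in> carrier R" and "x \<in> A \<boxplus> B"
  then obtain a b where *: "a \<in> A" "b \<in> B" and e: "x = a \<oplus>\<^bsub>M\<^esub> b" by (auto simp: pl_iff)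
  have "r \<odot>\<^bsub>M\<^esub> x = r \<odot>\<^bsub>M\<^esub> a \<oplus>\<^bsub>M\<^esub> r \<odot>\<^bsub>M\<^esub> b" using * r assms by (simp add: e sm_mem smult_r_distr)
  then show "r \<odot>\<^bsub>M\<^esub> x \<in> A \<boxplus> B" using * assms r unfolding pl_iff by (metis sm_smult)
qed

lemma sm_act [simp]:
  assumes a: "a \<in> carrier R" and A: "sm A" shows "sm (act a A)"
proof (rule smI)
  show "act a A \<subseteq> carrier M" using assms by (auto simp: act_def sm_mem)
  show "\<zero>\<^bsub>M\<^esub> \<in> act a A" using sm_zero[OF A] a by (force simp: act_def)
next
  fix x y assume "x \<in> act a A" "y \<in> act a A"
  then obtain u v where *: "u \<in> A" "v \<in> A" "x = a \<odot>\<^bsub>M\<^esub> u" "y = a \<odot>\<^bsub>M\<^esub> v" by (auto simp: act_def)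
  then have "x \<oplus>\<^bsub>M\<^esub> y = a \<odot>\<^bsub>M\<^esub> (u \<oplus>\<^bsub>M\<^esub> v)" using A a by (simp add: sm_mem smult_r_distr)
  then show "x \<oplus>\<^bsub>M\<^esub> y \<in> act a A" using * A by (auto simp: act_def sm_add)
next
  fix r x assume r: "r \<in> carrier R" and "x \<in> act a A"
  then obtain u where *: "u \<in> A" "x = a \<odot>\<^bsub>M\<^esub> u" by (auto simp: act_def)
  then have "r \<odot>\<^bsub>M\<^esub> x = a \<odot>\<^bsub>M\<^esub> (r \<odot>\<^bsub>M\<^esub> u)"
    using A a r by (metis R.m_comm sm_mem smult_assoc1)
  then show "r \<odot>\<^bsub>M\<^esub> x \<in> act a A" using * A r by (auto simp: act_def sm_smult)
qed

lemma sm_col [simp]: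
  assumes a: "a \<in> carrier R" and A: "sm A" shows "sm (col a A)"
proof (rule smI)
  show "\<zero>\<^bsub>M\<^esub> \<in> col a A" using sm_zero[OF A] a by (simp add: col_def)
next
  fix r x assume r: "r \<in> carrier R" and x: "x \<in> col a A"
  then have "a \<odot>\<^bsub>M\<^esub> (r \<odot>\<^bsub>M\<^esub> x) = r \<odot>\<^bsub>M\<^esub> (a \<odot>\<^bsub>M\<^esub> x)"
    using a by (metis (lifting) R.m_comm col_def mem_Collect_eq smult_assoc1)
  then show "r \<odot>\<^bsub>M\<^esub> x \<in> col a A" using x r A by (simp add: col_def sm_smult)
qed (use assms in \<open>auto simp: col_def smult_r_distr sm_add\<close>)

lemma sm_UN:
  assumes "\<And>i. sm (F i)" "\<And>i. F i \<subseteq> F (Suc i)" shows "sm (\<Union>i. F i)"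
proof (rule smI)
  have mono: "F i \<subseteq> F j" if "i \<le> j" for i j using lift_Suc_mono_le[of F, OF assms(2) that] .
  fix x y assume "x \<in> (\<Union>i. F i)" "y \<in> (\<Union>i. F i)"
  then obtain i j where "x \<in> F i" "y \<in> F j" by blast
  then have "x \<in> F (max i j)" "y \<in> F (max i j)" using mono[of i "max i j"] mono[of j "max i j"] by auto
  then show "x \<oplus>\<^bsub>M\<^esub> y \<in> (\<Union>i. F i)" using assms(1) sm_add by blast
qed (use assms(1) in \<open>auto simp: sm_zero intro: sm_mem sm_smult\<close>)

lemma bot_least: "sm A \<Longrightarrow> {\<zero>\<^bsub>M\<^esub>} \<subseteq> A" by (simp add: sm_zero)

lemma pl_upper1: assumes "sm A" "sm B" shows "A \<subseteq> A \<boxplus> B"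
proof
  fix x assume "x \<in> A"
  then have "x = x \<oplus>\<^bsub>M\<^esub> \<zero>\<^bsub>M\<^esub>" using assms by (simp add: sm_mem)
  then show "x \<in> A \<boxplus> B" using \<open>x \<in> A\<close> assms unfolding pl_iff by (metis sm_zero)
qed

lemma pl_upper2: assumes "sm A" "sm B" shows "B \<subseteq> A \<boxplus> B"
proof
  fix x assume "x \<in> B"
  then have "x = \<zero>\<^bsub>M\<^esub> \<oplus>\<^bsub>M\<^esub> x" using assms by (simp add: sm_mem)
  then show "x \<in> A \<boxplus> B" using \<open>x \<in> B\<close> assms unfolding pl_iff by (metis sm_zero)
qed

lemma pl_least: "sm C \<Longrightarrow> A \<subseteq> C \<Longrightarrow> B \<subseteq> C \<Longrightarrow> A \<boxplus> B \<subseteq> C"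
  by (auto simp: pl_iff sm_add subset_iff)

lemma pl_mono: "A \<subseteq> A' \<Longrightarrow> B \<subseteq> B' \<Longrightarrow> A \<boxplus> B \<subseteq> A' \<boxplus> B'"
  unfolding subset_iff pl_iff by blast

lemma pl_absorb: "sm A \<Longrightarrow> sm B \<Longrightarrow> B \<subseteq> A \<Longrightarrow> A \<boxplus> B = A"
  by (intro subset_antisym pl_least pl_upper1) auto

lemma add_cancel [simp]:
  "x \<in> carrier M \<Longrightarrow> y \<in> carrier M \<Longrightarrow> x \<oplus>\<^bsub>M\<^esub> (y \<oplus>\<^bsub>M\<^esub> \<ominus>\<^bsub>M\<^esub> x) = y"
  by (metis M.a_comm M.add.inv_closed M.r_neg2)

lemma modular:
  assumes "sm A" "sm B" "sm C" "A \<subseteq> C" shows "(A \<boxplus> B) \<inter> C = A \<boxplus> (B \<inter> C)"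
proof (intro subset_antisym subsetI)
  fix z assume z: "z \<in> (A \<boxplus> B) \<inter> C"
  then obtain x y where *: "x \<in> A" "y \<in> B" and e: "z = x \<oplus>\<^bsub>M\<^esub> y" by (auto simp: pl_iff)
  have "y = z \<ominus>\<^bsub>M\<^esub> x"
    using * assms e by (simp add: a_minus_def sm_mem M.a_ac M.r_neg)
  then have "y \<in> C" using z * assms by (auto intro!: sm_diff)
  then show "z \<in> A \<boxplus> (B \<inter> C)" using * e by (auto simp: pl_iff)
next
  fix z assume "z \<in> A \<boxplus> (B \<inter> C)"
  then show "z \<in> (A \<boxplus> B) \<inter> C" using assms by (auto simp: pl_iff subset_iff sm_add)
qed

lemma act_le_iff: "sm A \<Longrightarrow> act a A \<subseteq> B \<longleftrightarrow> A \<subseteq> col a B"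
  by (auto simp: act_def col_def subset_iff sm_mem)

lemma act_mono: "A \<subseteq> B \<Longrightarrow> act a A \<subseteq> act a B" by (auto simp: act_def)
lemma col_mono: "A \<subseteq> B \<Longrightarrow> col a A \<subseteq> col a B" by (auto simp: col_def)

lemma act_le: "a \<in> carrier R \<Longrightarrow> sm A \<Longrightarrow> act a A \<subseteq> A"
  by (auto simp: act_def sm_smult)

lemma le_col: "a \<in> carrier R \<Longrightarrow> sm A \<Longrightarrow> A \<subseteq> col a A"
  by (auto simp: col_def sm_smult sm_mem)

lemma act_commute: "a \<in> carrier R \<Longrightarrow> b \<in> carrier R \<Longrightarrow> sm A \<Longrightarrow> act a (act b A) = act b (act a A)"
  unfolding act_def image_image
  by (intro image_cong refl) (metis R.m_comm sm_mem smult_assoc1)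

lemma act_col_le:
  assumes "a \<in> carrier R" "b \<in> carrier R" shows "act a (col b A) \<subseteq> col b (act a A)"
proof
  fix z assume "z \<in> act a (col b A)"
  then obtain u where u: "u \<in> carrier M" "b \<odot>\<^bsub>M\<^esub> u \<in> A" "z = a \<odot>\<^bsub>M\<^esub> u" by (auto simp: act_def col_def)
  then have "b \<odot>\<^bsub>M\<^esub> z = a \<odot>\<^bsub>M\<^esub> (b \<odot>\<^bsub>M\<^esub> u)" using assms by (metis R.m_comm smult_assoc1)
  then show "z \<in> col b (act a A)" using u assms by (auto simp: act_def col_def)
qed

lemma act_pl: "a \<in> carrier R \<Longrightarrow> sm A \<Longrightarrow> sm B \<Longrightarrow> act a (A \<boxplus> B) = act a A \<boxplus> act a B"
proof (intro subset_antisym subsetI)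
  assume h: "a \<in> carrier R" "sm A" "sm B"
  fix z
  show "z \<in> act a A \<boxplus> act a B" if "z \<in> act a (A \<boxplus> B)"
  proof -
    obtain x y where "x \<in> A" "y \<in> B" "z = a \<odot>\<^bsub>M\<^esub> (x \<oplus>\<^bsub>M\<^esub> y)" using \<open>z \<in> act a (A \<boxplus> B)\<close> by (auto simp: act_def pl_iff)
    then have "z = a \<odot>\<^bsub>M\<^esub> x \<oplus>\<^bsub>M\<^esub> a \<odot>\<^bsub>M\<^esub> y" using h by (simp add: sm_mem smult_r_distr)
    then show ?thesis using \<open>x \<in> A\<close> \<open>y \<in> B\<close> unfolding pl_iff act_def by blast
  qed
  show "z \<in> act a (A \<boxplus> B)" if "z \<in> act a A \<boxplus> act a B"
  proof -
    obtain x y where "x \<in> A" "y \<in> B" "z = a \<odot>\<^bsub>M\<^esub> x \<oplus>\<^bsub>M\<^esub> a \<odot>\<^bsub>M\<^esub> y"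
      using \<open>z \<in> act a A \<boxplus> act a B\<close> by (auto simp: act_def pl_iff)
    then have "z = a \<odot>\<^bsub>M\<^esub> (x \<oplus>\<^bsub>M\<^esub> y)" using h by (simp add: sm_mem smult_r_distr)
    then show ?thesis using \<open>x \<in> A\<close> \<open>y \<in> B\<close> unfolding act_def by (metis image_eqI pl_iff)
  qed
qed

lemma act_bot: "a \<in> carrier R \<Longrightarrow> act a {\<zero>\<^bsub>M\<^esub>} = {\<zero>\<^bsub>M\<^esub>}" by (auto simp: act_def)

lemma act_int_col: "sm A \<Longrightarrow> act a (A \<inter> col a B) = act a A \<inter> B"
  by (auto simp: act_def col_def sm_mem)

text \<open>If az = b + au with u in A, then z - u lies in B : a. Together with
  \<open>act_int_col\<close> this identity makes the maps given by \<open>act\<close> and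
  \<open>col\<close> between two intervals mutually inverse.\<close>

lemma col_pl_act:
  assumes a: "a \<in> carrier R" and sm: "sm A" "sm B"
  shows "col a (B \<boxplus> act a A) = col a B \<boxplus> A"
proof (intro subset_antisym subsetI)
  fix z assume z: "z \<in> col a (B \<boxplus> act a A)"
  then obtain b u where *: "z \<in> carrier M" "b \<in> B" "u \<in> A" "a \<odot>\<^bsub>M\<^esub> z = b \<oplus>\<^bsub>M\<^esub> a \<odot>\<^bsub>M\<^esub> u"
    by (auto simp: col_def pl_iff act_def)
  have c: "u \<in> carrier M" "b \<in> carrier M" using * sm sm_mem by auto
  have "a \<odot>\<^bsub>M\<^esub> (z \<ominus>\<^bsub>M\<^esub> u) = b"
    using * a c by (simp add: a_minus_def smult_r_distr smult_r_minus M.a_ac M.r_neg)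
  then have "z \<ominus>\<^bsub>M\<^esub> u \<in> col a B" using * c by (simp add: col_def)
  moreover have "z = (z \<ominus>\<^bsub>M\<^esub> u) \<oplus>\<^bsub>M\<^esub> u" using * c by (simp add: a_minus_def M.a_ac M.l_neg)
  ultimately show "z \<in> col a B \<boxplus> A" using *(3) unfolding pl_iff by blast
next
  fix z assume "z \<in> col a B \<boxplus> A"
  then obtain w u where *: "w \<in> carrier M" "a \<odot>\<^bsub>M\<^esub> w \<in> B" "u \<in> A" "z = w \<oplus>\<^bsub>M\<^esub> u"
    by (auto simp: col_def pl_iff)
  have c: "u \<in> carrier M" using * sm sm_mem by auto
  have "a \<odot>\<^bsub>M\<^esub> z = a \<odot>\<^bsub>M\<^esub> w \<oplus>\<^bsub>M\<^esub> a \<odot>\<^bsub>M\<^esub> u" using * c a by (simp add: smult_r_distr)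
  then show "z \<in> col a (B \<boxplus> act a A)" using * c unfolding col_def pl_iff act_def by blast
qed

lemma pl_comm: "sm A \<Longrightarrow> sm B \<Longrightarrow> A \<boxplus> B = B \<boxplus> A"
  unfolding set_eq_iff pl_iff by (metis M.a_comm sm_mem)

section \<open>Length of subquotients\<close>

text \<open>\<open>chain n A B\<close> says that B/A has length at least n: even
  \<open>chain 0 A B\<close> allows A to be smaller than B, so the strict chain may start anywhere
  above A. With this slack the predicate is downward closed in n, and finite length means that it
  fails for some n.\<close>

primrec chain :: "nat \<Rightarrow> 'c set \<Rightarrow> 'c set \<Rightarrow> bool" where
  "chain 0 A B \<longleftrightarrow> sm A \<and> sm B \<and> A \<subseteq> B"
| "chain (Suc n) A B \<longleftrightarrow> (\<exists>C. chain n A C \<and> sm B \<and> C \<subset> B)"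

definition len :: "'c set \<Rightarrow> 'c set \<Rightarrow> enat" where
  "len A B = (SUP n \<in> {n. chain n A B}. enat n)"

definition fin :: "'c set \<Rightarrow> 'c set \<Rightarrow> bool" where
  "fin A B \<longleftrightarrow> len A B < \<infinity>"

text \<open>Real values, because lengths get subtracted. For an interval of infinite length the
  value is unspecified, hence the premises \<open>fin\<close> in the additivity statements.\<close>

definition rl :: "'c set \<Rightarrow> 'c set \<Rightarrow> real" where
  "rl A B = real (the_enat (len A B))"

lemma chain_sm: "chain n A B \<Longrightarrow> sm A \<and> sm B \<and> A \<subseteq> B"
  by (induction n arbitrary: B) auto

lemma chain_Suc: "chain (Suc n) A B \<Longrightarrow> chain n A B"
proof (induction n arbitrary: B)
  case 0 then show ?case using chain_sm by auto
next
  case (Suc n) then show ?case by (meson chain.simps(2))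
qed

lemma chain_mono: "chain n A B \<Longrightarrow> m \<le> n \<Longrightarrow> chain m A B"
  by (induction n) (auto simp: le_Suc_eq simp del: chain.simps dest: chain_Suc)

lemma chain_trans: "chain m A B \<Longrightarrow> chain n B C \<Longrightarrow> chain (m + n) A C"
proof (induction n arbitrary: C)
  case 0
  then have h: "chain m A B" "sm C" "B \<subseteq> C" by auto
  show ?case
  proof (cases "B = C")
    case False
    then have "chain (Suc m) A C" using h by (auto simp del: chain.simps(1) simp add: psubset_eq)
    then show ?thesis using chain_Suc by simp
  qed (use h in simp)
next
  case (Suc n) then show ?case by auto
qed

text \<open>A chain is cut at B by intersecting its members with B and by adding B to them. By the
  modular law a strict inclusion stays strict in at least one of the two images, so no step is
  lost.\<close>

lemma chain_split:
  assumes "chain n A C" "sm B" "A \<subseteq> B" "B \<subseteq> C"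
  shows "\<exists>p q. n \<le> p + q \<and> chain p A B \<and> chain q B C"
proof -
  have "\<exists>p q. n \<le> p + q \<and> chain p A (B \<inter> D) \<and> chain q B (B \<boxplus> D)" if "chain n A D" for D
    using that
  proof (induction n arbitrary: D)
    case 0
    then show ?case using assms(2,3) pl_upper1 by (intro exI[of _ 0]) auto
  next
    case (Suc n)
    then obtain E where E: "chain n A E" "sm D" "E \<subset> D" by auto
    then obtain p q where pq: "n \<le> p + q" "chain p A (B \<inter> E)" "chain q B (B \<boxplus> E)"
      using Suc.IH by blast
    have smE: "sm E" "A \<subseteq> E" using E(1) chain_sm by auto
    have le: "B \<inter> E \<subseteq> B \<inter> D" using E(3) by auto
    have le2: "B \<boxplus> E \<subseteq> B \<boxplus> D" using E(3) by (intro pl_mono) auto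
    have ne: "B \<inter> E \<noteq> B \<inter> D \<or> B \<boxplus> E \<noteq> B \<boxplus> D"
    proof (rule ccontr)
      assume "\<not> ?thesis"
      then have *: "B \<inter> E = B \<inter> D" "B \<boxplus> E = B \<boxplus> D" by auto
      have "D \<subseteq> (E \<boxplus> B) \<inter> D" using * pl_upper2[of B D] pl_comm[of B E] assms(2) E smE by auto
      also have "\<dots> = E \<boxplus> (B \<inter> D)" using modular assms(2) E smE by auto
      also have "\<dots> \<subseteq> E" using * smE by (intro pl_least) auto
      finally show False using E by auto
    qed
    have s: "sm (B \<inter> D)" "sm (B \<boxplus> D)" using assms(2) E by auto
    have p: "chain (if B \<inter> E = B \<inter> D then p else Suc p) A (B \<inter> D)"
      using pq le le2 s by (auto simp: psubset_eq)
    have q: "chain (if B \<boxplus> E = B \<boxplus> D then q else Suc q) B (B \<boxplus> D)"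
      using pq le le2 s by (auto simp: psubset_eq)
    show ?case using ne pq(1)
      by (intro exI[of _ "if B \<inter> E = B \<inter> D then p else Suc p"]
          exI[of _ "if B \<boxplus> E = B \<boxplus> D then q else Suc q"] conjI p q) auto
  qed
  from this[OF assms(1)] obtain p q where
    "n \<le> p + q \<and> chain p A (B \<inter> C) \<and> chain q B (B \<boxplus> C)" by blast
  moreover have "B \<inter> C = B" using assms by auto
  moreover have "B \<boxplus> C = C" using assms chain_sm[OF assms(1)] pl_absorb[of C B] pl_comm[of B C] by auto
  ultimately show ?thesis by auto
qed

lemma fin_iff: "fin A B \<longleftrightarrow> (\<exists>n. \<not> chain n A B)"
proof
  assume "fin A B"
  then obtain k where k: "len A B = enat k" by (auto simp: fin_def)
  have "\<not> chain (Suc k) A B"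
  proof
    assume "chain (Suc k) A B"
    then have "enat (Suc k) \<le> len A B" unfolding len_def by (intro SUP_upper) simp
    then show False using k by simp
  qed
  then show "\<exists>n. \<not> chain n A B" ..
next
  assume "\<exists>n. \<not> chain n A B"
  then obtain n where n: "\<not> chain n A B" by blast
  have "len A B \<le> enat n" unfolding len_def
    by (rule SUP_least) (metis chain_mono n enat_ord_simps(1) mem_Collect_eq nat_le_linear)
  then show "fin A B" unfolding fin_def using enat_ord_simps(4) order_le_less_trans by blast
qed

lemma len_ge: "chain n A B \<Longrightarrow> enat n \<le> len A B"
  unfolding len_def by (intro SUP_upper) simp

lemma len_attained:
  assumes "fin A B" "sm A" "sm B" "A \<subseteq> B"
  shows "chain (the_enat (len A B)) A B"
proof -
  obtain k where k: "len A B = enat k" using assms by (auto simp: fin_def)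
  have fi: "finite {n. chain n A B}"
  proof (rule finite_subset)
    show "{n. chain n A B} \<subseteq> {..k}" using len_ge k by fastforce
  qed auto
  have ne: "{n. chain n A B} \<noteq> {}" using assms by (auto intro: exI[of _ 0])
  have "Max {n. chain n A B} \<in> {n. chain n A B}" using fi ne by (rule Max_in)
  moreover have "len A B \<le> enat (Max {n. chain n A B})"
    unfolding len_def by (rule SUP_least) (use fi in auto)
  ultimately have "chain (Max {n. chain n A B}) A B" "k \<le> Max {n. chain n A B}" using k by auto
  then show ?thesis using k chain_mono[of _ A B k] by simp
qed

lemma fin_parts:
  assumes "fin A C" "sm A" "sm B" "sm C" "A \<subseteq> B" "B \<subseteq> C"
  shows "fin A B" "fin B C"
proof -
  obtain n where n: "\<not> chain n A C" using assms fin_iff by blast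
  have "chain 0 A B" "chain 0 B C" using assms by auto
  then have "\<not> chain n A B" "\<not> chain n B C" using n chain_trans[of n A B 0 C] chain_trans[of 0 A B n C] by auto
  then show "fin A B" "fin B C" using fin_iff by blast+
qed

lemma fin_trans:
  assumes "fin A B" "fin B C" "sm A" "sm B" "sm C" "A \<subseteq> B" "B \<subseteq> C"
  shows "fin A C"
proof -
  obtain m n where mn: "\<not> chain m A B" "\<not> chain n B C" using assms fin_iff by blast
  have "\<not> chain (m + n) A C"
  proof
    assume "chain (m + n) A C"
    then obtain p q where "m + n \<le> p + q" "chain p A B" "chain q B C"
      using chain_split assms by blast
    then show False using mn chain_mono
      by (metis add_less_mono linorder_not_less)
  qed
  then show ?thesis using fin_iff by blast
qed

lemma rl_add:
  assumes "fin A C" "sm A" "sm B" "sm C" "A \<subseteq> B" "B \<subseteq> C"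
  shows "rl A C = rl A B + rl B C"
proof -
  note f = fin_parts[OF assms]
  have AC: "A \<subseteq> C" using assms by auto
  have a: "chain (the_enat (len A B)) A B" "chain (the_enat (len B C)) B C" "chain (the_enat (len A C)) A C"
    using len_attained f assms AC by auto
  have m: "n \<le> the_enat (len X Y)" if "chain n X Y" "fin X Y" for n X Y
    using that len_ge[of n X Y] by (auto simp: fin_def)
  have "the_enat (len A B) + the_enat (len B C) \<le> the_enat (len A C)"
    using chain_trans[OF a(1,2)] m assms by auto
  moreover have "the_enat (len A C) \<le> the_enat (len A B) + the_enat (len B C)"
  proof -
    obtain p q where "the_enat (len A C) \<le> p + q" "chain p A B" "chain q B C"
      using chain_split a(3) assms by blast
    then show ?thesis using m f by (meson add_mono order_trans)
  qed
  ultimately show ?thesis unfolding rl_def by linarith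
qed

lemma rl_nonneg [simp]: "0 \<le> rl A B" by (simp add: rl_def)

lemma chain_refl: "chain n A A \<Longrightarrow> n = 0"
  by (cases n) (auto dest!: chain_sm)

lemma len_refl: "sm A \<Longrightarrow> len A A = 0"
proof -
  assume "sm A"
  then have "{n. chain n A A} = {0}" using chain_refl by auto
  then show "len A A = 0" by (simp add: len_def zero_enat_def)
qed

lemma rl_refl [simp]: "sm A \<Longrightarrow> rl A A = 0" by (simp add: rl_def len_refl zero_enat_def)
lemma fin_refl [simp]: "sm A \<Longrightarrow> fin A A" by (simp add: fin_def len_refl)

section \<open>Isomorphism theorems for intervals of submodules\<close>

lemma chain_map:
  assumes "chain n A B"
    and "\<And>X. sm X \<Longrightarrow> A \<subseteq> X \<Longrightarrow> X \<subseteq> B \<Longrightarrow> sm (f X)"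
    and "\<And>X Y. sm X \<Longrightarrow> sm Y \<Longrightarrow> A \<subseteq> X \<Longrightarrow> X \<subseteq> Y \<Longrightarrow> Y \<subseteq> B \<Longrightarrow> f X \<subseteq> f Y"
    and "\<And>X. sm X \<Longrightarrow> A \<subseteq> X \<Longrightarrow> X \<subseteq> B \<Longrightarrow> g (f X) = X"
  shows "chain n (f A) (f B)"
proof -
  have "chain n (f A) (f D)" if "chain n A D" "D \<subseteq> B" for D
    using that
  proof (induction n arbitrary: D)
    case 0
    then show ?case using assms(2)[of A] assms(2)[of D] assms(3)[of A D] by auto
  next
    case (Suc n)
    then obtain E where E: "chain n A E" "sm D" "E \<subset> D" by auto
    have s: "sm E" "A \<subseteq> E" "sm D" "A \<subseteq> D" "E \<subseteq> B" "E \<subseteq> D"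
      using chain_sm[OF E(1)] E(2,3) Suc.prems(2) by auto
    have "chain n (f A) (f E)" by (rule Suc.IH[OF E(1) s(5)])
    moreover have "sm (f D)" by (rule assms(2)[OF s(3,4) Suc.prems(2)])
    moreover have "f E \<subset> f D"
      using assms(3)[OF s(1,3,2,6) Suc.prems(2)] assms(4)[OF s(1,2,5)] assms(4)[OF s(3,4) Suc.prems(2)] E(3)
      by (metis psubset_eq)
    ultimately show ?case unfolding chain.simps(2) by blast
  qed
  from this[OF assms(1)] show ?thesis by simp
qed

text \<open>Length depends only on the ordered set of submodules in the interval. An isomorphism of
  subquotients can thus be given by two mutually inverse monotone maps, without constructing a
  homomorphism.\<close>

lemma len_iso:
  assumes f: "\<And>X. sm X \<Longrightarrow> A \<subseteq> X \<Longrightarrow> X \<subseteq> B \<Longrightarrow> sm (f X)"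
    and fm: "\<And>X Y. sm X \<Longrightarrow> sm Y \<Longrightarrow> A \<subseteq> X \<Longrightarrow> X \<subseteq> Y \<Longrightarrow> Y \<subseteq> B \<Longrightarrow> f X \<subseteq> f Y"
    and gf: "\<And>X. sm X \<Longrightarrow> A \<subseteq> X \<Longrightarrow> X \<subseteq> B \<Longrightarrow> g (f X) = X"
    and g: "\<And>X. sm X \<Longrightarrow> A' \<subseteq> X \<Longrightarrow> X \<subseteq> B' \<Longrightarrow> sm (g X)"
    and gm: "\<And>X Y. sm X \<Longrightarrow> sm Y \<Longrightarrow> A' \<subseteq> X \<Longrightarrow> X \<subseteq> Y \<Longrightarrow> Y \<subseteq> B' \<Longrightarrow> g X \<subseteq> g Y"
    and fg: "\<And>X. sm X \<Longrightarrow> A' \<subseteq> X \<Longrightarrow> X \<subseteq> B' \<Longrightarrow> f (g X) = X"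
    and eq: "f A = A'" "f B = B'" and s: "sm A" "sm B" "A \<subseteq> B"
  shows "len A B = len A' B'"
proof -
  have s': "g A' = A" "g B' = B" using gf[of A] gf[of B] eq s by auto
  have "chain n A B \<longleftrightarrow> chain n A' B'" for n
  proof
    show "chain n A' B'" if "chain n A B"
      by (rule chain_map[of n A B f g, OF that f fm gf, unfolded eq])
    show "chain n A B" if "chain n A' B'"
      by (rule chain_map[of n A' B' g f, OF that g gm fg, unfolded s'])
  qed
  then show ?thesis by (simp add: len_def)
qed

text \<open>First isomorphism theorem for the map W \<rightarrow> M/U induced by \<open>a\<close>:
  its image is (U + aW)/U and its kernel is W \<inter> (U : a).\<close>

lemma len_act:
  assumes a: "a \<in> carrier R" and "sm U" "sm W"
  shows "len U (U \<boxplus> act a W) = len (W \<inter> col a U) W"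
proof (rule sym, rule len_iso[where f = "\<lambda>Y. U \<boxplus> act a Y" and g = "\<lambda>X. W \<inter> col a X"])
  fix X assume X: "sm X" "W \<inter> col a U \<subseteq> X" "X \<subseteq> W"
  have "W \<inter> col a (U \<boxplus> act a X) = (X \<boxplus> col a U) \<inter> W"
    using assms X by (simp add: col_pl_act pl_comm Int_commute)
  also have "\<dots> = X \<boxplus> (col a U \<inter> W)" using assms X by (intro modular) auto
  also have "\<dots> = X" using assms X by (intro pl_absorb) auto
  finally show "W \<inter> col a (U \<boxplus> act a X) = X" .
next
  fix X assume X: "sm X" "U \<subseteq> X" "X \<subseteq> U \<boxplus> act a W"
  have "U \<boxplus> act a (W \<inter> col a X) = U \<boxplus> (act a W \<inter> X)" using assms by (simp add: act_int_col)
  also have "\<dots> = (U \<boxplus> act a W) \<inter> X" using assms X by (intro modular[symmetric]) auto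
  also have "\<dots> = X" using X by auto
  finally show "U \<boxplus> act a (W \<inter> col a X) = X" .
next
  show "U \<boxplus> act a (W \<inter> col a U) = U" using assms by (simp add: act_int_col pl_absorb)
qed (use assms in \<open>auto intro: subsetD[OF pl_mono[OF subset_refl act_mono]] dest: subsetD[OF col_mono]\<close>)

lemma len_diamond:
  assumes "sm A" "sm B" shows "len (A \<inter> B) B = len A (A \<boxplus> B)"
proof (rule len_iso[where f = "\<lambda>Y. A \<boxplus> Y" and g = "\<lambda>X. B \<inter> X"])
  fix X assume X: "sm X" "A \<inter> B \<subseteq> X" "X \<subseteq> B"
  have "B \<inter> (A \<boxplus> X) = (X \<boxplus> A) \<inter> B" using assms X pl_comm by auto
  also have "\<dots> = X \<boxplus> (A \<inter> B)" using assms X by (intro modular) auto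
  finally show "B \<inter> (A \<boxplus> X) = X" using X assms by (simp add: pl_absorb)
next
  fix X assume X: "sm X" "A \<subseteq> X" "X \<subseteq> A \<boxplus> B"
  then show "A \<boxplus> (B \<inter> X) = X" using modular[of A B X] assms by auto
next
  show "A \<boxplus> (A \<inter> B) = A" using assms by (intro pl_absorb) auto
qed (use assms in \<open>auto intro: subsetD[OF pl_mono[OF subset_refl]]\<close>)

text \<open>Multiplication by \<open>a\<close> induces a map from W/U to W'/U'. Its image is a
  quotient of the source and a submodule of the target, so its length cancels in the difference, and
  the cokernel minus the kernel remains.\<close>

lemma rl_coker_ker:
  assumes a: "a \<in> carrier R" and s: "sm U" "sm W" "sm U'" "sm W'"
    and le: "U \<subseteq> W" "U' \<subseteq> W'" "act a U \<subseteq> U'" "act a W \<subseteq> W'"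
    and fin: "fin U W" "fin U' W'"
  shows "rl U' W' - rl U W = rl (U' \<boxplus> act a W) W' - rl U (W \<inter> col a U')"
proof -
  have "rl U' W' = rl U' (U' \<boxplus> act a W) + rl (U' \<boxplus> act a W) W'"
    using s le a by (intro rl_add fin pl_upper1 pl_least) auto
  moreover have "rl U' (U' \<boxplus> act a W) = rl (W \<inter> col a U') W"
    using len_act[of a U' W] s a by (simp add: rl_def)
  moreover have "rl U W = rl U (W \<inter> col a U') + rl (W \<inter> col a U') W"
    using s le a act_le_iff[of U a U'] by (intro rl_add fin) auto
  ultimately show ?thesis by simp
qed

end

section \<open>Graded families of submodules\<close>

context module
begin

text \<open>A homogeneous operator \<open>p = (a, \<delta>)\<close> is multiplication by \<open>a\<close>, raising degrees by \<open>\<delta>\<close>. Integral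
  degrees make all shifts invertible.\<close>

definition fam :: "(('g \<Rightarrow> int) \<Rightarrow> 'c set) \<Rightarrow> bool" where
  "fam F \<longleftrightarrow> (\<forall>n. sm (F n))"

definition fpl :: "(('g \<Rightarrow> int) \<Rightarrow> 'c set) \<Rightarrow> (('g \<Rightarrow> int) \<Rightarrow> 'c set) \<Rightarrow> (('g \<Rightarrow> int) \<Rightarrow> 'c set)" where
  "fpl F G = (\<lambda>n. F n \<boxplus> G n)"

definition opY :: "'a \<times> ('g \<Rightarrow> int) \<Rightarrow> (('g \<Rightarrow> int) \<Rightarrow> 'c set) \<Rightarrow> (('g \<Rightarrow> int) \<Rightarrow> 'c set)" where
  "opY p F = (\<lambda>n. act (fst p) (F (n - snd p)))"

definition opC :: "'a \<times> ('g \<Rightarrow> int) \<Rightarrow> (('g \<Rightarrow> int) \<Rightarrow> 'c set) \<Rightarrow> (('g \<Rightarrow> int) \<Rightarrow> 'c set)" where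
  "opC p F = (\<lambda>n. col (fst p) (F (n + snd p)))"

definition bt :: "('g \<Rightarrow> int) \<Rightarrow> 'c set" where
  "bt = (\<lambda>_. {\<zero>\<^bsub>M\<^esub>})"

definition stable :: "('a \<times> ('g \<Rightarrow> int)) set \<Rightarrow> (('g \<Rightarrow> int) \<Rightarrow> 'c set) \<Rightarrow> bool" where
  "stable Ops F \<longleftrightarrow> (\<forall>p\<in>Ops. opY p F \<le> F)"

lemma fam_D [simp, dest]: "fam F \<Longrightarrow> sm (F n)" by (simp add: fam_def)
lemma fam_bt [simp]: "fam bt" by (simp add: fam_def bt_def)
lemma fam_const [simp]: "sm A \<Longrightarrow> fam (\<lambda>_. A)" by (simp add: fam_def)
lemma fam_fpl [simp]: "fam F \<Longrightarrow> fam G \<Longrightarrow> fam (fpl F G)" by (simp add: fam_def fpl_def)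
lemma fam_inf [simp]: "fam F \<Longrightarrow> fam G \<Longrightarrow> fam (inf F G)" by (simp add: fam_def)
lemma fam_opY [simp]: "fst p \<in> carrier R \<Longrightarrow> fam F \<Longrightarrow> fam (opY p F)" by (simp add: fam_def opY_def)
lemma fam_opC [simp]: "fst p \<in> carrier R \<Longrightarrow> fam F \<Longrightarrow> fam (opC p F)" by (simp add: fam_def opC_def)

lemma bt_le [simp]: "fam F \<Longrightarrow> bt \<le> F" by (simp add: le_fun_def bt_def fam_def sm_zero)
lemma fpl_upper1: "fam F \<Longrightarrow> fam G \<Longrightarrow> F \<le> fpl F G" by (simp add: le_fun_def fpl_def pl_upper1)
lemma fpl_upper2: "fam F \<Longrightarrow> fam G \<Longrightarrow> G \<le> fpl F G" by (simp add: le_fun_def fpl_def pl_upper2)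
lemma fpl_least: "fam H \<Longrightarrow> F \<le> H \<Longrightarrow> G \<le> H \<Longrightarrow> fpl F G \<le> H" by (simp add: le_fun_def fpl_def pl_least)
lemma fpl_mono: "F \<le> F' \<Longrightarrow> G \<le> G' \<Longrightarrow> fpl F G \<le> fpl F' G'" by (simp add: le_fun_def fpl_def pl_mono)
lemma fmodular: "fam F \<Longrightarrow> fam G \<Longrightarrow> fam H \<Longrightarrow> F \<le> H \<Longrightarrow> inf (fpl F G) H = fpl F (inf G H)"
  by (simp add: le_fun_def fpl_def fun_eq_iff modular)

lemma opY_le_iff: assumes "fam F" shows "opY p F \<le> G \<longleftrightarrow> F \<le> opC p G"
proof -
  have "opY p F \<le> G \<longleftrightarrow> (\<forall>n. opY p F (n + snd p) \<le> G (n + snd p))"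
    unfolding le_fun_def by (metis diff_add_cancel)
  also have "\<dots> \<longleftrightarrow> F \<le> opC p G"
    using assms by (simp add: opY_def opC_def le_fun_def act_le_iff)
  finally show ?thesis .
qed

lemma opY_mono: "F \<le> G \<Longrightarrow> opY p F \<le> opY p G" by (simp add: opY_def le_fun_def act_mono)
lemma opC_mono: "F \<le> G \<Longrightarrow> opC p F \<le> opC p G" by (simp add: opC_def le_fun_def col_mono)

lemma opY_commute:
  "fst p \<in> carrier R \<Longrightarrow> fst q \<in> carrier R \<Longrightarrow> fam F \<Longrightarrow> opY p (opY q F) = opY q (opY p F)"
  by (simp add: opY_def fun_eq_iff act_commute algebra_simps)

lemma opY_opC_le:
  "fst p \<in> carrier R \<Longrightarrow> fst q \<in> carrier R \<Longrightarrow> opY p (opC q F) \<le> opC q (opY p F)"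
  using act_col_le by (simp add: opY_def opC_def le_fun_def algebra_simps)

lemma opY_fpl: "fst p \<in> carrier R \<Longrightarrow> fam F \<Longrightarrow> fam G \<Longrightarrow> opY p (fpl F G) = fpl (opY p F) (opY p G)"
  by (simp add: opY_def fpl_def fun_eq_iff act_pl)

lemma opY_bt: "fst p \<in> carrier R \<Longrightarrow> opY p bt = bt"
  by (simp add: opY_def bt_def act_bot)

lemma opY_inf_opC: "fam F \<Longrightarrow> opY p (inf F (opC p G)) = inf (opY p F) G"
  by (simp add: opY_def opC_def fun_eq_iff act_int_col)

lemma stableD: "stable Ops F \<Longrightarrow> p \<in> Ops \<Longrightarrow> opY p F \<le> F" by (simp add: stable_def)

lemma stable_fpl:
  assumes "fst ` Ops \<subseteq> carrier R" "fam F" "fam G" "stable Ops F" "stable Ops G"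
  shows "stable Ops (fpl F G)"
  using assms by (auto simp: stable_def opY_fpl image_subset_iff intro!: fpl_mono)

lemma stable_inf: "stable Ops F \<Longrightarrow> stable Ops G \<Longrightarrow> stable Ops (inf F G)"
  unfolding stable_def by (meson inf.bounded_iff inf_le1 inf_le2 opY_mono order_trans)

lemma stable_opY:
  assumes "fst ` Ops \<subseteq> carrier R" "fst q \<in> carrier R" "fam F" "stable Ops F"
  shows "stable Ops (opY q F)"
  unfolding stable_def
proof
  fix p assume "p \<in> Ops"
  then show "opY p (opY q F) \<le> opY q F"
    using assms opY_commute[of p q F] opY_mono[of "opY p F" F q] by (auto simp: stable_def image_subset_iff)
qed

lemma stable_opC:
  assumes "fst ` Ops \<subseteq> carrier R" "fst q \<in> carrier R" "stable Ops F"
  shows "stable Ops (opC q F)"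
  unfolding stable_def
proof
  fix p assume "p \<in> Ops"
  then show "opY p (opC q F) \<le> opC q F"
    using assms opY_opC_le[of p q F] opC_mono[of "opY p F" F q]
    by (auto simp: stable_def image_subset_iff intro: order_trans)
qed

lemma stable_bt: "fst ` Ops \<subseteq> carrier R \<Longrightarrow> stable Ops bt"
  by (auto simp: stable_def opY_bt image_subset_iff)

lemma stable_const:
  assumes "fst ` Ops \<subseteq> carrier R" "sm A" shows "stable Ops (\<lambda>_. A)"
  using assms act_le[OF _ assms(2)] by (auto simp: stable_def opY_def le_fun_def image_subset_iff subset_iff)

lemma stable_insert: "stable (insert p Ops) F \<longleftrightarrow> opY p F \<le> F \<and> stable Ops F"
  by (simp add: stable_def)

subsection \<open>Chain conditions\<close>

text \<open>W/U is Noetherian as a graded module over the polynomial ring with one variable for each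
  operator. The index at which a chain stops is the same for all degrees.\<close>

definition acc :: "('a \<times> ('g \<Rightarrow> int)) set \<Rightarrow> (('g \<Rightarrow> int) \<Rightarrow> 'c set) \<Rightarrow> (('g \<Rightarrow> int) \<Rightarrow> 'c set) \<Rightarrow> bool" where
  "acc Ops U W \<longleftrightarrow> (\<forall>F. (\<forall>j::nat. fam (F j) \<and> stable Ops (F j) \<and> U \<le> F j \<and> F j \<le> W \<and> F j \<le> F (Suc j))
     \<longrightarrow> (\<exists>j0. \<forall>j\<ge>j0. F j = F j0))"

definition noeth :: bool where
  "noeth \<longleftrightarrow> (\<forall>F. (\<forall>j::nat. sm (F j) \<and> F j \<subseteq> F (Suc j)) \<longrightarrow> (\<exists>j0. \<forall>j\<ge>j0. F j = F j0))"

lemma acc_sub: "acc Ops U W \<Longrightarrow> U \<le> U' \<Longrightarrow> W' \<le> W \<Longrightarrow> acc Ops U' W'"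
  unfolding acc_def by (meson order_trans)

text \<open>A family between U and W is stable under p for free if p sends W into U. Kernel and
  cokernel of p are such intervals, which permits induction on the number of operators.\<close>

lemma acc_remove:
  assumes "acc (insert p Ops) U W" "opY p W \<le> U" shows "acc Ops U W"
  unfolding acc_def
proof (intro allI impI)
  fix F :: "nat \<Rightarrow> _"
  assume F: "\<forall>j. fam (F j) \<and> stable Ops (F j) \<and> U \<le> F j \<and> F j \<le> W \<and> F j \<le> F (Suc j)"
  then have "opY p (F j) \<le> F j" for j
    using assms(2) opY_mono by (meson order_trans)
  then show "\<exists>j0. \<forall>j\<ge>j0. F j = F j0"
    using assms(1) F unfolding acc_def by (auto simp: stable_insert)
qed

text \<open>If the diagonal is constant from k on, every entry \<open>L i j\<close> with i, j \<ge>
  k lies between \<open>L k k\<close> and a later diagonal entry, hence equals \<open>L k k\<close>.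
  The finitely many rows below k have bounds of their own, and j0 dominates them all.\<close>

lemma double_chain_stabilizes:
  fixes L :: "nat \<Rightarrow> nat \<Rightarrow> 'x::order"
  assumes m1: "\<And>i j. L i j \<le> L (Suc i) j" and m2: "\<And>i j. L i j \<le> L i (Suc j)"
    and s: "\<And>i. \<exists>j0. \<forall>j\<ge>j0. L i j = L i j0" and diag: "\<exists>j0. \<forall>j\<ge>j0. L j j = L j0 j0"
  shows "\<exists>j0. \<forall>i. \<forall>j\<ge>j0. L i j = L i j0"
proof -
  have m1': "L i j \<le> L i' j" if "i \<le> i'" for i i' j
    using lift_Suc_mono_le[of "\<lambda>i. L i j", OF m1 that] .
  have m2': "L i j \<le> L i j'" if "j \<le> j'" for i j j'
    using lift_Suc_mono_le[of "L i", OF m2 that] .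
  obtain k where k: "\<And>j. j \<ge> k \<Longrightarrow> L j j = L k k" using diag by blast
  obtain t where t: "\<And>i j. j \<ge> t i \<Longrightarrow> L i j = L i (t i)" using s by metis
  define j0 where "j0 = k + (\<Sum>i<k. t i)"
  have "L i j = L i j0" if j: "j \<ge> j0" for i j
  proof (cases "i < k")
    case True
    then have "t i \<le> (\<Sum>i<k. t i)" by (intro member_le_sum) auto
    then show ?thesis using t[of i j] t[of i j0] j by (simp add: j0_def)
  next
    case False
    have eq: "L i j' = L k k" if "j' \<ge> k" for j'
    proof (rule antisym)
      have "L i j' \<le> L (max i j') (max i j')"
        by (rule order_trans[OF m1'[of i "max i j'" j'] m2']) auto
      also have "\<dots> = L k k" by (rule k) (use that in auto)
      finally show "L i j' \<le> L k k" .
      show "L k k \<le> L i j'"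
        by (rule order_trans[OF m1'[of k i k] m2']) (use False that in auto)
    qed
    show ?thesis using eq[of j] eq[of j0] j by (simp add: j0_def)
  qed
  then show ?thesis by blast
qed

section \<open>Hilbert's basis theorem for families of submodules\<close>

primrec lv :: "'a \<times> ('g \<Rightarrow> int) \<Rightarrow> (('g \<Rightarrow> int) \<Rightarrow> 'c set) \<Rightarrow> nat \<Rightarrow> (('g \<Rightarrow> int) \<Rightarrow> 'c set)" where
  "lv p E 0 = bt"
| "lv p E (Suc i) = fpl (lv p E i) ((opY p ^^ i) E)"

lemma fam_opY_pow: "fst p \<in> carrier R \<Longrightarrow> fam E \<Longrightarrow> fam ((opY p ^^ i) E)"
  by (induction i) auto
lemma fam_opC_pow: "fst p \<in> carrier R \<Longrightarrow> fam E \<Longrightarrow> fam ((opC p ^^ i) E)"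
  by (induction i) auto
lemma fam_lv: "fst p \<in> carrier R \<Longrightarrow> fam E \<Longrightarrow> fam (lv p E i)"
  by (induction i) (auto simp: fam_opY_pow)

lemma opC_pow_mono: "F \<le> G \<Longrightarrow> (opC p ^^ i) F \<le> (opC p ^^ i) G"
  by (induction i) (auto intro: opC_mono)

lemma opY_pow_inf: "fst p \<in> carrier R \<Longrightarrow> fam E \<Longrightarrow> fam G \<Longrightarrow>
   (opY p ^^ i) (inf E ((opC p ^^ i) G)) = inf ((opY p ^^ i) E) G"
proof (induction i arbitrary: G)
  case (Suc i)
  have "(opY p ^^ Suc i) (inf E ((opC p ^^ Suc i) G)) = opY p ((opY p ^^ i) (inf E ((opC p ^^ i) (opC p G))))"
    by (simp add: funpow_swap1)
  also have "\<dots> = opY p (inf ((opY p ^^ i) E) (opC p G))"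
    by (rule arg_cong[OF Suc.IH]) (use Suc.prems in auto)
  also have "\<dots> = inf ((opY p ^^ Suc i) E) G" using Suc by (simp add: opY_inf_opC fam_opY_pow)
  finally show ?case .
qed auto

lemma stable_opY_pow:
  "fst ` Ops \<subseteq> carrier R \<Longrightarrow> fst p \<in> carrier R \<Longrightarrow> fam E \<Longrightarrow> stable Ops E \<Longrightarrow> stable Ops ((opY p ^^ i) E)"
  by (induction i) (auto simp: stable_opY fam_opY_pow)
lemma stable_opC_pow:
  "fst ` Ops \<subseteq> carrier R \<Longrightarrow> fst p \<in> carrier R \<Longrightarrow> stable Ops E \<Longrightarrow> stable Ops ((opC p ^^ i) E)"
  by (induction i) (auto simp: stable_opC)
lemma stable_lv:
  "fst ` Ops \<subseteq> carrier R \<Longrightarrow> fst p \<in> carrier R \<Longrightarrow> fam E \<Longrightarrow> stable Ops E \<Longrightarrow> stable Ops (lv p E i)"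
  by (induction i) (auto simp: stable_bt stable_fpl stable_opY_pow fam_lv fam_opY_pow)

lemma lv_Suc_le: "fst p \<in> carrier R \<Longrightarrow> fam E \<Longrightarrow> lv p E i \<le> lv p E (Suc i)"
  by (simp add: fpl_upper1 fam_lv fam_opY_pow)

lemma opY_lv: "fst p \<in> carrier R \<Longrightarrow> fam E \<Longrightarrow> opY p (lv p E i) \<le> lv p E (Suc i)"
proof (induction i)
  case (Suc i)
  have "opY p (lv p E (Suc i)) = fpl (opY p (lv p E i)) ((opY p ^^ Suc i) E)"
    using Suc by (simp add: opY_fpl fam_lv fam_opY_pow)
  also have "\<dots> \<le> lv p E (Suc (Suc i))" using Suc by (simp only: lv.simps(2)[of _ _ "Suc i"]) (intro fpl_mono, auto)
  finally show ?case .
qed (simp add: opY_bt fam_fpl)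

definition gen :: "'a \<times> ('g \<Rightarrow> int) \<Rightarrow> (('g \<Rightarrow> int) \<Rightarrow> 'c set) \<Rightarrow> (('g \<Rightarrow> int) \<Rightarrow> 'c set)" where
  "gen p E = (\<lambda>n. \<Union>i. lv p E i n)"

text \<open>\<open>lv p E i\<close> is the sum of p^k E over k < i, the polynomials of degree below
  i in p with coefficients in E. \<open>lt p E F i\<close> consists of the e in E for which p^i e
  lies in F up to such lower terms: the leading coefficients of degree i. As p acts on
  \<open>M\<close> and is not a free variable, an element has no well-defined leading coefficient,
  and only membership is used.\<close>

definition lt :: "'a \<times> ('g \<Rightarrow> int) \<Rightarrow> (('g \<Rightarrow> int) \<Rightarrow> 'c set) \<Rightarrow> (('g \<Rightarrow> int) \<Rightarrow> 'c set) \<Rightarrow> nat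
     \<Rightarrow> (('g \<Rightarrow> int) \<Rightarrow> 'c set)" where
  "lt p E F i = inf E ((opC p ^^ i) (fpl F (lv p E i)))"

text \<open>Applying p^i to the equality of leading coefficients gives B \<inter> (F + A) = B
  \<inter> (F' + A), where A is level i and B = p^i E. The modular law, used twice, then rewrites an
  element of F' of level i + 1 as an element of F plus one of F' of level i, where the induction
  hypothesis applies.\<close>

lemma lt_determines:
  assumes p: "fst p \<in> carrier R" and f: "fam E" "fam F" "fam F'" and le: "F \<le> F'"
    and eq: "\<And>i. lt p E F i = lt p E F' i"
  shows "inf F' (lv p E i) \<le> F"
proof (induction i)
  case 0 then show ?case unfolding lv.simps by (rule le_infI2[OF bt_le[OF f(2)]])
next
  case (Suc i)
  define A where "A = lv p E i"
  define B where "B = (opY p ^^ i) E"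
  have fAB: "fam A" "fam B" using p f by (simp_all add: A_def B_def fam_lv fam_opY_pow)
  have "inf B (fpl F A) = inf B (fpl F' A)"
    using arg_cong[OF eq[of i], of "opY p ^^ i"] p f fAB unfolding lt_def
    by (simp add: opY_pow_inf A_def[symmetric] B_def)
  then have "inf B (fpl F' A) \<le> fpl F A" by (metis inf_le2)
  then have h: "fpl A (inf B (fpl F' A)) \<le> fpl F A"
    using f fAB by (intro fpl_least) (auto simp: fpl_upper2)
  have "inf F' (fpl A B) \<le> inf (fpl A B) (fpl F' A)"
    by (rule le_infI[OF inf_le2 le_infI1[OF fpl_upper1[OF f(3) fAB(1)]]])
  also have "\<dots> = fpl A (inf B (fpl F' A))"
    using f fAB by (intro fmodular) (auto simp: fpl_upper2)
  finally have "inf F' (fpl A B) \<le> inf (fpl F A) F'"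
    using h by (intro le_infI inf_le1) (rule order_trans)
  also have "\<dots> = fpl F (inf A F')" using f fAB le by (intro fmodular) auto
  also have "\<dots> \<le> F" by (rule fpl_least[OF f(2) order_refl Suc[folded A_def, unfolded inf.commute[of F']]])
  finally show ?case unfolding lv.simps A_def B_def .
qed

text \<open>The leading coefficients \<open>L i j\<close> of the j-th family grow with j and,
  because the family is stable under p, also with i. The chain condition on E makes them stationary
  in j uniformly in i, and \<open>lt_determines\<close> transfers this to the families.\<close>

theorem hilbert_basis_step:
  assumes p: "fst p \<in> carrier R" and Ops: "fst ` Ops \<subseteq> carrier R"
    and E: "fam E" "stable Ops E" "acc Ops bt E"
  shows "acc (insert p Ops) bt (gen p E)"
  unfolding acc_def
proof (intro allI impI)
  fix F :: "nat \<Rightarrow> _"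
  assume F: "\<forall>j. fam (F j) \<and> stable (insert p Ops) (F j) \<and> bt \<le> F j \<and> F j \<le> gen p E \<and> F j \<le> F (Suc j)"
  then have fF: "fam (F j)" and sF: "stable Ops (F j)" and pF: "opY p (F j) \<le> F j" for j
    by (auto simp: stable_insert)
  have ch: "F j \<le> F j'" if "j \<le> j'" for j j'
    using lift_Suc_mono_le[of F, OF _ that] F by blast
  define L where "L i j = lt p E (F j) i" for i j
  have m1: "L i j \<le> L (Suc i) j" for i j
  proof -
    have "opY p (fpl (F j) (lv p E i)) \<le> fpl (F j) (lv p E (Suc i))"
      using p fF E pF[of j] opY_lv[OF p E(1), of i] by (subst opY_fpl) (auto simp: fam_lv intro: fpl_mono)
    then have "fpl (F j) (lv p E i) \<le> opC p (fpl (F j) (lv p E (Suc i)))"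
      using p fF E by (subst (asm) opY_le_iff) (auto simp: fam_lv)
    then have "(opC p ^^ i) (fpl (F j) (lv p E i)) \<le> (opC p ^^ i) (opC p (fpl (F j) (lv p E (Suc i))))"
      by (rule opC_pow_mono)
    then show ?thesis unfolding L_def lt_def by (simp add: funpow_swap1 le_infI2 del: lv.simps)
  qed
  have m2: "L i j \<le> L i (Suc j)" for i j
  proof -
    have "fpl (F j) (lv p E i) \<le> fpl (F (Suc j)) (lv p E i)" using ch by (intro fpl_mono) auto
    from opC_pow_mono[OF this, of i p] show ?thesis unfolding L_def lt_def by (rule inf_mono[OF order_refl])
  qed
  have fL: "fam (L i j)" "stable Ops (L i j)" "bt \<le> L i j" "L i j \<le> E" for i j
  proof -
    show "fam (L i j)" using p fF E by (simp add: L_def lt_def fam_opC_pow fam_lv)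
    then show "bt \<le> L i j" by simp
    show "stable Ops (L i j)" unfolding L_def lt_def
      using p Ops fF sF E by (intro stable_inf stable_opC_pow stable_fpl stable_lv) (auto simp: fam_lv)
    show "L i j \<le> E" by (simp add: L_def lt_def)
  qed
  have st: "\<exists>j0. \<forall>j\<ge>j0. G j = G j0" if "\<And>j. G j \<le> G (Suc j)" "\<And>j. \<exists>i k. G j = L i k" for G
  proof -
    have "fam (G j) \<and> stable Ops (G j) \<and> bt \<le> G j \<and> G j \<le> E \<and> G j \<le> G (Suc j)" for j
      using that(1)[of j] that(2)[of j] fL by auto
    then show ?thesis using E(3) unfolding acc_def by blast
  qed
  have "\<exists>j0. \<forall>i. \<forall>j\<ge>j0. L i j = L i j0"
  proof (rule double_chain_stabilizes[of L, OF m1 m2])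
    show "\<exists>j0. \<forall>j\<ge>j0. L i j = L i j0" for i by (rule st[of "L i"]) (use m2 in auto)
    have "L j j \<le> L (Suc j) (Suc j)" for j using m1 m2 order_trans by blast
    then show "\<exists>j0. \<forall>j\<ge>j0. L j j = L j0 j0" by (intro st[of "\<lambda>j. L j j"]) auto
  qed
  then obtain j0 where j0: "\<And>i j. j \<ge> j0 \<Longrightarrow> L i j = L i j0" by blast
  have "F j = F j0" if j: "j \<ge> j0" for j
  proof (rule antisym)
    have "inf (F j) (lv p E i) \<le> F j0" for i
      using lt_determines[OF p E(1) fF fF ch[OF j]] j0[OF j] unfolding L_def by metis
    then have "F j n \<inter> lv p E i n \<subseteq> F j0 n" for i n by (simp add: le_fun_def)
    moreover have "F j n \<subseteq> (\<Union>i. lv p E i n)" for n using F by (auto simp: le_fun_def gen_def)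
    ultimately show "F j \<le> F j0" unfolding le_fun_def by blast
  qed (use ch j in blast)
  then show "\<exists>j0. \<forall>j\<ge>j0. F j = F j0" by blast
qed

lemma gen_props:
  assumes p: "fst p \<in> carrier R" and Ops: "fst ` Ops \<subseteq> carrier R" and E: "fam E" "stable Ops E"
  shows "fam (gen p E)" "stable (insert p Ops) (gen p E)" "E \<le> gen p E"
proof -
  have m: "lv p E i n \<subseteq> lv p E (Suc i) n" for i n using lv_Suc_le[OF p E(1)] by (auto simp: le_fun_def)
  then show "fam (gen p E)" using fam_lv[OF p E(1)] by (simp add: fam_def gen_def sm_UN del: lv.simps)
  have cont: "opY q (gen p E) \<le> gen p E" if "\<And>i. \<exists>k. opY q (lv p E i) \<le> lv p E k" for q
    using that by (fastforce simp: le_fun_def gen_def opY_def act_def subset_iff)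
  have "opY p (gen p E) \<le> gen p E" using opY_lv[OF p E(1)] by (intro cont) blast
  moreover have "opY q (gen p E) \<le> gen p E" if "q \<in> Ops" for q
    using stable_lv[OF Ops p E] that stableD by (intro cont) blast
  ultimately show "stable (insert p Ops) (gen p E)" by (auto simp: stable_def)
  have "E \<le> lv p E 1" using E by (simp add: fpl_upper2)
  then show "E \<le> gen p E" unfolding gen_def le_fun_def by blast
qed

text \<open>The operators are adjoined one at a time to the family that is M in degree 0 and 0
  elsewhere. The result serves as an ambient Noetherian family: whatever lies below it inherits the
  chain condition by \<open>acc_sub\<close>.\<close>

theorem noetherian_family_exists:
  fixes Ops :: "('a \<times> ('g \<Rightarrow> int)) set"
  assumes "noeth" "finite Ops" "fst ` Ops \<subseteq> carrier R"
  shows "\<exists>G. fam G \<and> stable Ops G \<and> acc Ops bt G \<and> G (\<lambda>_. 0) = carrier M"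
  using assms(2,3)
proof (induction Ops)
  case empty
  define G where "G = (\<lambda>n::'g \<Rightarrow> int. if n = (\<lambda>_. 0) then carrier M else {\<zero>\<^bsub>M\<^esub>})"
  have "acc {} bt G"
    unfolding acc_def
  proof (intro allI impI)
    fix F :: "nat \<Rightarrow> _"
    assume F: "\<forall>j. fam (F j) \<and> stable {} (F j) \<and> bt \<le> F j \<and> F j \<le> G \<and> F j \<le> F (Suc j)"
    then have "\<forall>j. sm (F j (\<lambda>_. 0)) \<and> F j (\<lambda>_. 0) \<subseteq> F (Suc j) (\<lambda>_. 0)" by (auto simp: le_fun_def)
    then obtain j0 where j0: "\<And>j. j \<ge> j0 \<Longrightarrow> F j (\<lambda>_. 0) = F j0 (\<lambda>_. 0)"
      using assms(1)[unfolded noeth_def, rule_format, of "\<lambda>j. F j (\<lambda>_. 0)"] by auto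
    have "F j n = {\<zero>\<^bsub>M\<^esub>}" if "n \<noteq> (\<lambda>_. 0)" for j n
    proof -
      have "bt n \<subseteq> F j n" "F j n \<subseteq> G n" using F by (auto simp: le_fun_def)
      then show ?thesis using that by (auto simp: bt_def G_def)
    qed
    then have "F j n = F j0 n" if "j \<ge> j0" for j n using j0[OF that] by (cases "n = (\<lambda>_. 0)") auto
    then show "\<exists>j0. \<forall>j\<ge>j0. F j = F j0" by blast
  qed
  moreover have "fam G" by (auto simp: fam_def G_def)
  ultimately show ?case by (intro exI[of _ G]) (auto simp: stable_def G_def)
next
  case (insert p Ops)
  then obtain G where G: "fam G" "stable Ops G" "acc Ops bt G" "G (\<lambda>_. 0) = carrier M" by auto
  have p: "fst p \<in> carrier R" "fst ` Ops \<subseteq> carrier R" using insert.prems by auto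
  note gp = gen_props[OF p G(1,2)]
  have "gen p G (\<lambda>_. 0) = carrier M"
    using gp(1,3) G(4) sm_carr[of "gen p G (\<lambda>_. 0)"] by (auto simp: le_fun_def)
  then show ?case using gp hilbert_basis_step[OF p G(1-3)] by blast
qed

end

section \<open>Iterated differences of length functions\<close>

declare plus_fun_apply [simp del]

text \<open>All coordinates tend to infinity simultaneously. This is the sense in which a Hilbert
  function of several variables agrees with its polynomial.\<close>

definition big :: "('g \<Rightarrow> int) filter" where
  "big = (INF N. principal {n. \<forall>i. N \<le> n i})"

lemma eventually_big: "eventually P big \<longleftrightarrow> (\<exists>N. \<forall>n. (\<forall>i. N \<le> n i) \<longrightarrow> P n)"
proof -
  have "eventually P big \<longleftrightarrow> (\<exists>N::int\<in>UNIV. eventually P (principal {n. \<forall>i. N \<le> n i}))"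
    unfolding big_def
  proof (rule eventually_INF_base)
    fix a b :: int
    show "\<exists>x\<in>UNIV. principal {n. \<forall>i::'a. x \<le> n i} \<le> inf (principal {n. \<forall>i. a \<le> n i}) (principal {n. \<forall>i. b \<le> n i})"
      by (intro bexI[of _ "max a b"]) auto
  qed auto
  then show ?thesis by (simp add: eventually_principal)
qed

lemma eventually_big_shift:
  fixes \<delta> :: "'g::finite \<Rightarrow> int"
  assumes "eventually P big" shows "eventually (\<lambda>n. P (n + \<delta>)) big"
proof -
  obtain N where N: "\<And>n. (\<forall>i. N \<le> n i) \<Longrightarrow> P n" using assms unfolding eventually_big by blast
  show ?thesis unfolding eventually_big
  proof (intro exI[of _ "N + (\<Sum>j\<in>UNIV. \<bar>\<delta> j\<bar>)"] allI impI N)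
    fix n :: "'g \<Rightarrow> int" and i :: 'g assume n: "\<forall>i. N + (\<Sum>j\<in>UNIV. \<bar>\<delta> j\<bar>) \<le> n i"
    have "\<bar>\<delta> i\<bar> \<le> (\<Sum>j\<in>UNIV. \<bar>\<delta> j\<bar>)" by (rule member_le_sum) auto
    then show "N \<le> (n + \<delta>) i" using n[rule_format, of i] by (simp add: plus_fun_def)
  qed
qed

lemma big_neq_bot [simp]: "big \<noteq> (bot :: ('g \<Rightarrow> int) filter)"
proof
  assume "big = (bot :: ('g \<Rightarrow> int) filter)"
  then have "eventually (\<lambda>_. False) (big :: ('g \<Rightarrow> int) filter)" by simp
  then obtain N where "\<forall>n::'g \<Rightarrow> int. (\<forall>i. N \<le> n i) \<longrightarrow> False" unfolding eventually_big by blast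
  then show False by (auto dest: spec[of _ "\<lambda>_. N"])
qed

section \<open>Difference operators along multidegrees\<close>

definition dif :: "('g \<Rightarrow> int) \<Rightarrow> (('g \<Rightarrow> int) \<Rightarrow> real) \<Rightarrow> ('g \<Rightarrow> int) \<Rightarrow> real" where
  "dif \<delta> f = (\<lambda>n. f (n + \<delta>) - f n)"

primrec difs :: "('g \<Rightarrow> int) list \<Rightarrow> (('g \<Rightarrow> int) \<Rightarrow> real) \<Rightarrow> ('g \<Rightarrow> int) \<Rightarrow> real" where
  "difs [] f = f"
| "difs (\<delta> # ds) f = difs ds (dif \<delta> f)"

lemma eventually_difs_cong:
  fixes f :: "('g::finite \<Rightarrow> int) \<Rightarrow> real"
  assumes "eventually (\<lambda>n. f n = g n) big" shows "eventually (\<lambda>n. difs ds f n = difs ds g n) big"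
  using assms
proof (induction ds arbitrary: f g)
  case (Cons \<delta> ds)
  have "eventually (\<lambda>n. dif \<delta> f n = dif \<delta> g n) big"
    using Cons.prems eventually_big_shift[OF Cons.prems, of \<delta>]
  proof eventually_elim
    case (elim n)
    then show ?case unfolding dif_def by (simp only:)
  qed
  from Cons.IH[OF this] show ?case by simp
qed auto

lemma dif_diff: "dif \<delta> (\<lambda>n. f n - g n) = (\<lambda>n. dif \<delta> f n - dif \<delta> g n)"
  by (simp add: dif_def fun_eq_iff)

lemma dif_shift: "dif \<delta> (\<lambda>n. f (n + \<epsilon>)) = (\<lambda>n. dif \<delta> f (n + \<epsilon>))"
  by (simp add: dif_def fun_eq_iff add.commute add.left_commute)

lemma difs_diff: "difs ds (\<lambda>n. f n - g n) n = difs ds f n - difs ds g n"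
  by (induction ds arbitrary: f g) (auto simp: dif_diff)

lemma difs_shift: "difs ds (\<lambda>n. f (n + \<epsilon>)) n = difs ds f (n + \<epsilon>)"
  by (induction ds arbitrary: f) (auto simp: dif_shift)

context module
begin

text \<open>\<open>nil Ops X U W\<close> says that every subquotient of \<open>W/U\<close> annihilated by the operators in \<open>X\<close>
  vanishes in large degrees. Unlike the vanishing of \<open>W/(U + X W)\<close>, it passes to subquotients
  at once.\<close>

definition nil :: "('a \<times> ('g \<Rightarrow> int)) set \<Rightarrow> ('a \<times> ('g \<Rightarrow> int)) set \<Rightarrow>
    (('g \<Rightarrow> int) \<Rightarrow> 'c set) \<Rightarrow> (('g \<Rightarrow> int) \<Rightarrow> 'c set) \<Rightarrow> bool" where
  "nil Ops X U W \<longleftrightarrow> (\<forall>V' V. fam V' \<and> fam V \<and> stable Ops V' \<and> stable Ops V \<and> U \<le> V' \<and> V' \<le> V \<and> V \<le> W \<and>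
     (\<forall>p\<in>X. opY p V \<le> V') \<longrightarrow> eventually (\<lambda>n. V n = V' n) big)"

lemma nilI:
  assumes "\<And>V' V. \<lbrakk>fam V'; fam V; stable Ops V'; stable Ops V; U \<le> V'; V' \<le> V; V \<le> W;
     \<And>p. p \<in> X \<Longrightarrow> opY p V \<le> V'\<rbrakk> \<Longrightarrow> eventually (\<lambda>n. V n = V' n) big"
  shows "nil Ops X U W"
  using assms unfolding nil_def by blast

lemma nilD:
  assumes "nil Ops X U W" "fam V'" "fam V" "stable Ops V'" "stable Ops V" "U \<le> V'" "V' \<le> V" "V \<le> W"
    "\<And>p. p \<in> X \<Longrightarrow> opY p V \<le> V'"
  shows "eventually (\<lambda>n. V n = V' n) big"
  using assms unfolding nil_def by blast

lemma nil_remove: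
  assumes n: "nil Ops (insert p X) U W" and le: "U \<le> U'" "W' \<le> W"
    and kill: "\<And>V. fam V \<Longrightarrow> stable Ops V \<Longrightarrow> U' \<le> V \<Longrightarrow> V \<le> W' \<Longrightarrow> opY p V \<le> U'"
  shows "nil Ops X U' W'"
proof (rule nilI)
  fix V' V assume *: "fam V'" "fam V" "stable Ops V'" "stable Ops V" "U' \<le> V'" "V' \<le> V" "V \<le> W'"
    "\<And>p. p \<in> X \<Longrightarrow> opY p V \<le> V'"
  show "eventually (\<lambda>n. V n = V' n) big"
  proof (rule nilD[OF n *(1-4)])
    have "opY p V \<le> U'" using kill * by (meson order_trans)
    then show "opY q V \<le> V'" if "q \<in> insert p X" for q using that *(5,8) by (metis insert_iff order_trans)
  qed (use * le in \<open>meson order_trans\<close>)+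
qed

lemma opY_shift_eq: "opY (a, \<delta>) W (n + \<delta>) = act a (W n)"
  by (simp add: opY_def)

lemma dif_len:
  fixes U W :: "('g::finite \<Rightarrow> int) \<Rightarrow> 'c set"
  assumes a: "a \<in> carrier R" and f: "fam U" "fam W" and le: "U \<le> W"
    and st: "opY (a, \<delta>) U \<le> U" "opY (a, \<delta>) W \<le> W"
    and fin: "eventually (\<lambda>n. fin (U n) (W n)) big"
  shows "eventually (\<lambda>n. dif \<delta> (\<lambda>n. rl (U n) (W n)) n =
      rl (fpl U (opY (a, \<delta>) W) (n + \<delta>)) (W (n + \<delta>)) - rl (U n) (inf W (opC (a, \<delta>) U) n)) big"
  using fin eventually_big_shift[OF fin, of \<delta>]
proof eventually_elim
  case (elim n)
  have "rl (U (n + \<delta>)) (W (n + \<delta>)) - rl (U n) (W n) =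
     rl (U (n + \<delta>) \<boxplus> act a (W n)) (W (n + \<delta>)) - rl (U n) (W n \<inter> col a (U (n + \<delta>)))"
  proof (rule rl_coker_ker[OF a])
    show "act a (U n) \<subseteq> U (n + \<delta>)" "act a (W n) \<subseteq> W (n + \<delta>)"
      using st[THEN le_funD, of "n + \<delta>"] by (simp_all add: opY_shift_eq)
  qed (use elim f le in \<open>auto simp: le_fun_def\<close>)
  then show ?case by (simp add: dif_def fpl_def opC_def opY_shift_eq)
qed

lemma eventually_fin_sub:
  assumes "eventually (\<lambda>n. fin (U n) (W n)) big" "fam U" "fam W" "fam U'" "fam W'" "U \<le> U'" "U' \<le> W'" "W' \<le> W"
  shows "eventually (\<lambda>n. fin (U' n) (W' n)) big"
  using assms(1)
proof eventually_elim
  case (elim n)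
  have le: "U n \<subseteq> U' n" "U' n \<subseteq> W' n" "W' n \<subseteq> W n" using assms by (auto simp: le_fun_def)
  have "fin (U n) (W' n)" using elim assms le by (intro fin_parts(1)[of "U n" "W n" "W' n"]) auto
  then show ?case using assms le by (intro fin_parts(2)[of "U n" "W' n" "U' n"]) auto
qed

text \<open>A difference along p turns the length of W/U into the lengths of cokernel and kernel of
  p on W/U. Both are killed by p, so the hypothesis passes to them with p removed. When no operator
  is left, it says that W and U agree in large degrees.\<close>

theorem difs_len_vanish:
  fixes U W :: "('g::finite \<Rightarrow> int) \<Rightarrow> 'c set"
  assumes Ops: "fst ` Ops \<subseteq> carrier R" and xs: "set xs \<subseteq> Ops"
    and f: "fam U" "fam W" and le: "U \<le> W" and st: "stable Ops U" "stable Ops W"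
    and fin: "eventually (\<lambda>n. fin (U n) (W n)) big"
    and nil: "nil Ops (set xs) U W"
  shows "eventually (\<lambda>n. difs (map snd xs) (\<lambda>n. rl (U n) (W n)) n = 0) big"
  using xs f le st fin nil
proof (induction xs arbitrary: U W)
  case Nil
  have "eventually (\<lambda>n. W n = U n) big"
    using nilD[OF Nil(8) Nil(2,3)] Nil by simp
  then show ?case using Nil(2) by (auto elim!: eventually_mono)
next
  case (Cons p xs)
  obtain a \<delta> where p: "p = (a, \<delta>)" by force
  have a: "a \<in> carrier R" "p \<in> Ops" using Cons.prems Ops by (auto simp: p)
  note f = Cons.prems(2,3) and le = Cons.prems(4) and st = Cons.prems(5,6)
  define Uc where "Uc = fpl U (opY p W)"
  define Wk where "Wk = inf W (opC p U)"
  have fc: "fam Uc" "fam Wk" using f a by (auto simp: Uc_def Wk_def p)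
  have sc: "stable Ops Uc" "stable Ops Wk"
    unfolding Uc_def Wk_def using f a st Ops
    by (auto intro!: stable_fpl stable_opY stable_inf stable_opC simp: p)
  have pU: "opY p U \<le> U" "opY p W \<le> W" using st a by (auto simp: stable_def)
  have lec: "U \<le> Uc" "Uc \<le> W" unfolding Uc_def using f a pU le
    by (auto intro: fpl_upper1 fpl_least simp: p)
  have "U \<le> opC p U" using pU opY_le_iff[OF f(1)] by simp
  then have lek: "U \<le> Wk" "Wk \<le> W" unfolding Wk_def using le by auto
  have Yk: "opY p Wk \<le> U" using opY_le_iff[OF fc(2)] by (simp add: Wk_def)
  have "nil Ops (set xs) Uc W"
  proof (rule nil_remove[OF _ lec(1) order_refl])
    show "nil Ops (insert p (set xs)) U W" using Cons.prems(8) by simp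
    fix V assume "V \<le> W"
    then have "opY p V \<le> opY p W" by (rule opY_mono)
    then show "opY p V \<le> Uc" unfolding Uc_def using fpl_upper2[of U "opY p W"] f a
      by (auto simp: p intro: order_trans)
  qed
  moreover have "nil Ops (set xs) U Wk"
  proof (rule nil_remove[OF _ order_refl lek(2)])
    show "nil Ops (insert p (set xs)) U W" using Cons.prems(8) by simp
    fix V assume "V \<le> Wk"
    then show "opY p V \<le> U" using opY_mono Yk order_trans by blast
  qed
  moreover have fin: "eventually (\<lambda>n. fin (Uc n) (W n)) big" "eventually (\<lambda>n. fin (U n) (Wk n)) big"
    using eventually_fin_sub[OF Cons.prems(7) f fc(1) f(2) lec order_refl]
      eventually_fin_sub[OF Cons.prems(7) f f(1) fc(2) order_refl lek] by auto
  ultimately have c: "eventually (\<lambda>n. difs (map snd xs) (\<lambda>n. rl (Uc n) (W n)) n = 0) big"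
    and k: "eventually (\<lambda>n. difs (map snd xs) (\<lambda>n. rl (U n) (Wk n)) n = 0) big"
    using Cons.IH[of Uc W] Cons.IH[of U Wk] Cons.prems(1) fc f sc st lec lek by auto
  have "eventually (\<lambda>n. dif \<delta> (\<lambda>n. rl (U n) (W n)) n = rl (Uc (n + \<delta>)) (W (n + \<delta>)) - rl (U n) (Wk n)) big"
    using dif_len[OF a(1) f le pU[unfolded p] Cons.prems(7)] by (simp only: Uc_def Wk_def p)
  from eventually_difs_cong[OF this, of "map snd xs"] c[THEN eventually_big_shift, of \<delta>] k
  show ?case
    by eventually_elim (simp add: p difs_diff difs_shift[of _ "\<lambda>n. rl (Uc n) (W n)"])
qed

text \<open>The multiplicity symbol of Northcott and Wright, for the module \<open>V1/V0\<close>.\<close>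

fun chi :: "'a list \<Rightarrow> 'c set \<Rightarrow> 'c set \<Rightarrow> real" where
  "chi [] V0 V1 = rl V0 V1"
| "chi (a # as) V0 V1 = chi as (V0 \<boxplus> act a V1) V1 - chi as V0 (V1 \<inter> col a V0)"

text \<open>A difference along p of the length of V1/U(n) is a cokernel minus a kernel. The cokernel
  V1/(U + aV1) has the required form over V0 + aV1. The kernel (V1 \<inter> (U(n + \<delta>) :
  a))/U(n) contains a copy of Kx/(U \<inter> Kx), which has the required form over V0, and the
  quotient by it contributes 0 to the remaining differences by \<open>difs_len_vanish\<close>. This
  is the recursion of \<open>chi\<close>.\<close>

theorem difs_len_eq_chi:
  fixes U :: "('g::finite \<Rightarrow> int) \<Rightarrow> 'c set"
  assumes Ops: "fst ` Ops \<subseteq> carrier R" and xs: "set xs \<subseteq> Ops"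
    and V: "sm V0" "sm V1" and U: "fam U" "stable Ops U"
    and le: "\<And>n. V0 \<subseteq> U n" "\<And>n. U n \<subseteq> V1"
    and fin: "eventually (\<lambda>n. fin (U n) V1) big"
    and nil: "nil Ops (set xs) (\<lambda>_. V0) U"
  shows "eventually (\<lambda>n. difs (map snd xs) (\<lambda>n. rl (U n) V1) n = chi (map fst xs) V0 V1) big"
  using xs V U le fin nil
proof (induction xs arbitrary: V0 V1 U)
  case Nil
  have "eventually (\<lambda>n. U n = V0) big"
    using nilD[OF Nil(9), of "\<lambda>_. V0" U] Nil(2-7) stable_const[OF Ops Nil(2)]
    by (simp add: le_fun_def)
  then show ?case by (auto elim!: eventually_mono)
next
  case (Cons p xs)
  obtain a \<delta> where p: "p = (a, \<delta>)" by force
  have a: "a \<in> carrier R" "p \<in> Ops" "fst p \<in> carrier R" using Cons.prems Ops by (auto simp: p)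
  note V = Cons.prems(2,3) and U = Cons.prems(4,5) and le = Cons.prems(6,7)
  note fin = Cons.prems(8) and nil = Cons.prems(9)
  have V01: "V0 \<subseteq> V1" using le by blast
  have pU: "opY p U \<le> U" using U a by (auto simp: stable_def)
  then have aU: "act a (U n) \<subseteq> U (n + \<delta>)" for n
    using le_funD[OF pU, of "n + \<delta>"] by (simp add: p opY_shift_eq)
  have aV1: "act a V1 \<subseteq> V1" using act_le a V by blast
  have xs: "set xs \<subseteq> Ops" using Cons.prems by auto

  define Uc where "Uc = fpl U (\<lambda>_. act a V1)"
  have c: "eventually (\<lambda>n. difs (map snd xs) (\<lambda>n. rl (Uc n) V1) n = chi (map fst xs) (V0 \<boxplus> act a V1) V1) big"
  proof (rule Cons.IH[OF xs])
    show sm: "sm (V0 \<boxplus> act a V1)" using V a by simp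
    show fUc: "fam Uc" using U V a by (simp add: Uc_def)
    show "stable Ops Uc" unfolding Uc_def using U V a Ops by (intro stable_fpl stable_const) auto
    show "V0 \<boxplus> act a V1 \<subseteq> Uc n" "Uc n \<subseteq> V1" for n
      using pl_mono[OF le(1) order_refl, of "act a V1" n] pl_least[OF V(2) le(2) aV1, of n] by (auto simp: Uc_def fpl_def)
    show "eventually (\<lambda>n. fin (Uc n) V1) big"
    proof (rule eventually_fin_sub[OF fin U(1) fam_const[OF V(2)] fUc fam_const[OF V(2)]])
      show "U \<le> Uc" using U V a by (simp add: Uc_def fpl_upper1)
      show "Uc \<le> (\<lambda>_. V1)" using pl_least[OF V(2) le(2) aV1] by (simp add: Uc_def fpl_def le_fun_def)
    qed simp
    show "nil Ops (set xs) (\<lambda>_. V0 \<boxplus> act a V1) Uc"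
    proof (rule nilI)
      fix T' T assume T: "fam T'" "fam T" "stable Ops T'" "stable Ops T" "(\<lambda>_. V0 \<boxplus> act a V1) \<le> T'" "T' \<le> T" "T \<le> Uc"
        "\<And>q. q \<in> set xs \<Longrightarrow> opY q T \<le> T'"
      have T0: "V0 \<boxplus> act a V1 \<subseteq> T' n" for n using T(5) by (auto simp: le_fun_def)
      have T1: "V0 \<subseteq> T' n" "act a V1 \<subseteq> T' n" for n
        using T0[of n] pl_upper1[of V0 "act a V1"] pl_upper2[of V0 "act a V1"] V a by auto
      have TV: "T n \<subseteq> V1" for n
        using le_funD[OF T(7), of n] pl_least[OF V(2) le(2) aV1, of n] unfolding Uc_def fpl_def by (rule subset_trans)
      \<comment> \<open>The hypothesis \<open>nil\<close> concerns intervals inside U, whereas T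
        lies only in U + aV1. Since p maps T into aV1, hence into T', all of p and \<open>xs\<close>
        annihilate the interval cut down to U. Afterwards T is recovered as aV1 + (U \<inter> T) by
        the modular law.\<close>
      have "eventually (\<lambda>n. inf T U n = inf T' U n) big"
      proof (rule nilD[OF nil])
        show "fam (inf T' U)" "fam (inf T U)" by (rule fam_inf[OF T(1) U(1)], rule fam_inf[OF T(2) U(1)])
        show "stable Ops (inf T' U)" "stable Ops (inf T U)" using T U by (auto intro!: stable_inf)
        show "(\<lambda>_. V0) \<le> inf T' U" using T1 le by (auto simp: le_fun_def)
        fix q assume "q \<in> set (p # xs)"
        then consider "q = p" | "q \<in> set xs" by auto
        then show "opY q (inf T U) \<le> inf T' U"
        proof cases
          case 1
          have "act a (T n) \<subseteq> T' m" for n m using act_mono[OF TV] T1 by blast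
          then have "opY q T \<le> T'" using 1 by (simp add: le_fun_def opY_def p)
          moreover have "opY q U \<le> U" using 1 pU by simp
          ultimately show ?thesis using opY_mono[of "inf T U" T q] opY_mono[of "inf T U" U q]
            by (meson inf.bounded_iff inf_le1 inf_le2 order_trans)
        next
          case 2
          then have "opY q U \<le> U" "opY q T \<le> T'" using U xs T(8) by (auto simp: stable_def)
          then show ?thesis using opY_mono[of "inf T U" T q] opY_mono[of "inf T U" U q]
            by (meson inf.bounded_iff inf_le1 inf_le2 order_trans)
        qed
      qed (use T U in \<open>auto simp: le_fun_def\<close>)
      then show "eventually (\<lambda>n. T n = T' n) big"
      proof eventually_elim
        case (elim n)
        have s: "sm (T n)" "sm (T' n)" "sm (U n)" "sm (act a V1)" using T U V a by auto
        have "T n \<subseteq> (act a V1 \<boxplus> U n) \<inter> T n"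
          using T(7) pl_comm[OF s(3,4)] by (auto simp: le_fun_def Uc_def fpl_def)
        also have "\<dots> = act a V1 \<boxplus> (U n \<inter> T n)"
          using s T1(2)[of n] T(6) by (intro modular) (auto simp: le_fun_def)
        also have "\<dots> \<subseteq> T' n" using elim s T1 by (intro pl_least) auto
        finally show ?case using T(6) by (auto simp: le_fun_def)
      qed
    qed
  qed (rule V(2))

  define Kx where "Kx = V1 \<inter> col a V0"
  have sK: "sm Kx" "V0 \<subseteq> Kx" using V a V01 le_col[of a V0] by (auto simp: Kx_def)
  have KU: "Kx \<subseteq> V1 \<inter> col a (U n)" for n unfolding Kx_def using col_mono[OF le(1)] by auto
  have UU: "U n \<subseteq> V1 \<inter> col a (U (n + \<delta>))" for n
    using aU[of n] act_le_iff[of "U n" a] U le by auto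
  define Uk where "Uk = inf U (\<lambda>_. Kx)"
  have k: "eventually (\<lambda>n. difs (map snd xs) (\<lambda>n. rl (Uk n) Kx) n = chi (map fst xs) V0 Kx) big"
  proof (rule Cons.IH[OF xs])
    show fUk: "fam Uk" using U sK by (simp add: Uk_def)
    show "stable Ops Uk" unfolding Uk_def using U sK Ops by (intro stable_inf stable_const) auto
    show "V0 \<subseteq> Uk n" "Uk n \<subseteq> Kx" for n using le sK by (auto simp: Uk_def)
    show "eventually (\<lambda>n. fin (Uk n) Kx) big"
      using fin
    proof eventually_elim
      case (elim n)
      have "fin (U n) (U n \<boxplus> Kx)"
        using U V sK le KU[of n] by (intro fin_parts(1)[OF elim]) (simp_all add: pl_least pl_upper1)
      then show ?case using len_diamond[of "U n" Kx] U sK by (simp add: Uk_def fin_def)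
    qed
    show "nil Ops (set xs) (\<lambda>_. V0) Uk"
    proof (rule nil_remove[OF _ order_refl])
      show "nil Ops (insert p (set xs)) (\<lambda>_. V0) U" using nil by simp
      show "Uk \<le> U" by (simp add: Uk_def)
      fix W assume "W \<le> Uk" "fam W"
      then have "W n \<subseteq> col a V0" for n by (auto simp: le_fun_def Uk_def Kx_def)
      then show "opY p W \<le> (\<lambda>_. V0)" using act_le_iff \<open>fam W\<close> by (simp add: le_fun_def opY_def p)
    qed
  qed (use V sK in auto)

  \<comment> \<open>Multiplication by \<open>a\<close> carries the rest of the kernel, its quotient
    by U(n) + Kx, isomorphically onto W4/U4 in degree n + \<delta>. This interval lies in U and is
    killed by p, because p W4 \<subseteq> p U \<subseteq> U4.\<close>
  define U4 where "U4 = fpl (\<lambda>_. V0) (opY p U)"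
  define W4 where "W4 = fpl U4 (opY p (inf (\<lambda>_. V1) (opC p U)))"
  have f4: "fam U4" "fam W4" using V U a by (auto simp: U4_def W4_def)
  have le4: "U4 \<le> W4" using V U a by (simp add: U4_def W4_def fpl_upper1)
  have "opY p (inf (\<lambda>_. V1) (opC p U)) \<le> U"
    using opY_le_iff[of "inf (\<lambda>_. V1) (opC p U)" p U] U V a by simp
  then have W4U: "W4 \<le> U" unfolding W4_def U4_def
    using U pU le by (intro fpl_least) (auto simp: le_fun_def)
  have third: "len (U n \<boxplus> Kx) (V1 \<inter> col a (U (n + \<delta>))) = len (U4 (n + \<delta>)) (W4 (n + \<delta>))" for n
  proof -
    let ?W = "V1 \<inter> col a (U (n + \<delta>))" and ?U = "V0 \<boxplus> act a (U n)"
    have s: "sm ?W" "sm ?U" "sm (U n)" "sm (col a V0)" using U V a by auto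
    have "?W \<inter> col a ?U = (U n \<boxplus> col a V0) \<inter> ?W"
      using col_pl_act[of a "U n" V0] a U V pl_comm[OF s(3,4)] by auto
    also have "\<dots> = U n \<boxplus> (col a V0 \<inter> ?W)" using s UU by (intro modular) auto
    also have "col a V0 \<inter> ?W = Kx" using col_mono[OF le(1), of a] by (auto simp: Kx_def)
    finally have "len (U n \<boxplus> Kx) ?W = len ?U (?U \<boxplus> act a ?W)"
      using len_act[OF a(1) s(2,1)] by simp
    then show ?thesis by (simp add: U4_def W4_def fpl_def opY_shift_eq p opC_def)
  qed
  have fink: "eventually (\<lambda>n. fin (U n) (V1 \<inter> col a (U (n + \<delta>)))) big"
    using fin
  proof eventually_elim
    case (elim n)
    then show ?case using U V a UU[of n] by (intro fin_parts(1)[OF elim]) auto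
  qed
  have fin4': "eventually (\<lambda>n. fin (U n \<boxplus> Kx) (V1 \<inter> col a (U (n + \<delta>)))) big"
    using fink
  proof eventually_elim
    case (elim n)
    then show ?case using U V a UU[of n] KU[of "n + \<delta>"] sK
      by (intro fin_parts(2)[OF elim]) (simp_all add: pl_least pl_upper1)
  qed
  have fin4: "eventually (\<lambda>n. fin (U4 n) (W4 n)) big"
  proof -
    have "fin (U4 n) (W4 n) = fin (U (n - \<delta>) \<boxplus> Kx) (V1 \<inter> col a (U (n - \<delta> + \<delta>)))" for n
      using third[of "n - \<delta>"] unfolding fin_def by (simp only: diff_add_cancel)
    then show ?thesis using eventually_big_shift[OF fin4', of "-\<delta>"] by simp
  qed
  have v: "eventually (\<lambda>n. difs (map snd xs) (\<lambda>n. rl (U4 n) (W4 n)) n = 0) big"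
  proof (rule difs_len_vanish[OF Ops xs f4 le4 _ _ fin4])
    show "stable Ops U4" unfolding U4_def
      using U V a Ops by (intro stable_fpl stable_const stable_opY) auto
    then show "stable Ops W4" unfolding W4_def
      using U V a Ops f4 by (intro stable_fpl stable_const stable_opY stable_inf stable_opC) auto
    show "nil Ops (set xs) U4 W4"
    proof (rule nil_remove[OF _ _ W4U])
      show "nil Ops (insert p (set xs)) (\<lambda>_. V0) U" using nil by simp
      show "(\<lambda>_. V0) \<le> U4" using V U a by (simp add: U4_def fpl_upper1)
      fix W assume "W \<le> W4"
      then have "opY p W \<le> opY p U" using W4U by (auto intro!: opY_mono)
      also have "\<dots> \<le> U4" using V U a by (simp add: U4_def fpl_upper2)
      finally show "opY p W \<le> U4" .
    qed
  qed

  have "eventually (\<lambda>n. dif \<delta> (\<lambda>n. rl (U n) V1) n =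
      rl (Uc (n + \<delta>)) V1 - rl (Uk n) Kx - rl (U4 (n + \<delta>)) (W4 (n + \<delta>))) big"
    using fin eventually_big_shift[OF fin, of \<delta>] fink
  proof eventually_elim
    case (elim n)
    have "rl (U (n + \<delta>)) V1 - rl (U n) V1 = rl (U (n + \<delta>) \<boxplus> act a V1) V1 - rl (U n) (V1 \<inter> col a (U (n + \<delta>)))"
      using elim U V a le aU aV1 by (intro rl_coker_ker) auto
    moreover have "rl (U n) (V1 \<inter> col a (U (n + \<delta>))) = rl (U n) (U n \<boxplus> Kx) + rl (U n \<boxplus> Kx) (V1 \<inter> col a (U (n + \<delta>)))"
      using U V a UU[of n] KU[of "n + \<delta>"] sK
      by (intro rl_add[OF elim(3)]) (simp_all add: pl_least pl_upper1)
    moreover have "rl (U n) (U n \<boxplus> Kx) = rl (Uk n) Kx"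
      using len_diamond[of "U n" Kx] U sK by (simp add: Uk_def rl_def)
    ultimately show ?case using third[of n] by (simp add: dif_def Uc_def fpl_def rl_def)
  qed
  from eventually_difs_cong[OF this, of "map snd xs"] c[THEN eventually_big_shift, of \<delta>] k
    v[THEN eventually_big_shift, of \<delta>]
  show ?case
    by eventually_elim (simp add: p difs_diff Kx_def difs_shift[of _ "\<lambda>n. rl (Uc n) V1"]
        difs_shift[of _ "\<lambda>n. rl (U4 n) (W4 n)"])
qed

end

section \<open>Eventually polynomial functions\<close>

text \<open>Polynomial functions as an inductive predicate: closure under products, substitution and
  antidifferences then follows by rule induction. Coefficients are extracted only later, by
  \<open>PF_pfun\<close>.\<close>

inductive PF :: "(('g::finite \<Rightarrow> int) \<Rightarrow> real) \<Rightarrow> bool" where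
  monom: "PF (\<lambda>n. c * (\<Prod>i\<in>UNIV. real_of_int (n i) ^ \<alpha> i))"
| add: "PF f \<Longrightarrow> PF g \<Longrightarrow> PF (\<lambda>n. f n + g n)"

lemma PF_const: "PF (\<lambda>n. c)"
  using PF.monom[of c "\<lambda>_. 0"] by simp

lemma PF_coord: "PF (\<lambda>n. real_of_int (n k))"
proof -
  have "PF (\<lambda>n. 1 * (\<Prod>i\<in>UNIV. real_of_int (n i) ^ (if i = k then 1 else 0)))" by (rule PF.monom)
  moreover have "(\<Prod>i\<in>UNIV. real_of_int (n i) ^ (if i = k then 1 else 0)) = real_of_int (n k)" for n :: "'a \<Rightarrow> int"
  proof -
    have "(\<Prod>i\<in>UNIV. real_of_int (n i) ^ (if i = k then 1 else 0)) = (\<Prod>i\<in>UNIV. if i = k then real_of_int (n i) else 1)"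
      by (rule prod.cong) auto
    then show ?thesis by simp
  qed
  ultimately show ?thesis by simp
qed

lemma PF_mult: assumes "PF f" "PF g" shows "PF (\<lambda>n. f n * g n)"
  using assms(1)
proof induction
  case (monom c \<alpha>)
  show ?case using assms(2)
  proof induction
    case (monom c' \<alpha>')
    show ?case
      using PF.monom[of "c * c'" "\<lambda>i. \<alpha> i + \<alpha>' i"] by (simp add: power_add prod.distrib mult_ac)
  next
    case (add f g)
    show ?case using PF.add[OF add.IH] by (simp add: distrib_left)
  qed
next
  case (add f1 f2)
  show ?case using PF.add[OF add.IH] by (simp add: distrib_right)
qed

lemma PF_diff: "PF f \<Longrightarrow> PF g \<Longrightarrow> PF (\<lambda>n. f n - g n)"
  using PF.add[OF _ PF_mult[OF PF_const[of "-1"]], of f g] by simp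

lemma PF_sum: "finite A \<Longrightarrow> (\<And>j. j \<in> A \<Longrightarrow> PF (f j)) \<Longrightarrow> PF (\<lambda>n. \<Sum>j\<in>A. f j n)"
  by (induction A rule: finite_induct) (auto intro: PF_const PF.add)

lemma PF_power: "PF f \<Longrightarrow> PF (\<lambda>n. f n ^ k)"
  by (induction k) (auto intro: PF_const PF_mult)

lemma PF_prod: "finite A \<Longrightarrow> (\<And>j. j \<in> A \<Longrightarrow> PF (f j)) \<Longrightarrow> PF (\<lambda>n. \<Prod>j\<in>A. f j n)"
  by (induction A rule: finite_induct) (auto intro: PF_const PF_mult)

lemma PF_comp:
  assumes "PF f" "\<And>i. PF (\<lambda>n. real_of_int (s n i))" shows "PF (\<lambda>n. f (s n))"
  using assms(1)
  by induction (auto intro!: PF.add PF_mult PF_const PF_prod PF_power assms(2))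

text \<open>(t + 1)^(a+1) - t^(a+1) equals (a+1) t^a plus lower powers of t, and these have
  antidifferences by induction.\<close>

lemma antidifference_power:
  "\<exists>q::real poly. \<forall>t. poly q (t + 1) - poly q t = t ^ a"
proof (induction a rule: less_induct)
  case (less a)
  then have "\<forall>k. \<exists>q::real poly. k < a \<longrightarrow> (\<forall>t. poly q (t + 1) - poly q t = t ^ k)" by blast
  from choice[OF this] obtain q :: "nat \<Rightarrow> real poly"
    where q: "\<And>k t. k < a \<Longrightarrow> poly (q k) (t + 1) - poly (q k) t = t ^ k" by blast
  define Q where "Q = smult (1 / real (Suc a)) (Polynomial.monom 1 (Suc a) - (\<Sum>k<a. smult (real (Suc a choose k)) (q k)))"
  have "poly Q (t + 1) - poly Q t = t ^ a" for t
  proof -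
    have "(t + 1) ^ Suc a = (\<Sum>k\<le>Suc a. real (Suc a choose k) * t ^ k)"
      by (subst binomial_ring) simp
    also have "\<dots> = (\<Sum>k<a. real (Suc a choose k) * t ^ k) + real (Suc a) * t ^ a + t ^ Suc a"
      by (simp add: lessThan_Suc_atMost[symmetric] binomial_symmetric[of a "Suc a"] del: binomial_Suc_Suc)
    finally have e: "(t + 1) ^ Suc a - t ^ Suc a - (\<Sum>k<a. real (Suc a choose k) * t ^ k) = real (Suc a) * t ^ a"
      by simp
    have "poly Q (t + 1) - poly Q t = (1 / real (Suc a)) * ((t + 1) ^ Suc a - t ^ Suc a
        - (\<Sum>k<a. real (Suc a choose k) * (poly (q k) (t + 1) - poly (q k) t)))"
      unfolding Q_def by (simp add: poly_monom poly_sum sum_subtractf algebra_simps diff_divide_distrib add_divide_distrib)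
    also have "\<dots> = (1 / real (Suc a)) * (real (Suc a) * t ^ a)"
      unfolding e[symmetric] by (simp add: q)
    finally show ?thesis by simp
  qed
  then show ?case by blast
qed

definition unit :: "'g \<Rightarrow> 'g \<Rightarrow> int" where
  "unit k = (\<lambda>i. if i = k then 1 else 0)"

lemma fun_upd_add_unit: "m(k := t + 1) = m(k := t) + unit k"
  by (auto simp: unit_def fun_eq_iff plus_fun_def)

lemma PF_antidifference:
  fixes f :: "('g::finite \<Rightarrow> int) \<Rightarrow> real"
  assumes "PF f" shows "\<exists>F. PF F \<and> (\<forall>n. dif (unit k) F n = f n)"
  using assms
proof induction
  case (monom c \<alpha>)
  obtain q :: "real poly" where q: "\<And>t. poly q (t + 1) - poly q t = t ^ \<alpha> k"
    using antidifference_power by blast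
  define F where "F n = c * (\<Prod>i\<in>UNIV - {k}. real_of_int (n i) ^ \<alpha> i) * poly q (real_of_int (n k))" for n :: "'g \<Rightarrow> int"
  have "PF F" unfolding F_def poly_altdef
    by (intro PF_mult PF_const PF_prod PF_power PF_coord PF_sum) auto
  moreover have "dif (unit k) F n = c * (\<Prod>i\<in>UNIV. real_of_int (n i) ^ \<alpha> i)" for n
  proof -
    have "(\<Prod>i\<in>UNIV - {k}. real_of_int ((n + unit k) i) ^ \<alpha> i) = (\<Prod>i\<in>UNIV - {k}. real_of_int (n i) ^ \<alpha> i)"
      by (rule prod.cong) (auto simp: unit_def plus_fun_def)
    moreover have "real_of_int ((n + unit k) k) = real_of_int (n k) + 1" by (simp add: unit_def plus_fun_def)
    ultimately have "dif (unit k) F n = c * (\<Prod>i\<in>UNIV - {k}. real_of_int (n i) ^ \<alpha> i) * real_of_int (n k) ^ \<alpha> k"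
      unfolding dif_def F_def q[symmetric] by (simp only: right_diff_distrib)
    then show ?thesis by (subst prod.remove[of _ k]) (auto simp: mult_ac)
  qed
  ultimately show ?case by blast
next
  case (add f g)
  then obtain F G where "PF F" "\<And>n. dif (unit k) F n = f n" "PF G" "\<And>n. dif (unit k) G n = g n" by blast
  moreover have "dif (unit k) (\<lambda>n. F n + G n) n = dif (unit k) F n + dif (unit k) G n" for n
    by (simp add: dif_def)
  ultimately show ?case by (intro exI[of _ "\<lambda>n. F n + G n"]) (auto intro: PF.add)
qed

definition EP :: "(('g::finite \<Rightarrow> int) \<Rightarrow> real) \<Rightarrow> bool" where
  "EP f \<longleftrightarrow> (\<exists>p. PF p \<and> eventually (\<lambda>n. f n = p n) big)"

text \<open>Resetting the k-th coordinate to the bound N changes f by F k (n) minus F k at the reset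
  point, where F k is an antidifference of the k-th difference. Resetting all coordinates in turn
  leaves the constant f(N, ..., N). Each F k is used along its own direction only, so the
  antidifferences never have to be matched.\<close>

theorem EP_if_dif_EP:
  fixes f :: "('g::finite \<Rightarrow> int) \<Rightarrow> real"
  assumes "\<And>k. EP (dif (unit k) f)" shows "EP f"
proof -
  obtain p where p: "\<And>k. PF (p k)" "\<And>k. eventually (\<lambda>n. dif (unit k) f n = p k n) big"
    using assms unfolding EP_def by metis
  have "eventually (\<lambda>n. \<forall>k. dif (unit k) f n = p k n) big"
    by (rule eventually_all_finite) (rule p(2))
  then obtain N where N: "\<And>n k. (\<forall>i. N \<le> n i) \<Longrightarrow> dif (unit k) f n = p k n"
    unfolding eventually_big by blast
  obtain F where F: "\<And>k. PF (F k)" "\<And>k n. dif (unit k) (F k) n = p k n"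
  proof -
    have "\<forall>k. \<exists>F. PF F \<and> (\<forall>n. dif (unit k) F n = p k n)" using PF_antidifference[OF p(1)] by blast
    from choice[OF this] show thesis using that by blast
  qed
  have step: "f n = f (n(k := N)) + F k n - F k (n(k := N))" if n: "\<forall>i. N \<le> n i" for n k
  proof -
    define g where "g n = f n - F k n" for n
    have "g (n(k := N + int j)) = g (n(k := N))" for j
    proof (induction j)
      case (Suc j)
      let ?m = "n(k := N + int j)"
      have "dif (unit k) f ?m = dif (unit k) (F k) ?m" using N[of ?m k] n F(2)[of k ?m] by simp
      then have "g (?m + unit k) = g ?m" unfolding dif_def g_def by simp
      moreover have "n(k := N + int (Suc j)) = ?m + unit k"
        using fun_upd_add_unit[of n k "N + int j"] by (simp add: ac_simps)
      ultimately show ?case using Suc by simp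
    qed simp
    from this[of "nat (n k - N)"] show ?thesis using n by (simp add: g_def)
  qed
  define sub where "sub S n = (\<lambda>i. if i \<in> S then N else n i)" for S and n :: "'g \<Rightarrow> int"
  have PFsub: "PF (\<lambda>n. F' (sub S n))" if "PF F'" for F' S
  proof (rule PF_comp[OF that])
    show "PF (\<lambda>n. real_of_int (sub S n i))" for i
      by (cases "i \<in> S") (simp_all add: sub_def PF_const PF_coord)
  qed
  have "\<exists>q. PF q \<and> (\<forall>n. (\<forall>i. N \<le> n i) \<longrightarrow> f n = q n + f (sub S n))" for S :: "'g set"
  proof (induction S rule: infinite_finite_induct)
    case (insert k S)
    then obtain q where q: "PF q" "\<And>n. (\<forall>i. N \<le> n i) \<Longrightarrow> f n = q n + f (sub S n)" by blast
    have s: "(sub S n)(k := N) = sub (insert k S) n" for n by (auto simp: sub_def)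
    have "f n = q n + F k (sub S n) - F k (sub (insert k S) n) + f (sub (insert k S) n)" if "\<forall>i. N \<le> n i" for n
      using q(2)[OF that] step[of "sub S n" k] that unfolding s by (simp add: sub_def)
    moreover have "PF (\<lambda>n. q n + F k (sub S n) - F k (sub (insert k S) n))"
      by (intro PF.add PF_diff q PFsub F)
    ultimately show ?case by blast
  qed (auto simp: sub_def intro!: exI[of _ "\<lambda>_. 0"] PF_const)
  then obtain q where q: "PF q" "\<And>n. (\<forall>i. N \<le> n i) \<Longrightarrow> f n = q n + f (sub UNIV n)" by blast
  then have "eventually (\<lambda>n. f n = q n + f (\<lambda>_. N)) big"
    unfolding eventually_big
  proof (intro exI[of _ N] allI impI)
    fix n :: "'g \<Rightarrow> int" assume "\<forall>i. N \<le> n i"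
    from q(2)[OF this] show "f n = q n + f (\<lambda>_. N)" by (simp add: sub_def)
  qed
  moreover have "PF (\<lambda>n. q n + f (\<lambda>_. N))" by (intro PF.add q PF_const)
  ultimately show ?thesis unfolding EP_def by blast
qed

lemma EP_shift: assumes "EP f" shows "EP (\<lambda>n. f (n + \<delta>))"
proof -
  obtain p where p: "PF p" "eventually (\<lambda>n. f n = p n) big" using assms unfolding EP_def by blast
  have "PF (\<lambda>n. p (n + \<delta>))"
    by (rule PF_comp[OF p(1)]) (auto simp: plus_fun_def intro!: PF.add PF_coord PF_const)
  then show ?thesis using eventually_big_shift[OF p(2), of \<delta>] unfolding EP_def by blast
qed

lemma EP_diff: assumes "EP f" "EP g" shows "EP (\<lambda>n. f n - g n)"
proof -
  obtain p q where "PF p" "eventually (\<lambda>n. f n = p n) big" "PF q" "eventually (\<lambda>n. g n = q n) big"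
    using assms unfolding EP_def by blast
  then show ?thesis unfolding EP_def
    by (intro exI[of _ "\<lambda>n. p n - q n"] conjI PF_diff) (auto elim: eventually_elim2)
qed

lemma EP_cong: "EP f \<Longrightarrow> eventually (\<lambda>n. g n = f n) big \<Longrightarrow> EP g"
proof -
  assume "EP f" and g: "eventually (\<lambda>n. g n = f n) big"
  then obtain p where p: "PF p" "eventually (\<lambda>n. f n = p n) big" unfolding EP_def by blast
  have "eventually (\<lambda>n. g n = p n) big" using g p(2) by eventually_elim simp
  then show "EP g" using p(1) unfolding EP_def by blast
qed

context module
begin

text \<open>Induction on the number of operators. If each unit vector is the degree of an operator,
  the difference in that direction is expressed by cokernel and kernel of this operator, which are
  Noetherian over the remaining ones. If some direction k has no operator, W/U vanishes as soon as
  \<open>n k\<close> is large.\<close>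

theorem hilbert_polynomial:
  fixes U W :: "('g::finite \<Rightarrow> int) \<Rightarrow> 'c set"
  assumes "finite Ops" "fst ` Ops \<subseteq> carrier R" "snd ` Ops \<subseteq> range unit"
    and "fam U" "fam W" "U \<le> W" "stable Ops U" "stable Ops W" "acc Ops U W"
    and "eventually (\<lambda>n. fin (U n) (W n)) big"
  shows "EP (\<lambda>n. rl (U n) (W n))"
  using assms
proof (induction "card Ops" arbitrary: Ops U W rule: less_induct)
  case less
  note Ops = less.prems(1-3) and f = less.prems(4,5) and le = less.prems(6)
    and st = less.prems(7,8) and acc = less.prems(9) and fin = less.prems(10)
  show ?case
  proof (cases "\<forall>k. unit k \<in> snd ` Ops")
    case True
    show ?thesis
    proof (rule EP_if_dif_EP)
      fix k :: 'g
      obtain a where p: "(a, unit k) \<in> Ops" using True by (metis imageE prod.collapse)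
      define p where "p = (a, unit k)"
      have a: "a \<in> carrier R" "fst p \<in> carrier R" "p \<in> Ops" using p Ops by (auto simp: p_def)
      define O' where "O' = Ops - {p}"
      have O': "insert p O' = Ops" "finite O'" "fst ` O' \<subseteq> carrier R" "snd ` O' \<subseteq> range unit" "card O' < card Ops"
        using a Ops card_Diff1_less[of Ops p] by (auto simp: O'_def)
      define Uc where "Uc = fpl U (opY p W)"
      define Wk where "Wk = inf W (opC p U)"
      have fc: "fam Uc" "fam Wk" using f a by (auto simp: Uc_def Wk_def)
      have sc: "stable Ops Uc" "stable Ops Wk"
        unfolding Uc_def Wk_def using f a st Ops
        by (auto intro!: stable_fpl stable_opY stable_inf stable_opC)
      have pU: "opY p U \<le> U" "opY p W \<le> W" using st a by (auto simp: stable_def)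
      have lec: "U \<le> Uc" "Uc \<le> W" unfolding Uc_def using f a pU le
        by (auto intro: fpl_upper1 fpl_least)
      have "U \<le> opC p U" using pU opY_le_iff[OF f(1)] by simp
      then have lek: "U \<le> Wk" "Wk \<le> W" unfolding Wk_def using le by auto
      have Yk: "opY p Wk \<le> U" using opY_le_iff[OF fc(2)] by (simp add: Wk_def)
      have Yc: "opY p W \<le> Uc" using f a by (simp add: Uc_def fpl_upper2)
      have fins: "eventually (\<lambda>n. fin (Uc n) (W n)) big" "eventually (\<lambda>n. fin (U n) (Wk n)) big"
        using eventually_fin_sub[OF fin f fc(1) f(2) lec order_refl]
          eventually_fin_sub[OF fin f f(1) fc(2) order_refl lek] by auto
      have st': "stable O' X" if "stable Ops X" for X using that by (auto simp: stable_def O'_def)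
      have c: "EP (\<lambda>n. rl (Uc n) (W n))"
      proof (rule less.hyps[OF O'(5,2-4) fc(1) f(2) lec(2) st'[OF sc(1)] st'[OF st(2)] _ fins(1)])
        show "acc O' Uc W" using acc_remove[OF acc_sub[OF acc[folded O'(1)] lec(1) order_refl] Yc] .
      qed
      have k: "EP (\<lambda>n. rl (U n) (Wk n))"
      proof (rule less.hyps[OF O'(5,2-4) f(1) fc(2) lek(1) st'[OF st(1)] st'[OF sc(2)] _ fins(2)])
        show "acc O' U Wk" using acc_remove[OF acc_sub[OF acc[folded O'(1)] order_refl lek(2)] Yk] .
      qed
      have "eventually (\<lambda>n. dif (unit k) (\<lambda>n. rl (U n) (W n)) n = rl (Uc (n + unit k)) (W (n + unit k)) - rl (U n) (Wk n)) big"
        using dif_len[OF a(1) f le pU[unfolded p_def] fin] by (simp only: Uc_def Wk_def p_def)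
      then show "EP (dif (unit k) (\<lambda>n. rl (U n) (W n)))"
        by (rule EP_cong[OF EP_diff[OF EP_shift[OF c] k]])
    qed
  next
    case False
    then obtain k where k: "unit k \<notin> snd ` Ops" by blast
    \<comment> \<open>W up to degree j in direction k, and U beyond. This is stable because no
      operator moves in direction k; where the chain stops, W and U must agree.\<close>
    define F where "F j n = (if n k \<le> int j then W n else U n)" for j n
    have "\<forall>j. fam (F j) \<and> stable Ops (F j) \<and> U \<le> F j \<and> F j \<le> W \<and> F j \<le> F (Suc j)"
    proof (intro allI conjI)
      fix j
      show "fam (F j)" using f by (auto simp: fam_def F_def)
      show "U \<le> F j" "F j \<le> W" "F j \<le> F (Suc j)" using le by (auto simp: le_fun_def F_def)
      show "stable Ops (F j)" unfolding stable_def
      proof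
        fix p assume p: "p \<in> Ops"
        then have "snd p \<in> range unit" "snd p \<noteq> unit k" using Ops(3) k by (auto simp: image_iff)
        then obtain i where i: "snd p = unit i" "i \<noteq> k" by auto
        then have "(n - snd p) k = n k" for n by (simp add: unit_def fun_diff_def)
        moreover have "opY p U n \<subseteq> U n" "opY p W n \<subseteq> W n" for n
          using st p by (auto simp: stable_def le_fun_def)
        ultimately show "opY p (F j) \<le> F j" by (auto simp: le_fun_def F_def opY_def)
      qed
    qed
    then obtain j0 where j0: "\<And>j. j \<ge> j0 \<Longrightarrow> F j = F j0"
      using acc[unfolded acc_def, rule_format, of F] by auto
    have "rl (U n) (W n) = 0" if "\<forall>i. int j0 + 1 \<le> n i" for n
    proof -
      have n: "int j0 + 1 \<le> n k" using that by blast
      then have "F (nat (n k)) n = F j0 n" by (intro fun_cong[OF j0]) auto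
      then have "W n = U n" using n by (auto simp: F_def)
      then show ?thesis using f by simp
    qed
    then show ?thesis unfolding EP_def eventually_big by (intro exI[of _ "\<lambda>_. 0"]) (auto intro: PF_const)
  qed
qed

end

section \<open>Products of powers of ideals\<close>

definition multipow :: "('a, 'r) ring_scheme \<Rightarrow> ('k::finite \<Rightarrow> 'a set) \<Rightarrow> ('k \<Rightarrow> nat) \<Rightarrow> 'a set" where
  "multipow R J n = (\<Otimes>\<^bsub>ideals_set R\<^esub>i\<in>UNIV. J i [^]\<^bsub>ideals_set R\<^esub> n i)"

lemma ideals_set_simps [simp]:
  "carrier (ideals_set R) = {I. ideal I R}" "one (ideals_set R) = carrier R"
  "monoid.mult (ideals_set R) = ideal_prod R"
  by (simp_all add: ideals_set_def)

context cring
begin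

lemma ideal_pow [simp]: "ideal I R \<Longrightarrow> ideal (I [^]\<^bsub>ideals_set R\<^esub> (n::nat)) R"
  using monoid.nat_pow_closed[OF comm_monoid.axioms(1)[OF ideals_set_is_comm_monoid], of I n] by simp

lemma ideal_pow_Suc: "I [^]\<^bsub>ideals_set R\<^esub> Suc n = (I [^]\<^bsub>ideals_set R\<^esub> n) \<cdot> I"
  by (simp add: nat_pow_def)

lemma ideal_pow_0 [simp]: "I [^]\<^bsub>ideals_set R\<^esub> (0::nat) = carrier R"
  by (simp add: nat_pow_def)

lemma ideal_pow_1 [simp]: "ideal I R \<Longrightarrow> I [^]\<^bsub>ideals_set R\<^esub> (Suc 0) = I"
  by (simp add: ideal_pow_Suc ideal_prod_commute oneideal ideal_prod_one)

lemma ideal_pow_add: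
  "ideal I R \<Longrightarrow> I [^]\<^bsub>ideals_set R\<^esub> (m + n :: nat) = (I [^]\<^bsub>ideals_set R\<^esub> m) \<cdot> (I [^]\<^bsub>ideals_set R\<^esub> n)"
  using monoid.nat_pow_mult[OF comm_monoid.axioms(1)[OF ideals_set_is_comm_monoid], of I m n] by simp

lemma ideal_pow_pow:
  "ideal I R \<Longrightarrow> (I [^]\<^bsub>ideals_set R\<^esub> (m::nat)) [^]\<^bsub>ideals_set R\<^esub> (n::nat) = I [^]\<^bsub>ideals_set R\<^esub> (m * n)"
  using monoid.nat_pow_pow[OF comm_monoid.axioms(1)[OF ideals_set_is_comm_monoid], of I m n] by simp

lemma ideal_prod_mono: "I \<subseteq> I' \<Longrightarrow> J \<subseteq> J' \<Longrightarrow> I \<cdot> J \<subseteq> I' \<cdot> J'"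
proof
  fix x assume "I \<subseteq> I'" "J \<subseteq> J'" "x \<in> I \<cdot> J"
  show "x \<in> I' \<cdot> J'" using \<open>x \<in> I \<cdot> J\<close>
    by induction (use \<open>I \<subseteq> I'\<close> \<open>J \<subseteq> J'\<close> in \<open>auto intro: ideal_prod.intros\<close>)
qed

lemma ideal_prod_le1: "ideal I R \<Longrightarrow> ideal J R \<Longrightarrow> I \<cdot> J \<subseteq> I"
  using ideal_prod_inter by blast

lemma ideal_pow_mono: "I \<subseteq> J \<Longrightarrow> I [^]\<^bsub>ideals_set R\<^esub> (n::nat) \<subseteq> J [^]\<^bsub>ideals_set R\<^esub> n"
  by (induction n) (auto simp: ideal_pow_Suc ideal_prod_mono simp del: ideal_pow_1)

lemma ideal_pow_antimono:
  assumes "ideal I R" "m \<le> n" shows "I [^]\<^bsub>ideals_set R\<^esub> n \<subseteq> I [^]\<^bsub>ideals_set R\<^esub> (m::nat)"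
  using ideal_pow_add[OF assms(1), of m "n - m"] ideal_prod_le1[of "I [^]\<^bsub>ideals_set R\<^esub> m" "I [^]\<^bsub>ideals_set R\<^esub> (n - m)"] assms
  by simp

lemma multipow_ideal [simp]: "(\<And>i. ideal (J i) R) \<Longrightarrow> ideal (multipow R J n) R"
  using comm_monoid.finprod_closed[OF ideals_set_is_comm_monoid, of "\<lambda>i. J i [^]\<^bsub>ideals_set R\<^esub> n i" UNIV]
  by (simp add: multipow_def)

lemma multipow_add:
  assumes "\<And>i. ideal (J i) R"
  shows "multipow R J (\<lambda>i. m i + n i) = multipow R J m \<cdot> multipow R J n"
  using comm_monoid.finprod_multf[OF ideals_set_is_comm_monoid, of "\<lambda>i. J i [^]\<^bsub>ideals_set R\<^esub> m i" UNIV "\<lambda>i. J i [^]\<^bsub>ideals_set R\<^esub> n i"]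
  by (simp add: multipow_def assms ideal_pow_add)

lemma multipow_0 [simp]: "multipow R J (\<lambda>_. 0) = carrier R"
  using comm_monoid.finprod_one_eqI[OF ideals_set_is_comm_monoid, of UNIV "\<lambda>_. carrier R"]
  by (simp add: multipow_def)

lemma multipow_unit:
  assumes "\<And>i. ideal (J i) R" shows "multipow R J (\<lambda>i. if i = k then 1 else 0) = J k"
proof -
  have "(\<Otimes>\<^bsub>ideals_set R\<^esub>i\<in>UNIV. J i [^]\<^bsub>ideals_set R\<^esub> (if i = k then 1 else 0 :: nat)) =
      (\<Otimes>\<^bsub>ideals_set R\<^esub>i\<in>UNIV. if k = i then J i else one (ideals_set R))"
    by (rule comm_monoid.finprod_cong'[OF ideals_set_is_comm_monoid])
      (simp_all add: assms Pi_def oneideal ideal_prod_commute[of "carrier R"] ideal_prod_one)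
  also have "\<dots> = J k"
    using comm_monoid.finprod_singleton[OF ideals_set_is_comm_monoid, of k UNIV J] assms by simp
  finally show ?thesis by (simp add: multipow_def)
qed

lemma multipow_pow:
  assumes "\<And>i. ideal (J i) R"
  shows "multipow R J n [^]\<^bsub>ideals_set R\<^esub> (t::nat) = multipow R J (\<lambda>i. t * n i)"
proof (induction t)
  case (Suc t)
  show ?case
    using multipow_add[of J "\<lambda>i. t * n i" n, OF assms] by (simp only: ideal_pow_Suc Suc) (simp add: add.commute)
qed simp

lemma multipow_of_pow:
  assumes "\<And>i. ideal (J i) R"
  shows "multipow R (\<lambda>i. J i [^]\<^bsub>ideals_set R\<^esub> (m::nat)) n = multipow R J (\<lambda>i. m * n i)"
  by (simp add: multipow_def ideal_pow_pow assms)

lemma multipow_antimono: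
  assumes "\<And>i. ideal (J i) R" "\<And>i. m i \<le> n i" shows "multipow R J n \<subseteq> multipow R J m"
  using multipow_add[of J m "\<lambda>i. n i - m i", OF assms(1)] ideal_prod_le1[of "multipow R J m" "multipow R J (\<lambda>i. n i - m i)"] assms by simp

end

section \<open>Ideals acting on submodules\<close>

context module
begin

definition ism :: "'a set \<Rightarrow> 'c set \<Rightarrow> 'c set" where
  "ism I A = gen_submodule R M {a \<odot>\<^bsub>M\<^esub> x | a x. a \<in> I \<and> x \<in> A}"

lemma ideal_smult_eq_ism: "ideal_smult R M I = ism I (carrier M)"
  by (simp add: ideal_smult_def ism_def)

lemma sm_Inter: "\<A> \<noteq> {} \<Longrightarrow> (\<And>A. A \<in> \<A> \<Longrightarrow> sm A) \<Longrightarrow> sm (\<Inter>\<A>)"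
  by (rule smI) (auto simp: sm_zero sm_add sm_smult dest: sm_mem)

lemma sm_ism [simp]: "I \<subseteq> carrier R \<Longrightarrow> sm A \<Longrightarrow> sm (ism I A)"
  unfolding ism_def gen_submodule_def
  by (rule sm_Inter) (auto simp: sm_def[symmetric] sm_mem intro!: exI[of _ "carrier M"] dest: subsetD)

lemma ism_le_iff: "sm B \<Longrightarrow> ism I A \<subseteq> B \<longleftrightarrow> (\<forall>a\<in>I. act a A \<subseteq> B)"
  unfolding ism_def gen_submodule_def act_def sm_def by blast

lemma act_le_ism: "a \<in> I \<Longrightarrow> act a A \<subseteq> ism I A"
  unfolding ism_def gen_submodule_def act_def by blast

lemma ism_mono: "I \<subseteq> J \<Longrightarrow> A \<subseteq> B \<Longrightarrow> ism I A \<subseteq> ism J B"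
  unfolding ism_def gen_submodule_def by blast

lemma ism_le: "I \<subseteq> carrier R \<Longrightarrow> sm A \<Longrightarrow> ism I A \<subseteq> A"
  by (auto simp: ism_le_iff dest!: subsetD[of I] dest: act_le)

lemma ism_carrier [simp]: assumes "sm A" shows "ism (carrier R) A = A"
proof
  have "A \<subseteq> act \<one> A" using assms by (force simp: act_def sm_mem)
  also have "\<dots> \<subseteq> ism (carrier R) A" by (rule act_le_ism) simp
  finally show "A \<subseteq> ism (carrier R) A" .
qed (simp add: ism_le assms)

text \<open>As the conductor B : A is an ideal, an inclusion IA \<subseteq> B may be checked on
  generators of I. Sums and products of ideals acting on submodules are handled in this way.\<close>

lemma conductor_ideal:
  assumes A: "sm A" and B: "sm B" shows "ideal {a \<in> carrier R. act a A \<subseteq> B} R"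
proof (rule idealI)
  have *: "act a A \<subseteq> B \<longleftrightarrow> (\<forall>x\<in>A. a \<odot>\<^bsub>M\<^esub> x \<in> B)" for a by (auto simp: act_def)
  note smA = sm_mem[OF A]
  show "subgroup {a \<in> carrier R. act a A \<subseteq> B} (add_monoid R)"
    unfolding *
    by (rule R.add.subgroupI)
      (use B smA in \<open>auto simp: sm_zero sm_add smult_l_distr smult_l_minus sm_minus a_inv_def[symmetric] intro!: exI[of _ \<zero>]\<close>)
  fix a b assume "a \<in> {a \<in> carrier R. act a A \<subseteq> B}" "b \<in> carrier R"
  then show "b \<otimes> a \<in> {a \<in> carrier R. act a A \<subseteq> B}" "a \<otimes> b \<in> {a \<in> carrier R. act a A \<subseteq> B}"
    unfolding * using smA A B by (auto simp: smult_assoc1 sm_smult)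
qed (rule R.ring_axioms)

lemma ism_le_iff_conductor:
  "sm B \<Longrightarrow> I \<subseteq> carrier R \<Longrightarrow> ism I A \<subseteq> B \<longleftrightarrow> I \<subseteq> {a \<in> carrier R. act a A \<subseteq> B}"
  by (auto simp: ism_le_iff)

lemma ism_Idl_le_iff:
  assumes "S \<subseteq> carrier R" "sm A" "sm B"
  shows "ism (Idl S) A \<subseteq> B \<longleftrightarrow> (\<forall>s\<in>S. act s A \<subseteq> B)"
proof -
  have "ism (Idl S) A \<subseteq> B \<longleftrightarrow> Idl S \<subseteq> {a \<in> carrier R. act a A \<subseteq> B}"
    using assms by (intro ism_le_iff_conductor) (auto dest: ideal.Icarr[OF R.genideal_ideal[OF assms(1)]])
  also have "\<dots> \<longleftrightarrow> S \<subseteq> {a \<in> carrier R. act a A \<subseteq> B}"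
    using R.genideal_minimal[OF conductor_ideal[OF assms(2,3)], of S] R.genideal_self[OF assms(1)] by blast
  finally show ?thesis using assms by auto
qed

lemma act_mult: "a \<in> carrier R \<Longrightarrow> b \<in> carrier R \<Longrightarrow> sm A \<Longrightarrow> act (a \<otimes> b) A = act a (act b A)"
  unfolding act_def image_image by (intro image_cong refl) (simp add: sm_mem smult_assoc1)

lemma ideal_carr: "ideal I R \<Longrightarrow> I \<subseteq> carrier R"
  by (auto intro: ideal.Icarr)

lemma ism_prod:
  assumes I: "ideal I R" and J: "ideal J R" and A: "sm A"
  shows "ism (I \<cdot> J) A = ism I (ism J A)"
proof
  note c = ideal_carr[OF I] ideal_carr[OF J] ideal_carr[OF R.ideal_prod_is_ideal[OF I J]]
  have B: "sm (ism I (ism J A))" using c A by simp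
  have "I \<cdot> J \<subseteq> {a \<in> carrier R. act a A \<subseteq> ism I (ism J A)}"
  proof
    fix s assume "s \<in> I \<cdot> J"
    then show "s \<in> {a \<in> carrier R. act a A \<subseteq> ism I (ism J A)}"
    proof induction
      case (prod i j)
      have "act (i \<otimes> j) A = act i (act j A)" using prod c A by (intro act_mult) auto
      also have "\<dots> \<subseteq> act i (ism J A)" using prod by (intro act_mono act_le_ism)
      also have "\<dots> \<subseteq> ism I (ism J A)" using prod by (intro act_le_ism)
      finally show ?case using prod c by auto
    next
      case (sum s1 s2)
      then show ?case using additive_subgroup.a_closed[OF ideal.axioms(1)[OF conductor_ideal[OF A B]]] by blast
    qed
  qed
  then show "ism (I \<cdot> J) A \<subseteq> ism I (ism J A)" using B c by (simp add: ism_le_iff_conductor)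
  have C: "sm (ism (I \<cdot> J) A)" using c A by simp
  have "act i (ism J A) \<subseteq> ism (I \<cdot> J) A" if i: "i \<in> I" for i
  proof -
    have ic: "i \<in> carrier R" using i c by blast
    have "act j A \<subseteq> col i (ism (I \<cdot> J) A)" if "j \<in> J" for j
    proof -
      have jc: "j \<in> carrier R" using that c by blast
      have "act i (act j A) \<subseteq> ism (I \<cdot> J) A"
        using act_le_ism[OF ideal_prod.prod[OF i that], of R A] act_mult[OF ic jc A] by simp
      then show ?thesis using act_le_iff[of "act j A" i] A jc by simp
    qed
    then have "ism J A \<subseteq> col i (ism (I \<cdot> J) A)" using C ic by (simp add: ism_le_iff)
    then show ?thesis using act_le_iff[of "ism J A" i] A c by simp
  qed
  then show "ism I (ism J A) \<subseteq> ism (I \<cdot> J) A" using C by (simp add: ism_le_iff)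
qed

subsection \<open>The multigraded family of a tuple of ideals\<close>

text \<open>J^n M, continued by 0 to exponents with a negative entry. With this continuation the
  family is generated by M in degree 0, which \<open>JM_le\<close> exploits.\<close>

definition JM :: "('k::finite \<Rightarrow> 'a set) \<Rightarrow> ('k \<Rightarrow> int) \<Rightarrow> 'c set" where
  "JM J n = (if \<forall>i. 0 \<le> n i then ism (multipow R J (\<lambda>i. nat (n i))) (carrier M) else {\<zero>\<^bsub>M\<^esub>})"

lemma multipow_carr: "(\<And>i. ideal (J i) R) \<Longrightarrow> multipow R J n \<subseteq> carrier R"
  by (intro ideal_carr R.multipow_ideal)

lemma fam_JM: "(\<And>i. ideal (J i) R) \<Longrightarrow> fam (JM J)"
  by (auto simp: fam_def JM_def multipow_carr)

lemma JM_add_eq: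
  assumes J: "\<And>i. ideal (J i) R" and "\<forall>i. 0 \<le> n i"
  shows "ism (multipow R J m) (JM J n) = JM J (n + (\<lambda>i. int (m i)))"
proof -
  have "ism (multipow R J m) (JM J n) = ism (multipow R J m \<cdot> multipow R J (\<lambda>i. nat (n i))) (carrier M)"
    using assms by (simp add: JM_def ism_prod)
  also have "\<dots> = ism (multipow R J (\<lambda>i. m i + nat (n i))) (carrier M)"
    using J by (simp add: R.multipow_add)
  also have "(\<lambda>i. m i + nat (n i)) = (\<lambda>i. nat ((n + (\<lambda>i. int (m i))) i))"
    using assms by (auto simp: plus_fun_def nat_add_distrib)
  also have "ism (multipow R J \<dots>) (carrier M) = JM J (n + (\<lambda>i. int (m i)))"
    using assms by (simp add: JM_def plus_fun_def)
  finally show ?thesis .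
qed

lemma JM_add:
  assumes J: "\<And>i. ideal (J i) R"
  shows "ism (multipow R J m) (JM J n) \<subseteq> JM J (n + (\<lambda>i. int (m i)))"
proof (cases "\<forall>i. 0 \<le> n i")
  case True
  then show ?thesis using JM_add_eq[of J n m, OF J] by simp
next
  case False
  then have "ism (multipow R J m) (JM J n) \<subseteq> {\<zero>\<^bsub>M\<^esub>}"
    using J ism_le[OF multipow_carr[of J m, OF J] sm_bot] by (auto simp: JM_def)
  also have "\<dots> \<subseteq> JM J (n + (\<lambda>i. int (m i)))" by (rule bot_least[OF fam_D[OF fam_JM[of J, OF J]]])
  finally show ?thesis .
qed

lemma JM_unit:
  assumes J: "\<And>i. ideal (J i) R" shows "ism (J k) (JM J n) \<subseteq> JM J (n + unit k)"
proof -
  have "(\<lambda>i. int (if i = k then 1 else 0)) = unit k" by (auto simp: unit_def)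
  then show ?thesis using JM_add[of J "\<lambda>i. if i = k then 1 else 0" n, OF J] R.multipow_unit[of J k, OF J] by simp
qed

lemma opY_JM:
  assumes J: "\<And>i. ideal (J i) R" and a: "a \<in> J k" shows "opY (a, unit k) (JM J) \<le> JM J"
  unfolding le_fun_def
proof
  fix n
  have "act a (JM J (n - unit k)) \<subseteq> ism (J k) (JM J (n - unit k))" by (rule act_le_ism[OF a])
  also have "\<dots> \<subseteq> JM J n" using JM_unit[of J k "n - unit k", OF J] by simp
  finally show "opY (a, unit k) (JM J) n \<subseteq> JM J n" by (simp add: opY_def)
qed

definition gens :: "('k \<Rightarrow> 'a set) \<Rightarrow> ('a \<times> ('k \<Rightarrow> int)) set" where
  "gens S = (\<Union>k. (\<lambda>a. (a, unit k)) ` S k)"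

lemma gens_simps:
  fixes S :: "'k::finite \<Rightarrow> 'a set"
  assumes "\<And>k. finite (S k)" "\<And>k. S k \<subseteq> carrier R"
  shows "finite (gens S)" "fst ` gens S \<subseteq> carrier R" "snd ` gens S \<subseteq> range unit"
  using assms by (auto simp: gens_def dest: subsetD[OF assms(2)])

text \<open>Induction on the total degree: J^n M is generated by products of one generator of some J
  k with J^(n - e_k) M. The lemma places \<open>JM J\<close> inside the ambient family of
  \<open>noetherian_family_exists\<close>, which gives it the chain condition.\<close>

lemma JM_le:
  assumes J: "\<And>i. ideal (J i) R" and S: "\<And>k. S k \<subseteq> carrier R" "\<And>k. J k = Idl (S k)"
    and G: "fam G" "stable (gens S) G" "G (\<lambda>_. 0) = carrier M"
  shows "JM J \<le> G"
proof -
  have "ism (multipow R J n) (carrier M) \<subseteq> G (\<lambda>i. int (n i))" for n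
  proof (induction "\<Sum>i\<in>UNIV. n i" arbitrary: n)
    case 0
    then have "n = (\<lambda>_. 0)" by auto
    then show ?case using G(3) by simp
  next
    case (Suc m)
    then obtain k where k: "n k \<noteq> 0" by (metis sum.neutral nat.simps(3))
    define n' where "n' = n(k := n k - 1)"
    have n: "n = (\<lambda>i. (if i = k then 1 else 0) + n' i)" using k by (auto simp: n'_def)
    have "(\<Sum>i\<in>UNIV. n i) = 1 + (\<Sum>i\<in>UNIV. n' i)" by (subst n) (simp add: sum.distrib)
    then have IH: "ism (multipow R J n') (carrier M) \<subseteq> G (\<lambda>i. int (n' i))" using Suc by simp
    have "multipow R J n = J k \<cdot> multipow R J n'"
      by (subst n) (simp only: R.multipow_add[OF J] R.multipow_unit[OF J])
    then have "ism (multipow R J n) (carrier M) = ism (Idl (S k)) (ism (multipow R J n') (carrier M))"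
      using J by (simp add: ism_prod S(2)[symmetric])
    also have "\<dots> \<subseteq> G (\<lambda>i. int (n i))"
    proof (subst ism_Idl_le_iff[OF S(1)])
      show "\<forall>s\<in>S k. act s (ism (multipow R J n') (carrier M)) \<subseteq> G (\<lambda>i. int (n i))"
      proof
        fix s assume "s \<in> S k"
        then have "opY (s, unit k) G \<le> G" using G(2) by (auto simp: stable_def gens_def)
        moreover have "(\<lambda>i. int (n i)) - unit k = (\<lambda>i. int (n' i))"
          using k by (auto simp: fun_diff_def unit_def n'_def)
        ultimately have "act s (G (\<lambda>i. int (n' i))) \<subseteq> G (\<lambda>i. int (n i))"
          by (auto simp: le_fun_def opY_def dest!: spec[of _ "\<lambda>i. int (n i)"])
        then show "act s (ism (multipow R J n') (carrier M)) \<subseteq> G (\<lambda>i. int (n i))"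
          using act_mono[OF IH] by blast
      qed
    qed (use J G in \<open>auto simp: multipow_carr\<close>)
    finally show ?case .
  qed
  then have *: "ism (multipow R J n) (carrier M) \<subseteq> G (\<lambda>i. int (n i))" for n .
  show ?thesis unfolding le_fun_def
  proof
    fix n show "JM J n \<subseteq> G n"
    proof (cases "\<forall>i. 0 \<le> n i")
      case True
      then have "(\<lambda>i. int (nat (n i))) = n" by auto
      then show ?thesis using *[of "\<lambda>i. nat (n i)"] True by (simp add: JM_def)
    next
      case False
      then show ?thesis using bot_least[OF fam_D[OF G(1)]] by (auto simp: JM_def)
    qed
  qed
qed

end

section \<open>Joint reductions\<close>

text \<open>An extra coordinate \<open>q\<close>, the exponent of the ideal generated by the joint reduction.\<close>

definition lift :: "('k \<Rightarrow> int) \<Rightarrow> int \<Rightarrow> 'k option \<Rightarrow> int" where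
  "lift n q = (\<lambda>i. case i of None \<Rightarrow> q | Some k \<Rightarrow> n k)"

lemma lift_diff: "lift n q - lift n' q' = lift (n - n') (q - q')"
  by (auto simp: lift_def fun_diff_def split: option.splits)

lemma lift_eq: "(\<And>k. i (Some k) = n k) \<Longrightarrow> i None = q \<Longrightarrow> i = lift n q"
  by (auto simp: lift_def fun_eq_iff split: option.splits)

context module
begin

context
  fixes J S :: "'k::finite \<Rightarrow> 'a set"
  assumes noeth: noeth
    and J: "\<And>k. ideal (J k) R"
    and finS: "\<And>k. finite (S k)" and S: "\<And>k. S k \<subseteq> carrier R" and JS: "\<And>k. J k = Idl (S k)"
begin

lemma gens_JM_stable: "stable (gens S) (JM J)"
proof -
  have "S k \<subseteq> J k" for k using R.genideal_self[OF S[of k]] by (simp add: JS)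
  then show ?thesis using opY_JM[of J, OF J] unfolding stable_def gens_def by blast
qed

lemma JM_acc: "acc (gens S) bt (JM J)"
proof -
  obtain G where G: "fam G" "stable (gens S) G" "acc (gens S) bt G" "G (\<lambda>_. 0) = carrier M"
    using noetherian_family_exists[OF noeth gens_simps(1,2)[of S, OF finS S]] by blast
  show ?thesis by (rule acc_sub[OF G(3) order_refl JM_le[OF J S JS G(1,2,4)]])
qed

text \<open>The quotients M/J^n M are not the pieces of a graded interval with a chain condition.
  The quotients J^n M/J^(n + e_k) M are, and their lengths are the differences of the length of
  M/J^n M.\<close>

theorem JM_hilbert:
  assumes fin: "eventually (\<lambda>n. fin (JM J n) (carrier M)) big"
  shows "EP (\<lambda>n. rl (JM J n) (carrier M))"
proof (rule EP_if_dif_EP)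
  fix k
  note fJ = fam_JM[of J, OF J]
  \<comment> \<open>The intersection has an effect only in degrees with k-th coordinate -1, where
    the shifted family can already be nonzero while \<open>JM J\<close> is 0.\<close>
  define U where "U = inf (JM J) (\<lambda>n. JM J (n + unit k))"
  have fs: "fam (\<lambda>n. JM J (n + unit k))" using fJ by (simp add: fam_def)
  have fU: "fam U" unfolding U_def by (rule fam_inf[OF fJ fs])
  have sU: "stable (gens S) U" unfolding U_def
  proof (rule stable_inf[OF gens_JM_stable])
    show "stable (gens S) (\<lambda>n. JM J (n + unit k))" unfolding stable_def le_fun_def
    proof (intro ballI allI)
      fix p n assume "p \<in> gens S"
      then have "opY p (JM J) (n + unit k) \<subseteq> JM J (n + unit k)"
        using gens_JM_stable by (auto simp: stable_def le_fun_def)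
      then show "opY p (\<lambda>n. JM J (n + unit k)) n \<subseteq> JM J (n + unit k)"
        by (simp add: opY_def add_diff_eq diff_add_eq)
    qed
  qed
  have le: "U \<le> JM J" by (simp add: U_def)
  have JMsub: "JM J (n + unit k) \<subseteq> JM J n" if "\<forall>i. 0 \<le> n i" for n
  proof -
    have "multipow R J (\<lambda>i. nat ((n + unit k) i)) \<subseteq> multipow R J (\<lambda>i. nat (n i))"
      by (rule R.multipow_antimono[of J, OF J]) (simp add: plus_fun_def unit_def nat_mono)
    moreover have "\<forall>i. 0 \<le> (n + unit k) i" using that by (simp add: plus_fun_def unit_def)
    ultimately show ?thesis unfolding JM_def by (simp only: that if_True simp_thms) (rule ism_mono, auto)
  qed
  have evU: "eventually (\<lambda>n. U n = JM J (n + unit k)) big"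
    unfolding eventually_big
  proof (intro exI[of _ 0] allI impI)
    fix n :: "'k \<Rightarrow> int" assume "\<forall>i. 0 \<le> n i"
    from JMsub[OF this] show "U n = JM J (n + unit k)" by (auto simp: U_def)
  qed
  have fm: "eventually (\<lambda>n. fin (U n) (carrier M)) big"
    using evU fin[THEN eventually_big_shift, of "unit k"] by eventually_elim simp
  then have finU: "eventually (\<lambda>n. fin (U n) (JM J n)) big"
  proof eventually_elim
    case (elim n)
    show ?case using le fU fJ by (intro fin_parts(1)[OF elim]) (auto simp: le_fun_def sm_carr)
  qed
  have "EP (\<lambda>n. rl (U n) (JM J n))"
  proof (rule hilbert_polynomial[OF gens_simps[of S, OF finS S] fU fJ le sU gens_JM_stable _ finU])
    show "acc (gens S) U (JM J)" using acc_sub[OF JM_acc] fU by simp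
  qed
  moreover have "eventually (\<lambda>n. dif (unit k) (\<lambda>n. rl (JM J n) (carrier M)) n = rl (U n) (JM J n)) big"
    using fm evU
  proof eventually_elim
    case (elim n)
    have "rl (U n) (carrier M) = rl (U n) (JM J n) + rl (JM J n) (carrier M)"
      using le fU fJ by (intro rl_add[OF elim(1)]) (auto simp: le_fun_def sm_carr)
    then show ?case using elim(2) by (simp add: dif_def)
  qed
  ultimately show "EP (dif (unit k) (\<lambda>n. rl (JM J n) (carrier M)))" by (rule EP_cong)
qed

text \<open>\<open>red\<close> says that for large n the module J^n M is generated by the x J^(n -
  e_k) M with (x, k) in the list. Quantifying over the submodules B that contain these pieces avoids
  a sum of submodules over a list.\<close>

context
  fixes xs :: "('a \<times> 'k) list"
  assumes xJ: "\<And>x k. (x, k) \<in> set xs \<Longrightarrow> x \<in> J k"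
    and red: "eventually (\<lambda>n. \<forall>B. sm B \<longrightarrow> (\<forall>(x, k)\<in>set xs. act x (JM J (n - unit k)) \<subseteq> B) \<longrightarrow> JM J n \<subseteq> B) big"
begin

definition xops :: "('a \<times> ('k \<Rightarrow> int)) list" where
  "xops = map (\<lambda>(x, k). (x, unit k)) xs"

lemma x_carr: "(x, k) \<in> set xs \<Longrightarrow> x \<in> carrier R"
  using xJ ideal.Icarr[OF J] by blast

text \<open>An Artin--Rees argument: in large degrees every element of \<open>V\<close> lies in \<open>(x)\<^sup>q JM J\<close>, and the
  chain condition for the bigraded family moves one factor \<open>x\<close> onto \<open>V\<close> itself.\<close>

lemma JM_nil: "nil (gens S \<union> set xops) (set xops) bt (JM J)"
proof (rule nilI)
  fix V' V assume f: "fam V'" "fam V" and st: "stable (gens S \<union> set xops) V'" "stable (gens S \<union> set xops) V"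
    and le: "V' \<le> V" "V \<le> JM J" and kill: "\<And>p. p \<in> set xops \<Longrightarrow> opY p V \<le> V'"
  \<comment> \<open>The extra coordinate counts factors x: operators from \<open>S\<close> leave it
    alone, those from \<open>xs\<close> raise it by 1.\<close>
  define Y where "Y = (\<lambda>(a, \<delta>). (a, lift \<delta> 0)) ` gens S \<union> (\<lambda>(a, \<delta>). (a, lift \<delta> 1)) ` set xops"
  have Y: "finite Y" "fst ` Y \<subseteq> carrier R"
    using gens_simps(1,2)[of S, OF finS S] x_carr by (auto simp: Y_def xops_def)
  obtain G where G: "fam G" "stable Y G" "acc Y bt G" "G (\<lambda>_. 0) = carrier M"
    using noetherian_family_exists[OF noeth Y] by blast
  have G1: "act a (G (lift (n - \<delta>) q)) \<subseteq> G (lift n q)" if "(a, \<delta>) \<in> gens S" for a \<delta> n q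
  proof -
    have "(a, lift \<delta> 0) \<in> Y" using that by (force simp: Y_def)
    then have "opY (a, lift \<delta> 0) G (lift n q) \<subseteq> G (lift n q)" using G(2) by (auto simp: stable_def le_fun_def)
    then show ?thesis by (simp add: opY_def lift_diff)
  qed
  have G2: "act a (G (lift (n - \<delta>) (q - 1))) \<subseteq> G (lift n q)" if "(a, \<delta>) \<in> set xops" for a \<delta> n q
  proof -
    have "(a, lift \<delta> 1) \<in> Y" using that by (force simp: Y_def)
    then have "opY (a, lift \<delta> 1) G (lift n q) \<subseteq> G (lift n q)" using G(2) by (auto simp: stable_def le_fun_def)
    then show ?thesis by (simp add: opY_def lift_diff)
  qed
  \<comment> \<open>Applying \<open>red\<close> q times produces q factors x; the shifts of the
    degree are absorbed because n is large.\<close>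
  have big: "eventually (\<lambda>n. JM J n \<subseteq> G (lift n (int q))) big" for q
  proof (induction q)
    case 0
    have "JM J \<le> (\<lambda>n. G (lift n 0))"
    proof (rule JM_le[OF J S JS])
      show "fam (\<lambda>n. G (lift n 0))" using G(1) by (simp add: fam_def)
      show "stable (gens S) (\<lambda>n. G (lift n 0))"
        using G1 by (auto simp: stable_def le_fun_def opY_def subset_iff)
      have "lift (\<lambda>_. 0) 0 = (\<lambda>_::'k option. 0)" by (auto simp: lift_def split: option.splits)
      then show "G (lift (\<lambda>_. 0) 0) = carrier M" using G(4) by simp
    qed
    then show ?case by (simp add: le_fun_def)
  next
    case (Suc q)
    have "eventually (\<lambda>n. \<forall>k. JM J (n - unit k) \<subseteq> G (lift (n - unit k) (int q))) big"
    proof (rule eventually_all_finite)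
      show "eventually (\<lambda>n. JM J (n - unit k) \<subseteq> G (lift (n - unit k) (int q))) big" for k
        unfolding diff_conv_add_uminus by (rule eventually_big_shift[OF Suc])
    qed
    then show ?case using red
    proof eventually_elim
      case (elim n)
      have "act x (JM J (n - unit k)) \<subseteq> G (lift n (int (Suc q)))" if "(x, k) \<in> set xs" for x k
      proof -
        have "(x, unit k) \<in> set xops" using that by (force simp: xops_def)
        from G2[OF this, of n "int (Suc q)"] act_mono[OF elim(1)[rule_format, of k], of x] show ?thesis
          by auto
      qed
      then show ?case using elim(2)[rule_format, of "G (lift n (int (Suc q)))"] G(1) by (auto simp del: of_nat_Suc)
    qed
  qed
  \<comment> \<open>V up to height j in the extra coordinate and V' above, cut down to G. Only an
    operator x crosses from height j to j + 1, and it sends V into V', so F j is stable. Where the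
    chain stops, V and V' agree on G at height j0 + 1, and there G contains \<open>JM J\<close> in
    large degrees.\<close>
  define F where "F j i = (if i None \<le> int j then V (\<lambda>k. i (Some k)) else V' (\<lambda>k. i (Some k))) \<inter> G i" for j i
  have Fl: "F j (lift n q) = (if q \<le> int j then V n else V' n) \<inter> G (lift n q)" for j n q
    by (simp add: F_def lift_def)
  have ex: "\<exists>n q. i = lift n q" for i :: "'k option \<Rightarrow> int"
    using lift_eq[of i "\<lambda>k. i (Some k)" "i None"] by blast
  have V'V: "V' n \<subseteq> V n" for n using le by (auto simp: le_fun_def)
  have "\<forall>j. fam (F j) \<and> stable Y (F j) \<and> bt \<le> F j \<and> F j \<le> G \<and> F j \<le> F (Suc j)"
  proof (intro allI conjI)
    fix j
    show fF: "fam (F j)" using f G(1) by (auto simp: fam_def F_def)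
    then show "bt \<le> F j" by simp
    show "F j \<le> G" by (auto simp: le_fun_def F_def)
    show "F j \<le> F (Suc j)" using V'V by (auto simp: le_fun_def F_def)
    show "stable Y (F j)" unfolding stable_def le_fun_def
    proof (intro ballI allI)
      fix p and i :: "'k option \<Rightarrow> int" assume "p \<in> Y"
      obtain n q where i: "i = lift n q" using ex by blast
      from \<open>p \<in> Y\<close> consider (g) a \<delta> where "p = (a, lift \<delta> 0)" "(a, \<delta>) \<in> gens S"
        | (x) a \<delta> where "p = (a, lift \<delta> 1)" "(a, \<delta>) \<in> set xops" unfolding Y_def by auto
      then show "opY p (F j) i \<subseteq> F j i"
      proof cases
        case g
        have "opY (a, \<delta>) V n \<subseteq> V n" "opY (a, \<delta>) V' n \<subseteq> V' n"
          using st g(2) by (auto simp: stable_def le_fun_def)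
        then show ?thesis using G1[OF g(2), of n q] unfolding i g(1) opY_def
          by (auto simp: lift_diff Fl act_def)
      next
        case x
        have "opY (a, \<delta>) V n \<subseteq> V' n" using kill[OF x(2)] by (auto simp: le_fun_def)
        then have "act a (V (n - \<delta>)) \<subseteq> V' n" "act a (V' (n - \<delta>)) \<subseteq> V' n"
          using act_mono[OF V'V, of a "n - \<delta>"] by (auto simp: opY_def)
        then show ?thesis using G2[OF x(2), of n q] V'V[of n] unfolding i x(1) opY_def
          by (auto simp: lift_diff Fl act_def)
      qed
    qed
  qed
  then obtain j0 where j0: "\<And>j. j \<ge> j0 \<Longrightarrow> F j = F j0"
    using G(3)[unfolded acc_def, rule_format, of F] by auto
  from big[of "Suc j0"] show "eventually (\<lambda>n. V n = V' n) big"
  proof eventually_elim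
    case (elim n)
    have "F (Suc j0) (lift n (int (Suc j0))) = F j0 (lift n (int (Suc j0)))"
      by (intro fun_cong[OF j0]) simp
    then have "V n \<inter> G (lift n (int (Suc j0))) = V' n \<inter> G (lift n (int (Suc j0)))" by (simp add: Fl)
    moreover have "V n \<subseteq> JM J n" using le by (simp add: le_fun_def)
    ultimately show ?case using elim V'V[of n] by blast
  qed
qed

theorem joint_reduction_difs:
  assumes fin: "eventually (\<lambda>n. fin (JM J n) (carrier M)) big"
  shows "eventually (\<lambda>n. difs (map (\<lambda>(x, k). unit k) xs) (\<lambda>n. rl (JM J n) (carrier M)) n
     = chi (map fst xs) {\<zero>\<^bsub>M\<^esub>} (carrier M)) big"
proof -
  have e: "map snd xops = map (\<lambda>(x, k). unit k) xs" "map fst xops = map fst xs"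
    by (auto simp: xops_def)
  have xst: "stable (gens S \<union> set xops) (JM J)"
    using gens_JM_stable opY_JM[of J, OF J] xJ by (auto simp: stable_def xops_def)
  show ?thesis
    unfolding e[symmetric]
  proof (rule difs_len_eq_chi[of "gens S \<union> set xops"])
    show "fst ` (gens S \<union> set xops) \<subseteq> carrier R"
      using gens_simps(2)[of S, OF finS S] x_carr by (auto simp: xops_def)
    show "{\<zero>\<^bsub>M\<^esub>} \<subseteq> JM J n" "JM J n \<subseteq> carrier M" for n
      by (rule bot_least[OF fam_D[OF fam_JM[of J, OF J]]]) (rule sm_carr[OF fam_D[OF fam_JM[of J, OF J]]])
    show "nil (gens S \<union> set xops) (set xops) (\<lambda>_. {\<zero>\<^bsub>M\<^esub>}) (JM J)"
      using JM_nil by (simp add: bt_def)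
  qed (use fin xst fam_JM[of J, OF J] in auto)
qed

end

end

end

section \<open>Coefficients of multivariate polynomial functions\<close>

definition monval :: "('k::finite \<Rightarrow> nat) \<Rightarrow> ('k \<Rightarrow> real) \<Rightarrow> real" where
  "monval \<alpha> u = (\<Prod>i\<in>UNIV. u i ^ \<alpha> i)"

definition pfun :: "(('k::finite \<Rightarrow> nat) \<Rightarrow> real) \<Rightarrow> ('k \<Rightarrow> real) \<Rightarrow> real" where
  "pfun c u = (\<Sum>\<alpha> | c \<alpha> \<noteq> 0. c \<alpha> * monval \<alpha> u)"

lemma poly_fun_eq_pfun: "poly_fun c n = pfun c (\<lambda>i. real (n i))"
  by (simp add: poly_fun_def pfun_def monval_def)

lemma pfun_superset: "finite A \<Longrightarrow> {\<alpha>. c \<alpha> \<noteq> 0} \<subseteq> A \<Longrightarrow> pfun c u = (\<Sum>\<alpha>\<in>A. c \<alpha> * monval \<alpha> u)"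
  unfolding pfun_def by (rule sum.mono_neutral_left) auto

lemma pfun_add:
  assumes "finite {\<alpha>. c \<alpha> \<noteq> 0}" "finite {\<alpha>. c' \<alpha> \<noteq> 0}"
  shows "pfun (\<lambda>\<alpha>. c \<alpha> + s * c' \<alpha>) u = pfun c u + s * pfun c' u"
    and "finite {\<alpha>. c \<alpha> + s * c' \<alpha> \<noteq> 0}"
proof -
  let ?A = "{\<alpha>. c \<alpha> \<noteq> 0} \<union> {\<alpha>. c' \<alpha> \<noteq> 0}"
  have A: "finite ?A" using assms by simp
  show "finite {\<alpha>. c \<alpha> + s * c' \<alpha> \<noteq> 0}" by (rule finite_subset[OF _ A]) auto
  have "pfun (\<lambda>\<alpha>. c \<alpha> + s * c' \<alpha>) u = (\<Sum>\<alpha>\<in>?A. (c \<alpha> + s * c' \<alpha>) * monval \<alpha> u)"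
    by (rule pfun_superset[OF A]) auto
  also have "\<dots> = (\<Sum>\<alpha>\<in>?A. c \<alpha> * monval \<alpha> u) + s * (\<Sum>\<alpha>\<in>?A. c' \<alpha> * monval \<alpha> u)"
    by (simp add: distrib_right sum.distrib sum_distrib_left mult.assoc)
  also have "(\<Sum>\<alpha>\<in>?A. c \<alpha> * monval \<alpha> u) = pfun c u" by (rule pfun_superset[OF A, symmetric]) auto
  also have "(\<Sum>\<alpha>\<in>?A. c' \<alpha> * monval \<alpha> u) = pfun c' u" by (rule pfun_superset[OF A, symmetric]) auto
  finally show "pfun (\<lambda>\<alpha>. c \<alpha> + s * c' \<alpha>) u = pfun c u + s * pfun c' u" .
qed

lemma PF_pfun:
  assumes "PF f"
  shows "\<exists>c. finite {\<alpha>. c \<alpha> \<noteq> 0} \<and> (\<forall>n. f n = pfun c (\<lambda>i. real_of_int (n i)))"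
  using assms
proof induction
  case (monom c \<alpha>)
  define c' where "c' \<beta> = (if \<beta> = \<alpha> then c else 0)" for \<beta>
  have s: "{\<beta>. c' \<beta> \<noteq> 0} \<subseteq> {\<alpha>}" by (auto simp: c'_def)
  then have "pfun c' u = c * monval \<alpha> u" for u
    by (subst pfun_superset[of "{\<alpha>}"]) (auto simp: c'_def)
  then show ?case using finite_subset[OF s] by (intro exI[of _ c']) (auto simp: monval_def)
next
  case (add f g)
  then obtain c c' where c: "finite {\<alpha>. c \<alpha> \<noteq> 0}" "\<And>n. f n = pfun c (\<lambda>i. real_of_int (n i))"
    "finite {\<alpha>. c' \<alpha> \<noteq> 0}" "\<And>n. g n = pfun c' (\<lambda>i. real_of_int (n i))" by blast
  show ?case using pfun_add[OF c(1,3), of 1] c by (intro exI[of _ "\<lambda>\<alpha>. c \<alpha> + 1 * c' \<alpha>"]) auto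
qed

lemma EP_pfun:
  assumes "EP f"
  obtains c where "finite {\<alpha>. c \<alpha> \<noteq> 0}" "eventually (\<lambda>n. f n = pfun c (\<lambda>i. real_of_int (n i))) big"
proof -
  obtain p where p: "PF p" "eventually (\<lambda>n. f n = p n) big" using assms unfolding EP_def by blast
  obtain c where c: "finite {\<alpha>. c \<alpha> \<noteq> 0}" "\<And>n. p n = pfun c (\<lambda>i. real_of_int (n i))"
    using PF_pfun[OF p(1)] by blast
  show thesis using that[OF c(1)] p(2) unfolding c(2) by blast
qed

subsection \<open>Iterated differences pick out coefficients\<close>

definition dlt :: "(int \<Rightarrow> real) \<Rightarrow> int \<Rightarrow> real" where
  "dlt h t = h (t + 1) - h t"

lemma dlt_pow_mult: "(dlt ^^ r) (\<lambda>t. a * h t) = (\<lambda>t. a * (dlt ^^ r) h t)"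
  by (induction r) (auto simp: dlt_def right_diff_distrib)

text \<open>Leibniz rule for multiplication by t. With a power of t for h it reduces the differences
  of t^(a+1) to those of t^a.\<close>

lemma dlt_pow_id_mult:
  "(dlt ^^ r) (\<lambda>t. real_of_int t * h t) t = real_of_int t * (dlt ^^ r) h t + real r * (dlt ^^ (r - 1)) h (t + 1)"
proof (induction r arbitrary: t)
  case (Suc r)
  have "(dlt ^^ Suc r) (\<lambda>t. real_of_int t * h t) t
    = real_of_int (t + 1) * (dlt ^^ r) h (t + 1) + real r * (dlt ^^ (r - 1)) h (t + 1 + 1)
      - (real_of_int t * (dlt ^^ r) h t + real r * (dlt ^^ (r - 1)) h (t + 1))"
    by (simp add: dlt_def[of "(dlt ^^ r) _"] Suc)
  also have "\<dots> = real_of_int t * (dlt ^^ Suc r) h t + (dlt ^^ r) h (t + 1) + real r * dlt ((dlt ^^ (r - 1)) h) (t + 1)"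
    by (simp add: dlt_def algebra_simps)
  also have "real r * dlt ((dlt ^^ (r - 1)) h) (t + 1) = real r * (dlt ^^ r) h (t + 1)"
    by (cases r) auto
  finally show ?case by (simp add: algebra_simps)
qed simp

lemma dlt_pow_power:
  "a < r \<Longrightarrow> (dlt ^^ r) (\<lambda>t. real_of_int t ^ a) t = 0"
  "(dlt ^^ a) (\<lambda>t. real_of_int t ^ a) t = fact a"
proof -
  have "(a < r \<longrightarrow> (\<forall>t. (dlt ^^ r) (\<lambda>t. real_of_int t ^ a) t = 0)) \<and>
        (a = r \<longrightarrow> (\<forall>t. (dlt ^^ r) (\<lambda>t. real_of_int t ^ a) t = fact r))" for r
  proof (induction a arbitrary: r)
    case 0
    have "(dlt ^^ Suc r) (\<lambda>t. 1) = (\<lambda>t. 0)" for r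
      by (induction r) (auto simp: dlt_def fun_eq_iff)
    then show ?case by (cases r) auto
  next
    case (Suc a)
    show ?case
      using Suc.IH[of r] Suc.IH[of "r - 1"] by (auto simp: dlt_pow_id_mult simp del: funpow.simps)
  qed
  then show "a < r \<Longrightarrow> (dlt ^^ r) (\<lambda>t. real_of_int t ^ a) t = 0"
    "(dlt ^^ a) (\<lambda>t. real_of_int t ^ a) t = fact a" by auto
qed

lemma difs_prod:
  fixes g :: "'k::finite \<Rightarrow> int \<Rightarrow> real"
  shows "difs (map unit ks) (\<lambda>n. \<Prod>i\<in>UNIV. g i (n i)) n = (\<Prod>i\<in>UNIV. (dlt ^^ count_list ks i) (g i) (n i))"
proof (induction ks arbitrary: g)
  case (Cons k ks)
  have "dif (unit k) (\<lambda>n. \<Prod>i\<in>UNIV. g i (n i)) n = (\<Prod>i\<in>UNIV. (g(k := dlt (g k))) i (n i))" for n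
  proof -
    have "(\<Prod>i\<in>UNIV. g i ((n + unit k) i)) = g k (n k + 1) * (\<Prod>i\<in>UNIV - {k}. g i (n i))"
    proof (subst prod.remove[of _ k])
      have "(\<Prod>i\<in>UNIV - {k}. g i ((n + unit k) i)) = (\<Prod>i\<in>UNIV - {k}. g i (n i))"
        by (rule prod.cong) (auto simp: plus_fun_def unit_def)
      then show "g k ((n + unit k) k) * (\<Prod>i\<in>UNIV - {k}. g i ((n + unit k) i)) = g k (n k + 1) * (\<Prod>i\<in>UNIV - {k}. g i (n i))"
        by (simp add: plus_fun_def unit_def)
    qed auto
    moreover have "(\<Prod>i\<in>UNIV. g i (n i)) = g k (n k) * (\<Prod>i\<in>UNIV - {k}. g i (n i))"
      by (rule prod.remove) auto
    moreover have "(\<Prod>i\<in>UNIV. (g(k := dlt (g k))) i (n i)) = dlt (g k) (n k) * (\<Prod>i\<in>UNIV - {k}. g i (n i))"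
      by (subst prod.remove[of _ k]) auto
    ultimately show ?thesis by (simp add: dif_def dlt_def left_diff_distrib)
  qed
  then have "dif (unit k) (\<lambda>n. \<Prod>i\<in>UNIV. g i (n i)) = (\<lambda>n. \<Prod>i\<in>UNIV. (g(k := dlt (g k))) i (n i))"
    by (rule ext)
  then have "difs (map unit (k # ks)) (\<lambda>n. \<Prod>i\<in>UNIV. g i (n i)) n
      = difs (map unit ks) (\<lambda>n. \<Prod>i\<in>UNIV. (g(k := dlt (g k))) i (n i)) n"
    by (simp only: list.map difs.simps)
  also have "\<dots> = (\<Prod>i\<in>UNIV. (dlt ^^ count_list ks i) ((g(k := dlt (g k))) i) (n i))" by (rule Cons)
  also have "\<dots> = (\<Prod>i\<in>UNIV. (dlt ^^ count_list (k # ks) i) (g i) (n i))"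
    by (rule prod.cong) (auto simp: funpow_swap1)
  finally show ?case .
qed simp

lemma difs_lincomb:
  "finite A \<Longrightarrow> difs ds (\<lambda>n. \<Sum>\<alpha>\<in>A. c \<alpha> * f \<alpha> n) n = (\<Sum>\<alpha>\<in>A. c \<alpha> * difs ds (f \<alpha>) n)"
proof (induction ds arbitrary: f)
  case (Cons \<delta> ds)
  have "dif \<delta> (\<lambda>n. \<Sum>\<alpha>\<in>A. c \<alpha> * f \<alpha> n) = (\<lambda>n. \<Sum>\<alpha>\<in>A. c \<alpha> * dif \<delta> (f \<alpha>) n)"
    by (simp add: dif_def fun_eq_iff sum_subtractf right_diff_distrib)
  then show ?case using Cons by simp
qed auto

lemma sum_count_list: "(\<Sum>i\<in>UNIV. count_list ks (i::'k::finite)) = length ks"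
proof (induction ks)
  case (Cons k ks)
  have "(\<Sum>i\<in>UNIV. count_list (k # ks) i) = (\<Sum>i\<in>UNIV. count_list ks i + (if i = k then 1 else 0))"
    by (rule sum.cong) auto
  then show ?case using Cons by (simp add: sum.distrib)
qed simp

text \<open>A monomial survives \<open>ds i\<close> differences in every direction i only if its
  exponents are at least those of \<open>ds\<close>. The bound on the total degree then leaves
  \<alpha> = ds alone, and the result is a constant. The dilation by \<open>a\<close> pulls out a
  power of \<open>a\<close>: used with a = m for the m-th powers of the ideals, it produces the
  factor m^d.\<close>

lemma difs_pfun:
  fixes c :: "('k::finite \<Rightarrow> nat) \<Rightarrow> real"
  assumes fin: "finite {\<alpha>. c \<alpha> \<noteq> 0}" and deg: "\<And>\<alpha>. c \<alpha> \<noteq> 0 \<Longrightarrow> (\<Sum>i\<in>UNIV. \<alpha> i) \<le> length ks"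
    and ds: "\<And>i. ds i = count_list ks i"
  shows "difs (map unit ks) (\<lambda>n. pfun c (\<lambda>i. a * real_of_int (n i))) n
    = a ^ length ks * ((\<Prod>i\<in>UNIV. fact (ds i)) * c ds)"
proof -
  have len: "(\<Sum>i\<in>UNIV. ds i) = length ks" using sum_count_list[of ks] by (simp add: ds)
  have m: "difs (map unit ks) (\<lambda>n. monval \<alpha> (\<lambda>i. a * real_of_int (n i))) n =
     (\<Prod>i\<in>UNIV. a ^ \<alpha> i * (dlt ^^ ds i) (\<lambda>t. real_of_int t ^ \<alpha> i) (n i))" for \<alpha>
    unfolding monval_def using difs_prod[of ks "\<lambda>i t. (a * real_of_int t) ^ \<alpha> i" n]
    by (simp add: ds power_mult_distrib dlt_pow_mult)
  have z: "difs (map unit ks) (\<lambda>n. monval \<alpha> (\<lambda>i. a * real_of_int (n i))) n = 0" if "c \<alpha> \<noteq> 0" "\<alpha> \<noteq> ds" for \<alpha>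
  proof -
    have "\<exists>i. \<alpha> i < ds i"
    proof (rule ccontr)
      assume "\<not> ?thesis"
      then have ge: "\<And>i. ds i \<le> \<alpha> i" by (simp add: not_less)
      obtain i where "\<alpha> i \<noteq> ds i" using \<open>\<alpha> \<noteq> ds\<close> by blast
      then have "(\<Sum>i\<in>UNIV. ds i) < (\<Sum>i\<in>UNIV. \<alpha> i)"
        using ge[of i] ge by (intro sum_strict_mono_ex1 bexI[of _ i]) (auto simp: le_less)
      then show False using deg[OF that(1)] len by simp
    qed
    then obtain i where "\<alpha> i < ds i" by blast
    then have "a ^ \<alpha> i * (dlt ^^ ds i) (\<lambda>t. real_of_int t ^ \<alpha> i) (n i) = 0" by (simp add: dlt_pow_power(1))
    then show ?thesis unfolding m by (intro prod_zero bexI[of _ i]) auto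
  qed
  have d: "difs (map unit ks) (\<lambda>n. monval ds (\<lambda>i. a * real_of_int (n i))) n = a ^ length ks * (\<Prod>i\<in>UNIV. fact (ds i))"
    unfolding m by (simp add: dlt_pow_power(2) prod.distrib power_sum len[symmetric])
  have "difs (map unit ks) (\<lambda>n. pfun c (\<lambda>i. a * real_of_int (n i))) n
     = (\<Sum>\<alpha> | c \<alpha> \<noteq> 0. c \<alpha> * difs (map unit ks) (\<lambda>n. monval \<alpha> (\<lambda>i. a * real_of_int (n i))) n)"
    unfolding pfun_def by (rule difs_lincomb[OF fin])
  also have "\<dots> = (\<Sum>\<alpha> | c \<alpha> \<noteq> 0. if \<alpha> = ds then c ds * (a ^ length ks * (\<Prod>i\<in>UNIV. fact (ds i))) else 0)"
    by (rule sum.cong) (auto simp: z d)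
  also have "\<dots> = c ds * (a ^ length ks * (\<Prod>i\<in>UNIV. fact (ds i)))"
    using fin by (simp add: sum.delta)
  finally show ?thesis by simp
qed

lemma list_with_counts:
  fixes ds :: "'k::finite \<Rightarrow> nat"
  shows "\<exists>ks. \<forall>i. count_list ks i = ds i"
proof -
  have "\<exists>ks. \<forall>i. count_list ks i = (if i \<in> A then ds i else 0)" for A :: "'k set"
  proof (induction A rule: infinite_finite_induct)
    case (insert k A)
    then obtain ks where ks: "\<And>i. count_list ks i = (if i \<in> A then ds i else 0)" by blast
    have r: "count_list (replicate m k) i = (if i = k then m else 0)" for m i by (induction m) auto
    show ?case using insert(2) by (intro exI[of _ "replicate (ds k) k @ ks"]) (auto simp: ks r)
  qed (auto intro: exI[of _ "[]"])
  from this[of UNIV] show ?thesis by simp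
qed

text \<open>Differences prescribed by an exponent of maximal total degree isolate its coefficient in
  c - c'. It follows that the coefficient families introduced by \<open>THE\<close> are well
  determined.\<close>

theorem pfun_unique:
  fixes c c' :: "('k::finite \<Rightarrow> nat) \<Rightarrow> real"
  assumes fin: "finite {\<alpha>. c \<alpha> \<noteq> 0}" "finite {\<alpha>. c' \<alpha> \<noteq> 0}"
    and eq: "\<And>n. (\<forall>i. N \<le> n i) \<Longrightarrow> pfun c (\<lambda>i. real (n i)) = pfun c' (\<lambda>i. real (n i))"
  shows "c = c'"
proof (rule ccontr)
  assume "c \<noteq> c'"
  define b where "b \<alpha> = c \<alpha> + (-1) * c' \<alpha>" for \<alpha>
  have fb: "finite {\<alpha>. b \<alpha> \<noteq> 0}" using pfun_add(2)[OF fin, of "-1"] by (simp add: b_def)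
  have ne: "{\<alpha>. b \<alpha> \<noteq> 0} \<noteq> {}" using \<open>c \<noteq> c'\<close> by (auto simp: b_def fun_eq_iff)
  define deg where "deg \<alpha> = (\<Sum>i\<in>UNIV. \<alpha> i)" for \<alpha> :: "'k \<Rightarrow> nat"
  have "Max (deg ` {\<alpha>. b \<alpha> \<noteq> 0}) \<in> deg ` {\<alpha>. b \<alpha> \<noteq> 0}" using fb ne by (intro Max_in) auto
  then obtain \<beta> where \<beta>: "b \<beta> \<noteq> 0" "deg \<beta> = Max (deg ` {\<alpha>. b \<alpha> \<noteq> 0})" by auto
  have mx: "deg \<alpha> \<le> deg \<beta>" if "b \<alpha> \<noteq> 0" for \<alpha> using that fb by (auto simp: \<beta>(2))
  obtain ks where ks: "\<And>i. count_list ks i = \<beta> i" using list_with_counts by blast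
  have len: "length ks = deg \<beta>" using sum_count_list[of ks] by (simp add: ks deg_def)
  have "eventually (\<lambda>n. pfun b (\<lambda>i. 1 * real_of_int (n i)) = 0) big"
    unfolding eventually_big
  proof (intro exI[of _ "int N"] allI impI)
    fix n :: "'k \<Rightarrow> int" assume n: "\<forall>i. int N \<le> n i"
    then have r: "real_of_int (n i) = real (nat (n i))" for i
      by (metis of_nat_0_le_iff of_nat_nat order_trans of_int_of_nat_eq)
    have "\<forall>i. N \<le> nat (n i)" using n by (metis nat_int nat_mono)
    from eq[OF this] show "pfun b (\<lambda>i. 1 * real_of_int (n i)) = 0"
      using pfun_add(1)[OF fin, of "-1"] by (simp add: b_def[abs_def] r)
  qed
  from eventually_difs_cong[OF this, of "map unit ks"]
  have "eventually (\<lambda>n::'k \<Rightarrow> int. (\<Prod>i\<in>UNIV. fact (\<beta> i)) * b \<beta> = difs (map unit ks) (\<lambda>n. 0) n) big"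
    by (subst (asm) difs_pfun[OF fb, of ks \<beta>]) (use mx len ks in \<open>auto simp: deg_def\<close>)
  moreover have "difs ds (\<lambda>n. 0) n = 0" for ds and n :: "'k \<Rightarrow> int"
    using difs_lincomb[of "{}" ds "\<lambda>_. 0" "\<lambda>_ _. 0" n] by simp
  ultimately have "eventually (\<lambda>n::'k \<Rightarrow> int. False) big" using \<beta>(1) by simp
  then show False by (simp add: eventually_False)
qed

subsection \<open>Asymptotics\<close>

definition hpart :: "nat \<Rightarrow> (('k::finite \<Rightarrow> nat) \<Rightarrow> real) \<Rightarrow> ('k \<Rightarrow> nat) \<Rightarrow> real" where
  "hpart d c = (\<lambda>\<alpha>. if (\<Sum>i\<in>UNIV. \<alpha> i) = d then c \<alpha> else 0)"

lemma hpart_finite: "finite {\<alpha>. c \<alpha> \<noteq> 0} \<Longrightarrow> finite {\<alpha>. hpart d c \<alpha> \<noteq> 0}"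
  by (rule finite_subset[rotated]) (auto simp: hpart_def)

lemma monval_scale: "monval \<alpha> (\<lambda>i. a * u i) = a ^ (\<Sum>i\<in>UNIV. \<alpha> i) * monval \<alpha> u"
  by (simp add: monval_def power_mult_distrib prod.distrib power_sum)

lemma pfun_hpart_scale: "pfun (hpart d c) (\<lambda>i. a * u i) = a ^ d * pfun (hpart d c) u"
  unfolding pfun_def sum_distrib_left
  by (rule sum.cong) (auto simp: hpart_def monval_scale split: if_splits)

text \<open>A monomial of total degree e < d is suppressed by 1/t^(d - e). Only the asymptotic
  direction u of \<open>v t\<close> matters, so exponents may be rounded or shifted by bounded
  amounts.\<close>

theorem pfun_asymp:
  fixes c :: "('k::finite \<Rightarrow> nat) \<Rightarrow> real"
  assumes fin: "finite {\<alpha>. c \<alpha> \<noteq> 0}" and deg: "\<And>\<alpha>. c \<alpha> \<noteq> 0 \<Longrightarrow> (\<Sum>i\<in>UNIV. \<alpha> i) \<le> d"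
    and v: "\<And>i. (\<lambda>t. v t i / real t) \<longlonglongrightarrow> u i"
  shows "(\<lambda>t. pfun c (v t) / real t ^ d) \<longlonglongrightarrow> pfun (hpart d c) u"
proof -
  have "(\<lambda>t. c \<alpha> * (monval \<alpha> (v t) / real t ^ d)) \<longlonglongrightarrow> hpart d c \<alpha> * monval \<alpha> u" if "c \<alpha> \<noteq> 0" for \<alpha>
  proof -
    define e where "e = (\<Sum>i\<in>UNIV. \<alpha> i)"
    have e: "e \<le> d" using deg[OF that] by (simp add: e_def)
    have "(\<lambda>t. monval \<alpha> (\<lambda>i. v t i / real t)) \<longlonglongrightarrow> monval \<alpha> u"
      unfolding monval_def by (intro tendsto_intros v)
    moreover have "(\<lambda>t. (1 / real t) ^ (d - e)) \<longlonglongrightarrow> (if e = d then 1 else 0)"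
    proof (cases "e = d")
      case False
      then have "(\<lambda>t. (1 / real t) ^ (d - e)) \<longlonglongrightarrow> 0 ^ (d - e)" by (intro tendsto_power lim_1_over_n)
      moreover have "0 ^ (d - e) = (0::real)" using False e by simp
      ultimately show ?thesis using False by (simp only: if_False)
    qed simp
    ultimately have l: "(\<lambda>t. c \<alpha> * (monval \<alpha> (\<lambda>i. v t i / real t) * (1 / real t) ^ (d - e)))
        \<longlonglongrightarrow> c \<alpha> * (monval \<alpha> u * (if e = d then 1 else 0))"
      by (intro tendsto_intros)
    have "eventually (\<lambda>t. monval \<alpha> (\<lambda>i. v t i / real t) * (1 / real t) ^ (d - e) = monval \<alpha> (v t) / real t ^ d) sequentially"
      using eventually_gt_at_top[of 0]
    proof eventually_elim
      case (elim t)
      have "monval \<alpha> (\<lambda>i. v t i / real t) = (1 / real t) ^ e * monval \<alpha> (v t)"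
        using monval_scale[of \<alpha> "1 / real t" "v t"] by (simp add: e_def)
      moreover have "(1 / real t) ^ e * (1 / real t) ^ (d - e) = 1 / real t ^ d"
        using e by (simp add: power_add[symmetric] power_one_over)
      ultimately show ?case by (simp add: mult.commute mult.left_commute)
    qed
    then have "eventually (\<lambda>t. c \<alpha> * (monval \<alpha> (\<lambda>i. v t i / real t) * (1 / real t) ^ (d - e)) = c \<alpha> * (monval \<alpha> (v t) / real t ^ d)) sequentially"
      by eventually_elim simp
    from Lim_transform_eventually[OF l this] show ?thesis by (auto simp: hpart_def e_def)
  qed
  then have "(\<lambda>t. \<Sum>\<alpha> | c \<alpha> \<noteq> 0. c \<alpha> * (monval \<alpha> (v t) / real t ^ d)) \<longlonglongrightarrow> (\<Sum>\<alpha> | c \<alpha> \<noteq> 0. hpart d c \<alpha> * monval \<alpha> u)"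
    by (intro tendsto_sum) auto
  moreover have "(\<Sum>\<alpha> | c \<alpha> \<noteq> 0. hpart d c \<alpha> * monval \<alpha> u) = pfun (hpart d c) u"
    by (rule pfun_superset[symmetric]) (auto simp: hpart_def fin)
  ultimately show ?thesis by (simp add: pfun_def sum_divide_distrib)
qed

text \<open>If the top degree D exceeded d, division by t^D would show that the homogeneous part of
  degree D vanishes at all vectors of positive integers, hence identically by
  \<open>pfun_unique\<close>.\<close>

theorem pfun_degree_le:
  fixes c :: "('k::finite \<Rightarrow> nat) \<Rightarrow> real"
  assumes fin: "finite {\<alpha>. c \<alpha> \<noteq> 0}"
    and bound: "\<And>u. (\<And>i. 1 \<le> u i) \<Longrightarrow>
      \<exists>C. eventually (\<lambda>t. \<bar>pfun c (\<lambda>i. real (t * u i))\<bar> \<le> C * real t ^ d) sequentially"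
    and "c \<alpha> \<noteq> 0"
  shows "(\<Sum>i\<in>UNIV. \<alpha> i) \<le> d"
proof (rule ccontr)
  assume not: "\<not> ?thesis"
  define deg where "deg \<alpha> = (\<Sum>i\<in>UNIV. \<alpha> i)" for \<alpha> :: "'k \<Rightarrow> nat"
  define D where "D = Max (deg ` {\<alpha>. c \<alpha> \<noteq> 0})"
  have le: "deg \<beta> \<le> D" if "c \<beta> \<noteq> 0" for \<beta> using that fin by (auto simp: D_def)
  have "D \<in> deg ` {\<alpha>. c \<alpha> \<noteq> 0}" unfolding D_def using fin \<open>c \<alpha> \<noteq> 0\<close> by (intro Max_in) auto
  then obtain \<beta> where \<beta>: "c \<beta> \<noteq> 0" "deg \<beta> = D" by auto
  have Dd: "d < D" using le[OF \<open>c \<alpha> \<noteq> 0\<close>] not by (simp add: deg_def)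
  have "pfun (hpart D c) (\<lambda>i. real (u i)) = 0" if u: "\<And>i. 1 \<le> u i" for u
  proof -
    obtain C where C: "eventually (\<lambda>t. \<bar>pfun c (\<lambda>i. real (t * u i))\<bar> \<le> C * real t ^ d) sequentially"
      using bound[of u, OF u] by blast
    have "(\<lambda>t. real (t * u i) / real t) \<longlonglongrightarrow> real (u i)" for i
    proof (rule Lim_transform_eventually[OF tendsto_const])
      show "eventually (\<lambda>t. real (u i) = real (t * u i) / real t) sequentially"
        using eventually_gt_at_top[of 0] by eventually_elim simp
    qed
    from pfun_asymp[OF fin le[unfolded deg_def], of "\<lambda>t i. real (t * u i)", OF _ this]
    have l: "(\<lambda>t. pfun c (\<lambda>i. real (t * u i)) / real t ^ D) \<longlonglongrightarrow> pfun (hpart D c) (\<lambda>i. real (u i))" by simp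
    have "(\<lambda>t. C * (1 / real t) ^ (D - d)) \<longlonglongrightarrow> C * 0 ^ (D - d)"
      by (intro tendsto_intros lim_1_over_n)
    moreover have "C * 0 ^ (D - d) = 0" using Dd by simp
    ultimately have z: "(\<lambda>t. C * (1 / real t) ^ (D - d)) \<longlonglongrightarrow> 0" by (simp only:)
    have "(\<lambda>t. pfun c (\<lambda>i. real (t * u i)) / real t ^ D) \<longlonglongrightarrow> 0"
    proof (rule tendsto_0_le[OF z])
      show "eventually (\<lambda>t. norm (pfun c (\<lambda>i. real (t * u i)) / real t ^ D) \<le> norm (C * (1 / real t) ^ (D - d)) * 1) sequentially"
        using C eventually_gt_at_top[of 0]
      proof eventually_elim
        case (elim t)
        have "norm (pfun c (\<lambda>i. real (t * u i)) / real t ^ D) \<le> C * (real t ^ d / real t ^ D)"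
          using elim by (simp add: divide_right_mono abs_divide)
        also have "real t ^ d / real t ^ D = (1 / real t) ^ (D - d)"
          using elim Dd by (simp add: power_diff power_one_over)
        finally have "norm (pfun c (\<lambda>i. real (t * u i)) / real t ^ D) \<le> C * (1 / real t) ^ (D - d)" .
        then show ?case by simp
      qed
    qed
    then show ?thesis using l LIMSEQ_unique by blast
  qed
  then have "hpart D c = (\<lambda>_. 0)"
    by (intro pfun_unique[of _ _ 1] hpart_finite[OF fin]) (auto simp: pfun_def)
  then show False using \<beta> by (auto simp: hpart_def deg_def fun_eq_iff split: if_splits)
qed

section \<open>Finiteness over a Noetherian ring\<close>

lemma (in cring) ideal_sum_upper:
  assumes A: "ideal A R" and B: "ideal B R"
  shows "A \<subseteq> A <+>\<^bsub>R\<^esub> B" "B \<subseteq> A <+>\<^bsub>R\<^esub> B"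
proof -
  have z: "\<zero> \<in> A" "\<zero> \<in> B" 
    using additive_subgroup.zero_closed[OF ideal.axioms(1)[OF A]] additive_subgroup.zero_closed[OF ideal.axioms(1)[OF B]] by auto
  show "A \<subseteq> A <+>\<^bsub>R\<^esub> B"
  proof
    fix x assume x: "x \<in> A"
    then have "x = x \<oplus> \<zero>" using ideal.Icarr[OF A x] by simp
    then show "x \<in> A <+>\<^bsub>R\<^esub> B" using x z unfolding set_add_def' by blast
  qed
  show "B \<subseteq> A <+>\<^bsub>R\<^esub> B"
  proof
    fix x assume x: "x \<in> B"
    then have "x = \<zero> \<oplus> x" using ideal.Icarr[OF B x] by simp
    then show "x \<in> A <+>\<^bsub>R\<^esub> B" using x z unfolding set_add_def' by blast
  qed
qed

lemma (in cring) ideal_sum_pow_le: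
  assumes A: "ideal A R" and B: "ideal B R"
  shows "(A <+>\<^bsub>R\<^esub> B) [^]\<^bsub>ideals_set R\<^esub> (i::nat) \<subseteq> A <+>\<^bsub>R\<^esub> (B [^]\<^bsub>ideals_set R\<^esub> i)"
proof (induction i)
  case 0
  show ?case using ideal_sum_upper(2)[OF A oneideal] by simp
next
  case (Suc i)
  let ?P = "A <+>\<^bsub>R\<^esub> (B [^]\<^bsub>ideals_set R\<^esub> Suc i)"
  have P: "ideal ?P R" using A B by (intro add_ideals ideal_pow)
  note closed = additive_subgroup.a_closed[OF ideal.axioms(1)[OF P]]
  have sub: "A \<subseteq> ?P"
    using ideal_sum_upper(1)[OF A ideal_pow[OF B]] .
  have sub2: "B [^]\<^bsub>ideals_set R\<^esub> Suc i \<subseteq> ?P"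
    using ideal_sum_upper(2)[OF A ideal_pow[OF B]] .
  have "(A <+>\<^bsub>R\<^esub> (B [^]\<^bsub>ideals_set R\<^esub> i)) \<cdot> (A <+>\<^bsub>R\<^esub> B) \<subseteq> ?P"
  proof
    fix x assume "x \<in> (A <+>\<^bsub>R\<^esub> (B [^]\<^bsub>ideals_set R\<^esub> i)) \<cdot> (A <+>\<^bsub>R\<^esub> B)"
    then show "x \<in> ?P"
    proof induction
      case (prod u v)
      then obtain a b a' b' where *: "a \<in> A" "b \<in> B [^]\<^bsub>ideals_set R\<^esub> i" "a' \<in> A" "b' \<in> B"
        and e: "u = a \<oplus> b" "v = a' \<oplus> b'" by (auto simp: set_add_def')
      have c: "a \<in> carrier R" "a' \<in> carrier R" "b' \<in> carrier R" "b \<in> carrier R"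
        using ideal.Icarr[OF A *(1)] ideal.Icarr[OF A *(3)] ideal.Icarr[OF B *(4)]
          ideal.Icarr[OF ideal_pow[OF B] *(2)] by auto
      have eq: "u \<otimes> v = (a \<otimes> (a' \<oplus> b') \<oplus> b \<otimes> a') \<oplus> b \<otimes> b'"
        using c by (simp add: e l_distr r_distr a_ac)
      have h: "a \<otimes> (a' \<oplus> b') \<in> A" "b \<otimes> a' \<in> A"
        using c * ideal.I_r_closed[OF A] ideal.I_l_closed[OF A] by auto
      have h2: "b \<otimes> b' \<in> B [^]\<^bsub>ideals_set R\<^esub> Suc i"
        unfolding ideal_pow_Suc using * by (intro ideal_prod.prod)
      show ?case unfolding eq
        by (rule closed[OF closed[OF subsetD[OF sub h(1)] subsetD[OF sub h(2)]] subsetD[OF sub2 h2]])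
    qed (rule closed)
  qed
  moreover have "(A <+>\<^bsub>R\<^esub> B) [^]\<^bsub>ideals_set R\<^esub> Suc i \<subseteq> (A <+>\<^bsub>R\<^esub> (B [^]\<^bsub>ideals_set R\<^esub> i)) \<cdot> (A <+>\<^bsub>R\<^esub> B)"
    unfolding ideal_pow_Suc by (intro ideal_prod_mono Suc order_refl)
  ultimately show ?case by blast
qed

lemma (in cring) cgenideal_pow_le:
  assumes s: "s \<in> carrier R"
  shows "(PIdl s) [^]\<^bsub>ideals_set R\<^esub> (n::nat) \<subseteq> PIdl (s [^] n)"
proof (induction n)
  case 0
  then show ?case by (auto simp: cgenideal_def) (metis r_one)
next
  case (Suc n)
  have "(PIdl (s [^] n)) \<cdot> (PIdl s) \<subseteq> PIdl (s [^] Suc n)"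
  proof
    fix x assume "x \<in> (PIdl (s [^] n)) \<cdot> (PIdl s)"
    then show "x \<in> PIdl (s [^] Suc n)"
    proof induction
      case (prod u v)
      then obtain a b where *: "a \<in> carrier R" "b \<in> carrier R" "u = a \<otimes> s [^] n" "v = b \<otimes> s"
        by (auto simp: cgenideal_def)
      then have "u \<otimes> v = (a \<otimes> b) \<otimes> s [^] Suc n" using s by (simp add: m_ac)
      then show ?case using * by (auto simp: cgenideal_def)
    next
      case (sum s1 s2)
      then show ?case
        using additive_subgroup.a_closed[OF ideal.axioms(1)[OF cgenideal_ideal]] s by blast
    qed
  qed
  then show ?case unfolding ideal_pow_Suc using ideal_prod_mono[OF Suc order_refl] by blast
qed

text \<open>Induction on S with any ideal K containing S in place of \<open>Idl S\<close>. If s^n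
  lies in I, then (K + (s))^n \<subseteq> K + I, and (I + K)^N \<subseteq> I + K^N \<subseteq> I;
  the exponents multiply.\<close>

lemma (in cring) fin_gen_ideal_pow_le:
  assumes I: "ideal I R" and S: "finite S" "S \<subseteq> carrier R"
    and nil: "\<And>s. s \<in> S \<Longrightarrow> \<exists>n::nat. s [^] n \<in> I"
  shows "\<exists>N::nat. (Idl S) [^]\<^bsub>ideals_set R\<^esub> N \<subseteq> I"
proof -
  have "\<exists>K N. ideal K R \<and> S \<subseteq> K \<and> K [^]\<^bsub>ideals_set R\<^esub> (N::nat) \<subseteq> I"
    using S nil
  proof (induction S)
    case empty
    have "{\<zero>} [^]\<^bsub>ideals_set R\<^esub> (Suc 0) \<subseteq> I"
      unfolding ideal_pow_1[OF zeroideal] using additive_subgroup.zero_closed[OF ideal.axioms(1)[OF I]] by simp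
    then show ?case using zeroideal by blast
  next
    case (insert s S)
    then obtain K and N :: nat where K: "ideal K R" "S \<subseteq> K" "K [^]\<^bsub>ideals_set R\<^esub> N \<subseteq> I" by auto
    have s: "s \<in> carrier R" using insert by simp
    obtain n :: nat where n: "s [^] n \<in> I" using insert by blast
    have P: "ideal (PIdl s) R" "s \<in> PIdl s" using s by (auto simp: cgenideal_ideal cgenideal_self)
    let ?K = "K <+>\<^bsub>R\<^esub> PIdl s"
    have K': "ideal ?K R" using K P by (intro add_ideals)
    have "(PIdl s) [^]\<^bsub>ideals_set R\<^esub> n \<subseteq> I"
      using cgenideal_pow_le[OF s, of n] cgenideal_minimal[OF I n] by blast
    then have "?K [^]\<^bsub>ideals_set R\<^esub> n \<subseteq> K <+>\<^bsub>R\<^esub> I"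
      using ideal_sum_pow_le[OF K(1) P(1), of n] by (force simp: set_add_def')
    also have "K <+>\<^bsub>R\<^esub> I = I <+>\<^bsub>R\<^esub> K"
      using ideal.Icarr[OF K(1)] ideal.Icarr[OF I] by (force simp: set_add_def' a_comm)
    finally have "(?K [^]\<^bsub>ideals_set R\<^esub> n) [^]\<^bsub>ideals_set R\<^esub> N \<subseteq> (I <+>\<^bsub>R\<^esub> K) [^]\<^bsub>ideals_set R\<^esub> N"
      by (rule ideal_pow_mono)
    also have "\<dots> \<subseteq> I <+>\<^bsub>R\<^esub> (K [^]\<^bsub>ideals_set R\<^esub> N)" by (rule ideal_sum_pow_le[OF I K(1)])
    also have "\<dots> \<subseteq> I"
      using K(3) additive_subgroup.a_closed[OF ideal.axioms(1)[OF I]] by (auto simp: set_add_def')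
    finally have "?K [^]\<^bsub>ideals_set R\<^esub> (n * N) \<subseteq> I" using K' by (simp add: ideal_pow_pow)
    moreover have "insert s S \<subseteq> ?K"
      using K(2) P(2) ideal_sum_upper[OF K(1) P(1)] by blast
    ultimately show ?case using K' by blast
  qed
  then obtain K and N :: nat where K: "ideal K R" "S \<subseteq> K" "K [^]\<^bsub>ideals_set R\<^esub> N \<subseteq> I" by blast
  have "(Idl S) [^]\<^bsub>ideals_set R\<^esub> N \<subseteq> K [^]\<^bsub>ideals_set R\<^esub> N"
    by (intro ideal_pow_mono genideal_minimal K)
  then show ?thesis using K(3) by blast
qed

lemma (in maximalideal) one_decomp:
  assumes "cring R" "a \<in> carrier R" "a \<notin> I"
  shows "\<exists>r\<in>carrier R. \<exists>m\<in>I. \<one> = m \<oplus> r \<otimes> a"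
proof -
  interpret cring R by fact
  let ?J = "I <+>\<^bsub>R\<^esub> PIdl a"
  have P: "ideal (PIdl a) R" using assms by (simp add: cgenideal_ideal)
  have J: "ideal ?J R" by (intro add_ideals is_ideal P)
  have "I \<subseteq> ?J" by (rule ideal_sum_upper(1)[OF is_ideal P])
  moreover have "a \<in> ?J" using ideal_sum_upper(2)[OF is_ideal P] cgenideal_self[OF assms(2)] by blast
  ultimately have "?J = carrier R" 
  proof -
    assume h: "I \<subseteq> ?J" "a \<in> ?J"
    have "?J = I \<or> ?J = carrier R"
      by (rule I_maximal[OF J h(1)]) (use ideal.Icarr[OF J] in auto)
    then show ?thesis using h(2) assms(3) by auto
  qed
  then have "\<one> \<in> ?J" by simp
  then show ?thesis by (auto simp: set_add_def' cgenideal_def)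
qed

context module
begin

section \<open>Noetherian modules and modules of finite length\<close>

definition cyc :: "'c \<Rightarrow> 'c set" where
  "cyc g = (\<lambda>a. a \<odot>\<^bsub>M\<^esub> g) ` carrier R"

lemma sm_cyc [simp]: assumes g: "g \<in> carrier M" shows "sm (cyc g)"
proof (rule smI)
  show "\<zero>\<^bsub>M\<^esub> \<in> cyc g" using g smult_l_null[OF g] by (force simp: cyc_def)
  fix x y assume "x \<in> cyc g" "y \<in> cyc g"
  then show "x \<oplus>\<^bsub>M\<^esub> y \<in> cyc g" using g by (auto simp: cyc_def smult_l_distr[symmetric])
next
  fix a x assume "a \<in> carrier R" "x \<in> cyc g"
  then show "a \<odot>\<^bsub>M\<^esub> x \<in> cyc g" using g by (auto simp: cyc_def smult_assoc1[symmetric])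
qed (use g in \<open>auto simp: cyc_def\<close>)

lemma cyc_self: "g \<in> carrier M \<Longrightarrow> g \<in> cyc g"
  by (force simp: cyc_def)

definition cc :: "'c set \<Rightarrow> bool" where
  "cc V \<longleftrightarrow> (\<forall>F. (\<forall>j::nat. sm (F j) \<and> F j \<subseteq> V \<and> F j \<subseteq> F (Suc j)) \<longrightarrow> (\<exists>j0. \<forall>j\<ge>j0. F j = F j0))"

lemma ideal_chain_stabilizes:
  fixes F :: "nat \<Rightarrow> 'a set"
  assumes noeth: "noetherian_ring R" and F: "\<And>j. ideal (F j) R" "\<And>j. F j \<subseteq> F (Suc j)"
  shows "\<exists>j0. \<forall>j\<ge>j0. F j = F j0"
proof -
  have mono: "F i \<subseteq> F j" if "i \<le> j" for i j using lift_Suc_mono_le[of F, OF F(2) that] .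
  have "\<Union>(range F) \<in> range F"
  proof (rule noetherian_ring.ideal_chain_is_trivial[OF noeth])
    show "subset.chain {I. ideal I R} (range F)"
      unfolding subset_chain_def
    proof (intro conjI ballI)
      fix X Y assume "X \<in> range F" "Y \<in> range F"
      then obtain i j where "X = F i" "Y = F j" by blast
      then show "X \<subseteq> Y \<or> Y \<subseteq> X" using mono[of i j] mono[of j i] by (cases "i \<le> j") auto
    qed (use F(1) in auto)
  qed auto
  then obtain j0 where "\<Union>(range F) = F j0" by blast
  then have "F j = F j0" if "j \<ge> j0" for j using mono[OF that] by blast
  then show ?thesis by blast
qed

text \<open>Along an ascending chain in V + Rg, a member F is determined by F \<inter> V and by the
  ideal of those a with ag in F + V. The former is stationary by the condition on V, the latter
  because R is Noetherian.\<close>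

lemma cc_extend:
  assumes noeth: "noetherian_ring R" and V: "sm V" "cc V" and g: "g \<in> carrier M"
  shows "cc (V \<boxplus> cyc g)"
  unfolding cc_def
proof (intro allI impI)
  fix F :: "nat \<Rightarrow> 'c set"
  assume F: "\<forall>j. sm (F j) \<and> F j \<subseteq> V \<boxplus> cyc g \<and> F j \<subseteq> F (Suc j)"
  have mono: "F i \<subseteq> F j" if "i \<le> j" for i j using lift_Suc_mono_le[of F, OF _ that] F by blast
  have "\<forall>j. sm (F j \<inter> V) \<and> F j \<inter> V \<subseteq> V \<and> F j \<inter> V \<subseteq> F (Suc j) \<inter> V" using F V by auto
  then obtain j1 where j1: "\<And>j. j \<ge> j1 \<Longrightarrow> F j \<inter> V = F j1 \<inter> V"
    using V(2)[unfolded cc_def, rule_format, of "\<lambda>j. F j \<inter> V"] by blast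
  define D where "D j = {a \<in> carrier R. act a (cyc g) \<subseteq> F j \<boxplus> V}" for j
  have "\<exists>j0. \<forall>j\<ge>j0. D j = D j0"
  proof (rule ideal_chain_stabilizes[OF noeth])
    show "ideal (D j) R" for j unfolding D_def using F V g by (intro conductor_ideal) auto
    show "D j \<subseteq> D (Suc j)" for j unfolding D_def using pl_mono[of "F j" "F (Suc j)" V V] F by blast
  qed
  then obtain j2 where j2: "\<And>j. j \<ge> j2 \<Longrightarrow> D j = D j2" by blast
  have "F j = F (max j1 j2)" if j: "j \<ge> max j1 j2" for j
  proof
    let ?k = "max j1 j2"
    show "F j \<subseteq> F ?k"
    proof
      fix z assume z: "z \<in> F j"
      have sF: "sm (F j)" "sm (F ?k)" "F ?k \<subseteq> F j" using F mono[OF j] by auto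
      obtain v a where va: "v \<in> V" "a \<in> carrier R" "z = v \<oplus>\<^bsub>M\<^esub> a \<odot>\<^bsub>M\<^esub> g"
        using z F by (force simp: pl_iff cyc_def)
      have c: "v \<in> carrier M" "z \<in> carrier M" using va V z sF sm_mem by auto
      have "a \<odot>\<^bsub>M\<^esub> g = z \<oplus>\<^bsub>M\<^esub> \<ominus>\<^bsub>M\<^esub> v"
        using c va g by (simp add: M.a_ac M.r_neg2)
      then have ag: "a \<odot>\<^bsub>M\<^esub> g \<in> F j \<boxplus> V" using z va V sm_minus unfolding pl_iff by blast
      have "act a (cyc g) \<subseteq> F j \<boxplus> V"
      proof
        fix w assume "w \<in> act a (cyc g)"
        then obtain b where b: "b \<in> carrier R" "w = a \<odot>\<^bsub>M\<^esub> (b \<odot>\<^bsub>M\<^esub> g)" by (auto simp: act_def cyc_def)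
        then have "w = b \<odot>\<^bsub>M\<^esub> (a \<odot>\<^bsub>M\<^esub> g)" using va g by (simp add: smult_assoc1[symmetric] R.m_comm)
        then show "w \<in> F j \<boxplus> V" using ag b sF V by (simp add: sm_smult)
      qed
      then have "a \<in> D j" using va by (simp add: D_def)
      then have "a \<in> D ?k" using j2[of j] j2[of ?k] j by simp
      then have "a \<odot>\<^bsub>M\<^esub> g \<in> F ?k \<boxplus> V" using cyc_self[OF g] by (auto simp: D_def act_def)
      then obtain f v' where fv: "f \<in> F ?k" "v' \<in> V" "a \<odot>\<^bsub>M\<^esub> g = f \<oplus>\<^bsub>M\<^esub> v'" by (auto simp: pl_iff)
      have fc: "f \<in> carrier M" "v' \<in> carrier M" using fv sF V sm_mem by auto
      have e: "z = f \<oplus>\<^bsub>M\<^esub> (v \<oplus>\<^bsub>M\<^esub> v')" using va fv fc c by (simp add: M.a_ac)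
      have "w = (f \<oplus>\<^bsub>M\<^esub> w) \<ominus>\<^bsub>M\<^esub> f" if "w \<in> carrier M" for w
        using that fc by (simp add: a_minus_def M.a_assoc)
      from this[of "v \<oplus>\<^bsub>M\<^esub> v'"] have "v \<oplus>\<^bsub>M\<^esub> v' = z \<ominus>\<^bsub>M\<^esub> f" using fc c by (simp add: e)
      also have "\<dots> \<in> F j" using z fv sF by (intro sm_diff) auto
      finally have "v \<oplus>\<^bsub>M\<^esub> v' \<in> F j \<inter> V" using va fv V by (simp add: sm_add)
      then have "v \<oplus>\<^bsub>M\<^esub> v' \<in> F ?k" using j1[of j] j1[of ?k] j by auto
      then show "z \<in> F ?k" using e fv sF by (simp add: sm_add)
    qed
  qed (use mono j in blast)
  then show "\<exists>j0. \<forall>j\<ge>j0. F j = F j0" by blast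
qed

theorem noeth_if_finite_module:
  assumes noeth: "noetherian_ring R" and fm: "finite_module R M"
  shows noeth
proof -
  obtain S where S: "finite S" "S \<subseteq> carrier M" "gen_submodule R M S = carrier M"
    using fm by (auto simp: finite_module_def)
  have "\<exists>V. sm V \<and> S \<subseteq> V \<and> cc V"
    using S(1,2)
  proof (induction S)
    case empty
    have "cc {\<zero>\<^bsub>M\<^esub>}" unfolding cc_def
    proof (intro allI impI exI)
      fix F :: "nat \<Rightarrow> 'c set" and j
      assume F: "\<forall>j. sm (F j) \<and> F j \<subseteq> {\<zero>\<^bsub>M\<^esub>} \<and> F j \<subseteq> F (Suc j)"
      then have "F j = {\<zero>\<^bsub>M\<^esub>}" for j using sm_zero by blast
      then show "F j = F 0" by simp
    qed
    then show ?case by (intro exI[of _ "{\<zero>\<^bsub>M\<^esub>}"]) auto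
  next
    case (insert g S)
    then obtain V where V: "sm V" "S \<subseteq> V" "cc V" by auto
    have g: "g \<in> carrier M" using insert by auto
    show ?case
      using V g cc_extend[OF noeth V(1,3) g] pl_upper1[of V "cyc g"] pl_upper2[of V "cyc g"] cyc_self[OF g]
      by (intro exI[of _ "V \<boxplus> cyc g"]) auto
  qed
  then obtain V where V: "sm V" "S \<subseteq> V" "cc V" by blast
  then have "carrier M \<subseteq> V" unfolding S(3)[symmetric] gen_submodule_def sm_def by blast
  then have "V = carrier M" using V sm_carr by blast
  then show ?thesis using V(3) sm_carr unfolding cc_def noeth_def by blast
qed

lemma noeth_maximal:
  assumes noeth and ne: "\<A> \<noteq> {}" and sm: "\<And>A. A \<in> \<A> \<Longrightarrow> sm A"
  shows "\<exists>X\<in>\<A>. \<forall>Y\<in>\<A>. X \<subseteq> Y \<longrightarrow> X = Y"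
proof (rule ccontr)
  assume "\<not> ?thesis"
  then have step: "\<exists>Y. Y \<in> \<A> \<and> X \<subset> Y" if "X \<in> \<A>" for X using that by blast
  have "\<exists>F. \<forall>j::nat. F j \<in> \<A> \<and> F j \<subset> F (Suc j)"
    by (rule dependent_nat_choice) (use ne step in auto)
  then obtain F where F: "\<And>j::nat. F j \<in> \<A>" "\<And>j. F j \<subset> F (Suc j)" by blast
  then have "\<forall>j. sm (F j) \<and> F j \<subseteq> F (Suc j)" using sm by auto
  then obtain j0 where "\<forall>j\<ge>j0. F j = F j0"
    using \<open>noeth\<close>[unfolded noeth_def, THEN spec, of F] by blast
  then have "F (Suc j0) = F j0" by (metis le_Suc_eq order_refl)
  then show False using F(2)[of j0] by simp
qed

text \<open>Take X maximal among the submodules of W with X/V of finite length. For g in W outside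
  X, the quotient (X + Rg)/X is simple, because \<mm> kills it and every scalar outside \<mm> is
  invertible modulo \<mm>. Then X + Rg contradicts maximality.\<close>

lemma fin_if_killed:
  assumes noeth: noeth and mx: "maximalideal \<mm> R" and V: "sm V" "sm W" "V \<subseteq> W"
    and kill: "\<And>a. a \<in> \<mm> \<Longrightarrow> act a W \<subseteq> V"
  shows "fin V W"
proof -
  interpret mx: maximalideal \<mm> R by fact
  let ?A = "{X. sm X \<and> V \<subseteq> X \<and> X \<subseteq> W \<and> fin V X}"
  have "V \<in> ?A" using V by simp
  then have "?A \<noteq> {}" by blast
  from noeth_maximal[OF noeth this] obtain X0 where X0: "X0 \<in> ?A" "\<forall>Y\<in>?A. X0 \<subseteq> Y \<longrightarrow> X0 = Y" by blast
  obtain X where X: "sm X" "V \<subseteq> X" "X \<subseteq> W" "fin V X"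
    and max: "\<And>Y. sm Y \<Longrightarrow> X \<subseteq> Y \<Longrightarrow> Y \<subseteq> W \<Longrightarrow> fin V Y \<Longrightarrow> X = Y"
  proof
    show "X0 = Y" if "sm Y" "X0 \<subseteq> Y" "Y \<subseteq> W" "fin V Y" for Y
      using X0(1) that by (intro X0(2)[rule_format]) auto
  qed (use X0(1) in auto)
  have "X = W"
  proof (rule ccontr)
    assume "X \<noteq> W"
    then obtain g where g: "g \<in> W" "g \<notin> X" using X by blast
    have gc: "g \<in> carrier M" using g V sm_mem by blast
    have cW: "cyc g \<subseteq> W" using g V by (auto simp: cyc_def sm_smult)
    define X' where "X' = X \<boxplus> cyc g"
    have X': "sm X'" "X \<subseteq> X'" "X' \<subseteq> W" "g \<in> X'"
      using X gc cW V pl_upper2[of X "cyc g"] cyc_self[OF gc] by (auto simp: X'_def intro: subsetD[OF pl_upper1] subsetD[OF pl_least])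
    have simple: "Y = X'" if Y: "sm Y" "X \<subset> Y" "Y \<subseteq> X'" for Y
    proof -
      obtain y where y: "y \<in> Y" "y \<notin> X" using Y by blast
      then obtain x a where xa: "x \<in> X" "a \<in> carrier R" "y = x \<oplus>\<^bsub>M\<^esub> a \<odot>\<^bsub>M\<^esub> g"
        using Y by (force simp: X'_def pl_iff cyc_def)
      have mg: "b \<odot>\<^bsub>M\<^esub> g \<in> X" if "b \<in> \<mm>" for b using kill[OF that] g X by (auto simp: act_def)
      have "a \<notin> \<mm>" using mg[of a] xa y X sm_add by blast
      then obtain r m where rm: "r \<in> carrier R" "m \<in> \<mm>" "\<one> = m \<oplus> r \<otimes> a"
        using mx.one_decomp[OF R.is_cring xa(2)] by blast
      have mc: "m \<in> carrier R" using rm mx.Icarr by blast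
      have xY: "x \<in> Y" "x \<in> carrier M" using xa Y X sm_mem by auto
      have "a \<odot>\<^bsub>M\<^esub> g = y \<ominus>\<^bsub>M\<^esub> x" using xa gc xY by (simp add: a_minus_def M.a_ac M.r_neg2)
      also have "\<dots> \<in> Y" using y xY Y by (intro sm_diff) auto
      finally have ag: "a \<odot>\<^bsub>M\<^esub> g \<in> Y" .
      have "g = \<one> \<odot>\<^bsub>M\<^esub> g" using gc by simp
      also have "\<dots> = m \<odot>\<^bsub>M\<^esub> g \<oplus>\<^bsub>M\<^esub> r \<odot>\<^bsub>M\<^esub> (a \<odot>\<^bsub>M\<^esub> g)"
        unfolding rm(3) using rm xa gc mc by (simp add: smult_l_distr smult_assoc1)
      also have "\<dots> \<in> Y"
      proof (rule sm_add[OF Y(1) _ sm_smult[OF Y(1) rm(1) ag]])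
        show "m \<odot>\<^bsub>M\<^esub> g \<in> Y" using mg[OF rm(2)] Y(2) by blast
      qed
      finally have "cyc g \<subseteq> Y" using Y by (auto simp: cyc_def sm_smult)
      then have "X' \<subseteq> Y" unfolding X'_def using Y by (intro pl_least) auto
      then show "Y = X'" using Y by blast
    qed
    have "\<not> chain (Suc (Suc 0)) X X'"
    proof
      assume "chain (Suc (Suc 0)) X X'"
      then obtain C0 C1 where C: "sm C0" "X \<subseteq> C0" "sm C1" "C0 \<subset> C1" "C1 \<subset> X'" by auto
      then have "C1 = X'" by (intro simple) auto
      then show False using C by blast
    qed
    then have "fin X X'" using fin_iff by blast
    then have "fin V X'" using fin_trans[OF X(4)] X X' V by blast
    then show False using max[OF X'(1,2,3)] X' g by blast
  qed
  then show ?thesis using X by simp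
qed

theorem fin_maximal_pow:
  assumes noeth: noeth and mx: "maximalideal \<mm> R"
  shows "fin (ism (\<mm> [^]\<^bsub>ideals_set R\<^esub> (N::nat)) (carrier M)) (carrier M)"
proof (induction N)
  case (Suc N)
  have m: "ideal \<mm> R" using mx maximalideal.axioms(1) by blast
  let ?W = "ism (\<mm> [^]\<^bsub>ideals_set R\<^esub> N) (carrier M)"
  let ?V = "ism (\<mm> [^]\<^bsub>ideals_set R\<^esub> Suc N) (carrier M)"
  have mc: "\<mm> \<subseteq> carrier R" "\<mm> [^]\<^bsub>ideals_set R\<^esub> N \<subseteq> carrier R" using m by (auto intro!: ideal_carr R.ideal_pow)
  have W: "sm ?W" "?W \<subseteq> carrier M" using mc by (simp_all add: sm_carr)
  have e: "?V = ism \<mm> ?W"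
    using m by (simp add: R.ideal_pow_Suc R.ideal_prod_commute[of _ \<mm>] ism_prod)
  have V: "sm ?V" "?V \<subseteq> ?W" unfolding e using W mc by (simp_all add: ism_le)
  have "fin ?V ?W"
    by (rule fin_if_killed[OF noeth mx V(1) W(1) V(2)]) (simp only: e act_le_ism)
  then show ?case using fin_trans[OF _ Suc] V W by simp
qed simp

end

section \<open>Colengths as lengths of intervals of submodules\<close>

context module
begin

text \<open>The recursive chains agree with the indexed sequences that occur in
  \<open>module_length\<close>.\<close>

lemma chain_iff:
  assumes "sm A" "sm B" "A \<subseteq> B"
  shows "chain n A B \<longleftrightarrow> (\<exists>C. (\<forall>k\<le>n. sm (C k) \<and> A \<subseteq> C k \<and> C k \<subseteq> B) \<and> (\<forall>k<n. C k \<subset> C (Suc k)))"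
proof
  assume "chain n A B"
  then show "\<exists>C. (\<forall>k\<le>n. sm (C k) \<and> A \<subseteq> C k \<and> C k \<subseteq> B) \<and> (\<forall>k<n. C k \<subset> C (Suc k))"
  proof (induction n arbitrary: B)
    case 0
    then show ?case by (intro exI[of _ "\<lambda>_. A"]) auto
  next
    case (Suc n)
    then obtain D where D: "chain n A D" "sm B" "D \<subset> B" by auto
    obtain C where "\<forall>k\<le>n. sm (C k) \<and> A \<subseteq> C k \<and> C k \<subseteq> D" "\<forall>k<n. C k \<subset> C (Suc k)"
      using Suc.IH[OF D(1)] by blast
    then have C: "\<And>k. k \<le> n \<Longrightarrow> sm (C k) \<and> A \<subseteq> C k \<and> C k \<subseteq> D" "\<And>k. k < n \<Longrightarrow> C k \<subset> C (Suc k)"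
      by simp_all
    have A: "A \<subseteq> B" using chain_sm[OF Suc.prems] by simp
    show ?case
    proof (intro exI[of _ "C(Suc n := B)"] conjI allI impI)
      fix k assume "k \<le> Suc n"
      then consider "k = Suc n" | "k \<le> n" by linarith
      then show "sm ((C(Suc n := B)) k)" "A \<subseteq> (C(Suc n := B)) k" "(C(Suc n := B)) k \<subseteq> B"
        using C(1)[of k] D A by (cases; force)+
    next
      fix k assume "k < Suc n"
      then consider "k = n" | "k < n" by linarith
      then show "(C(Suc n := B)) k \<subset> (C(Suc n := B)) (Suc k)"
        using C(1)[of n] C(2)[of k] D by cases auto
    qed
  qed
next
  assume "\<exists>C. (\<forall>k\<le>n. sm (C k) \<and> A \<subseteq> C k \<and> C k \<subseteq> B) \<and> (\<forall>k<n. C k \<subset> C (Suc k))"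
  then obtain C where "\<forall>k\<le>n. sm (C k) \<and> A \<subseteq> C k \<and> C k \<subseteq> B" "\<forall>k<n. C k \<subset> C (Suc k)" by blast
  then have C: "\<And>k. k \<le> n \<Longrightarrow> sm (C k) \<and> A \<subseteq> C k \<and> C k \<subseteq> B" "\<And>k. k < n \<Longrightarrow> C k \<subset> C (Suc k)"
    by simp_all
  have "chain k A (C k)" if "k \<le> n" for k
    using that
  proof (induction k)
    case 0
    then show ?case using C(1)[of 0] assms by auto
  next
    case (Suc k)
    then show ?case using C(1)[of "Suc k"] C(2)[of k] by (auto intro!: exI[of _ "C k"])
  qed
  from chain_trans[OF this[OF order_refl], of 0 B] show "chain n A B" using C(1)[of n] assms by simp
qed

lemma coset_eq_iff:
  assumes N: "sm N" and x: "x \<in> carrier M" and y: "y \<in> carrier M"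
  shows "N +>\<^bsub>M\<^esub> x = N +>\<^bsub>M\<^esub> y \<longleftrightarrow> x \<ominus>\<^bsub>M\<^esub> y \<in> N"
proof -
  interpret N: abelian_subgroup N M
    by (rule abelian_subgroupI3[OF additive_subgroup.intro[OF submodule.axioms(1)[OF N[unfolded sm_def]]]
          M.abelian_group_axioms])
  show ?thesis
  proof
    assume "N +>\<^bsub>M\<^esub> x = N +>\<^bsub>M\<^esub> y"
    then have "x \<in> N +>\<^bsub>M\<^esub> y" using N.a_rcos_self x by blast
    then show "x \<ominus>\<^bsub>M\<^esub> y \<in> N" using N.a_rcos_module_imp[OF y] by (simp add: a_minus_def)
  next
    assume "x \<ominus>\<^bsub>M\<^esub> y \<in> N"
    then have "x \<in> N +>\<^bsub>M\<^esub> y" using N.a_rcos_module_rev[OF y x] by (simp add: a_minus_def)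
    then show "N +>\<^bsub>M\<^esub> x = N +>\<^bsub>M\<^esub> y" using N.a_repr_independence'[OF _ y] by simp
  qed
qed

text \<open>Correspondence theorem: image and preimage under the projection to cosets match the
  submodules of M/N with those containing N, and preserve strict inclusions.\<close>

theorem module_length_quot:
  assumes N: "sm N" shows "module_length R (quot_module M N) = len N (carrier M)"
proof -
  let ?Q = "quot_module M N"
  have sN: "submodule N R M" using N by (simp add: sm_def)
  interpret N: abelian_subgroup N M
    by (rule abelian_subgroupI3[OF additive_subgroup.intro[OF submodule.axioms(1)[OF sN]]
          M.abelian_group_axioms])
  interpret Q: module R ?Q by (rule quot_module_is_module[OF sN])
  define \<pi> where "\<pi> x = N +>\<^bsub>M\<^esub> x" for x
  have carrQ: "carrier ?Q = \<pi> ` carrier M"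
    by (auto simp: quot_module_def A_RCOSETS_def RCOSETS_def a_r_coset_def \<pi>_def)
  have padd: "\<pi> (x \<oplus>\<^bsub>M\<^esub> y) = \<pi> x \<oplus>\<^bsub>?Q\<^esub> \<pi> y" if "x \<in> carrier M" "y \<in> carrier M" for x y
    using that N.a_rcos_sum by (simp add: quot_module_def \<pi>_def)
  have psm: "\<pi> (a \<odot>\<^bsub>M\<^esub> x) = a \<odot>\<^bsub>?Q\<^esub> \<pi> x" if "a \<in> carrier R" "x \<in> carrier M" for a x
    using that quot_module_smult[OF sN] by (simp add: \<pi>_def)
  have pz: "\<pi> x = \<zero>\<^bsub>?Q\<^esub>" if "x \<in> N" for x
    using that by (simp add: quot_module_def \<pi>_def N.a_rcos_const)
  have peq: "\<pi> x = \<pi> y \<longleftrightarrow> x \<ominus>\<^bsub>M\<^esub> y \<in> N" if "x \<in> carrier M" "y \<in> carrier M" for x y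
    using coset_eq_iff[OF N that] by (simp add: \<pi>_def)
  define f where "f X = {x \<in> carrier M. \<pi> x \<in> X}" for X
  have f: "sm (f X)" "N \<subseteq> f X" if X: "Q.sm X" for X
  proof -
    show "N \<subseteq> f X" using pz Q.sm_zero[OF X] sm_mem[OF N] by (auto simp: f_def)
    then show "sm (f X)"
      by (intro smI) (use X sm_zero[OF N] pz[OF sm_zero[OF N]] Q.sm_zero[OF X] in \<open>auto simp: f_def padd psm Q.sm_add Q.sm_smult\<close>)
  qed
  have pf: "\<pi> ` f X = X" if X: "Q.sm X" for X
    using Q.sm_carr[OF X] by (auto simp: f_def carrQ)
  have g: "Q.sm (\<pi> ` Y)" if Y: "sm Y" for Y
  proof (rule Q.smI)
    show "\<pi> ` Y \<subseteq> carrier ?Q" using sm_carr[OF Y] by (auto simp: carrQ)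
    show "\<zero>\<^bsub>?Q\<^esub> \<in> \<pi> ` Y" using pz[OF sm_zero[OF N]] sm_zero[OF Y] by force
  next
    fix x y assume "x \<in> \<pi> ` Y" "y \<in> \<pi> ` Y"
    then obtain u v where "u \<in> Y" "v \<in> Y" "x = \<pi> u" "y = \<pi> v" by blast
    then show "x \<oplus>\<^bsub>?Q\<^esub> y \<in> \<pi> ` Y" using padd[of u v] sm_mem[OF Y] sm_add[OF Y, of u v] by force
  next
    fix a x assume a: "a \<in> carrier R" and "x \<in> \<pi> ` Y"
    then obtain u where "u \<in> Y" "x = \<pi> u" by blast
    then show "a \<odot>\<^bsub>?Q\<^esub> x \<in> \<pi> ` Y" using psm[OF a, of u] sm_mem[OF Y] sm_smult[OF Y a, of u] by force
  qed
  have fg: "f (\<pi> ` Y) = Y" if Y: "sm Y" "N \<subseteq> Y" for Y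
  proof
    show "f (\<pi> ` Y) \<subseteq> Y"
    proof
      fix x assume "x \<in> f (\<pi> ` Y)"
      then obtain y where y: "x \<in> carrier M" "y \<in> Y" "\<pi> x = \<pi> y" by (auto simp: f_def)
      have yc: "y \<in> carrier M" using y Y sm_mem by blast
      have "x \<ominus>\<^bsub>M\<^esub> y \<in> Y" using peq[OF y(1) yc] y Y by blast
      then have "y \<oplus>\<^bsub>M\<^esub> (x \<ominus>\<^bsub>M\<^esub> y) \<in> Y" using y Y sm_add by blast
      then show "x \<in> Y" using y(1) yc by (simp add: a_minus_def)
    qed
  qed (use sm_carr[OF Y(1)] in \<open>auto simp: f_def\<close>)
  have "{n. \<exists>C. (\<forall>k\<le>n. submodule (C k) R ?Q) \<and> (\<forall>k<n. C k \<subset> C (Suc k))} = {n. chain n N (carrier M)}"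
  proof (intro Collect_cong iffI)
    fix n assume "\<exists>C. (\<forall>k\<le>n. submodule (C k) R ?Q) \<and> (\<forall>k<n. C k \<subset> C (Suc k))"
    then obtain C where "\<forall>k\<le>n. submodule (C k) R ?Q" "\<forall>k<n. C k \<subset> C (Suc k)" by blast
    then have C: "Q.sm (C k)" if "k \<le> n" for k using that by (simp add: Q.sm_def)
    have Cs: "C k \<subset> C (Suc k)" if "k < n" for k using \<open>\<forall>k<n. C k \<subset> C (Suc k)\<close> that by blast
    have "f (C k) \<subset> f (C (Suc k))" if "k < n" for k
    proof -
      have "f (C k) \<subseteq> f (C (Suc k))" using Cs[OF that] by (auto simp: f_def)
      moreover have "f (C k) \<noteq> f (C (Suc k))"
      proof
        assume "f (C k) = f (C (Suc k))"
        then have "\<pi> ` f (C k) = \<pi> ` f (C (Suc k))" by (rule arg_cong)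
        then show False using pf[OF C[of k]] pf[OF C[of "Suc k"]] Cs[OF that] that by simp
      qed
      ultimately show ?thesis by (rule psubsetI)
    qed
    then show "chain n N (carrier M)"
      unfolding chain_iff[OF N sm_carrier sm_carr[OF N]]
    proof (intro exI[of _ "\<lambda>k. f (C k)"] conjI allI impI)
      fix k assume "k \<le> n"
      from f[OF C[OF this]] show "sm (f (C k))" "N \<subseteq> f (C k)" "f (C k) \<subseteq> carrier M" by (simp_all add: sm_carr)
    qed
  next
    fix n assume "chain n N (carrier M)"
    then obtain C where "\<forall>k\<le>n. sm (C k) \<and> N \<subseteq> C k \<and> C k \<subseteq> carrier M" "\<forall>k<n. C k \<subset> C (Suc k)"
      unfolding chain_iff[OF N sm_carrier sm_carr[OF N]] by blast
    then have C: "\<And>k. k \<le> n \<Longrightarrow> sm (C k) \<and> N \<subseteq> C k \<and> C k \<subseteq> carrier M" "\<And>k. k < n \<Longrightarrow> C k \<subset> C (Suc k)"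
      by simp_all
    have "\<pi> ` C k \<subset> \<pi> ` C (Suc k)" if "k < n" for k
    proof -
      have "f (\<pi> ` C k) = C k" "f (\<pi> ` C (Suc k)) = C (Suc k)"
        using fg C(1)[of k] C(1)[of "Suc k"] that by simp_all
      moreover have "C k \<noteq> C (Suc k)" using C(2)[OF that] by (simp add: psubset_eq)
      ultimately have "\<pi> ` C k \<noteq> \<pi> ` C (Suc k)" by metis
      moreover have "\<pi> ` C k \<subseteq> \<pi> ` C (Suc k)" using C(2)[OF that] by (intro image_mono) auto
      ultimately show ?thesis by (intro psubsetI)
    qed
    then show "\<exists>C. (\<forall>k\<le>n. submodule (C k) R ?Q) \<and> (\<forall>k<n. C k \<subset> C (Suc k))"
      using g C(1) by (intro exI[of _ "\<lambda>k. \<pi> ` C k"]) (simp add: Q.sm_def)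
  qed
  then show ?thesis unfolding module_length_def len_def by simp
qed

corollary colength_eq_rl:
  "I \<subseteq> carrier R \<Longrightarrow> colength R M I = rl (ism I (carrier M)) (carrier M)"
  by (simp add: colength_def rl_def ideal_smult_eq_ism module_length_quot)

end

section \<open>Primary ideals and Noetherian families\<close>

lemma primary_to_facts:
  assumes "noetherian_local_ring R \<mm>" "primary_to R \<mm> I"
  shows "ideal I R" "I \<subseteq> \<mm>" "\<exists>N::nat. \<mm> [^]\<^bsub>ideals_set R\<^esub> N \<subseteq> I"
proof -
  interpret noetherian_local_ring R \<mm> by fact
  have rad: "radical_ideal R I = \<mm>" and I: "ideal I R"
    using assms(2) by (auto simp: primary_to_def primary_ideal_def)
  show "ideal I R" by (rule I)
  show "I \<subseteq> \<mm>"
  proof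
    fix a assume a: "a \<in> I"
    then have "a [^]\<^bsub>R\<^esub> (1::nat) \<in> I" using ideal.Icarr[OF I a] by simp
    then show "a \<in> \<mm>" unfolding rad[symmetric] radical_ideal_def using ideal.Icarr[OF I a] by blast
  qed
  have m: "ideal \<mm> R" using maximal maximalideal.axioms(1) by blast
  obtain S where S: "S \<subseteq> carrier R" "finite S" "\<mm> = Idl\<^bsub>R\<^esub> S" using finetely_gen[OF m] by blast
  have "\<exists>n::nat. s [^]\<^bsub>R\<^esub> n \<in> I" if "s \<in> S" for s
  proof -
    have "s \<in> \<mm>" using that S genideal_self by blast
    then show ?thesis unfolding rad[symmetric] radical_ideal_def by blast
  qed
  from fin_gen_ideal_pow_le[OF I S(2,1) this] show "\<exists>N::nat. \<mm> [^]\<^bsub>ideals_set R\<^esub> N \<subseteq> I"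
    by (simp add: S(3))
qed

text \<open>\<open>gr R I D n\<close> is spanned by the products \<open>I w\<^sub>1 \<cdots> I w\<^sub>k\<close> with \<open>w\<^sub>1 + \<cdots> + w\<^sub>k = n\<close> and
  all \<open>w\<^sub>j\<close> between 1 and \<open>D\<close>.\<close>

inductive gr :: "('a, 'r) ring_scheme \<Rightarrow> (nat \<Rightarrow> 'a set) \<Rightarrow> nat \<Rightarrow> nat \<Rightarrow> 'a \<Rightarrow> bool" for R and I and D where
  base: "r \<in> carrier R \<Longrightarrow> gr R I D 0 r"
| null: "gr R I D n \<zero>\<^bsub>R\<^esub>"
| mult: "a \<in> I w \<Longrightarrow> 1 \<le> w \<Longrightarrow> w \<le> D \<Longrightarrow> gr R I D n b \<Longrightarrow> gr R I D (w + n) (a \<otimes>\<^bsub>R\<^esub> b)"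
| add: "gr R I D n a \<Longrightarrow> gr R I D n b \<Longrightarrow> gr R I D n (a \<oplus>\<^bsub>R\<^esub> b)"

section \<open>From generators of the Rees algebra to a Veronese subfamily\<close>

context cring
begin

context
  fixes I :: "nat \<Rightarrow> 'a set"
  assumes I0: "I 0 = carrier R" and idl: "\<And>n. ideal (I n) R" and gradedI: "\<And>m n. I m \<cdot> I n \<subseteq> I (m + n)"
begin

lemma I_carr: "a \<in> I n \<Longrightarrow> a \<in> carrier R"
  by (rule ideal.Icarr[OF idl])

lemma gr_carr: "gr R I D n a \<Longrightarrow> a \<in> carrier R"
  by (induction rule: gr.induct) (auto intro: I_carr)

lemma gr_mult: "gr R I D m a \<Longrightarrow> gr R I D n b \<Longrightarrow> gr R I D (m + n) (a \<otimes> b)"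
proof (induction m a rule: gr.induct)
  case (base r)
  have "gr R I D n (r \<otimes> b)" using base(2)
  proof induction
    case (base s) then show ?case using \<open>r \<in> carrier R\<close> by (auto intro: gr.base)
  next
    case (null n) then show ?case using \<open>r \<in> carrier R\<close> by (auto intro: gr.null)
  next
    case (mult a w n b)
    have "r \<otimes> (a \<otimes> b) = a \<otimes> (r \<otimes> b)"
      using \<open>r \<in> carrier R\<close> I_carr[OF mult(1)] gr_carr[OF mult(4)] by (simp add: m_lcomm)
    then show ?case using gr.mult[OF mult(1-3,5)] by simp
  next
    case (add n a b)
    then show ?case using \<open>r \<in> carrier R\<close> gr.add[OF add(3,4)] gr_carr by (simp add: r_distr)
  qed
  then show ?case by simp
next
  case (null m) then show ?case using gr_carr[OF null] by (auto intro: gr.null)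
next
  case (mult a w m a')
  have "(a \<otimes> a') \<otimes> b = a \<otimes> (a' \<otimes> b)"
    using I_carr[OF mult(1)] gr_carr[OF mult(4)] gr_carr[OF mult(6)] by (simp add: m_assoc)
  then show ?case using gr.mult[OF mult(1-3) mult(5)[OF mult(6)]] by (simp add: add.assoc)
next
  case (add m a a')
  then show ?case using gr.add[OF add(3,4)[OF add(5)]] gr_carr by (simp add: l_distr)
qed

lemma gr_minus: assumes "gr R I D n a" shows "gr R I D n (\<ominus> a)"
proof -
  have "gr R I D (0 + n) ((\<ominus> \<one>) \<otimes> a)" by (intro gr_mult assms gr.base) simp
  then show ?thesis using gr_carr[OF assms] by (simp add: l_minus)
qed

lemma gr_finsum: "finite A \<Longrightarrow> (\<And>i. i \<in> A \<Longrightarrow> gr R I D n (f i)) \<Longrightarrow> gr R I D n (\<Oplus>i\<in>A. f i)"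
proof (induction A rule: finite_induct)
  case empty then show ?case by (simp add: gr.null)
next
  case (insert x A)
  then have "f \<in> A \<rightarrow> carrier R" "f x \<in> carrier R" using gr_carr by auto
  then show ?case using insert by (simp add: gr.add)
qed

text \<open>D exceeds the degrees of finitely many algebra generators. A coefficient of a generator
  is a scalar in degree 0, a single factor in degrees 1 to D, and zero beyond. As \<open>gr\<close>
  is compatible with the ring operations, it holds for all coefficients in the Rees algebra, in
  particular for that of the monomial a t^n.\<close>

theorem noetherian_family_gr:
  assumes "noetherian_family R I"
  shows "\<exists>D\<ge>1. \<forall>n. \<forall>a\<in>I n. gr R I D n a"
proof -
  define A where "A = rees_algebra R I"
  interpret P: UP_cring R "UP R" by (simp add: UP_cring_def is_cring)
  let ?c = "up_ring.coeff (UP R)"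
  have A: "carrier A = {p \<in> carrier (UP R). \<forall>n. ?c p n \<in> I n}"
    and [simp]: "monoid.mult A = monoid.mult (UP R)" "ring.add A = ring.add (UP R)" "monoid.one A = monoid.one (UP R)"
      "ring.zero A = ring.zero (UP R)" "module.smult A = module.smult (UP R)"
    by (simp_all add: A_def rees_algebra_def)
  obtain F where F: "F \<subseteq> carrier A" "finite F"
    "generate_ring A ((\<lambda>a. a \<odot>\<^bsub>A\<^esub> \<one>\<^bsub>A\<^esub>) ` carrier R \<union> F) = carrier A"
    using assms by (auto simp: noetherian_family_def fin_gen_algebra_def A_def)
  have "\<exists>b. \<forall>n>b. ?c p n = \<zero>" if "p \<in> F" for p
  proof -
    have "p \<in> up R" using that F A by (auto simp: UP_def)
    then obtain b where "bound \<zero> b p" using bound_upD by blast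
    then show ?thesis using \<open>p \<in> up R\<close> by (auto simp: UP_def bound_def)
  qed
  then obtain b where b: "\<And>p n. p \<in> F \<Longrightarrow> b p < n \<Longrightarrow> ?c p n = \<zero>" by metis
  define D where "D = Suc (\<Sum>p\<in>F. b p)"
  have bD: "b p \<le> D" if "p \<in> F" for p
    using member_le_sum[of p F b] that F by (simp add: D_def)
  have genF: "gr R I D n (?c p n)" if "p \<in> F" for p n
  proof -
    have pA: "?c p n \<in> I n" using that F A by auto
    consider "n = 0" | "1 \<le> n" "n \<le> D" | "D < n" by linarith
    then show ?thesis
    proof cases
      case 1
      then show ?thesis using pA I_carr by (auto intro: gr.base)
    next
      case 2
      have "gr R I D (n + 0) (?c p n \<otimes> \<one>)" using pA 2 by (intro gr.mult gr.base) auto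
      then show ?thesis using I_carr[OF pA] by simp
    next
      case 3
      then show ?thesis using b[OF that, of n] bD[OF that] by (simp add: gr.null)
    qed
  qed
  \<comment> \<open>\<open>generate_ring\<close> takes additive inverses in A, where they are a
    definite description over a smaller carrier; they have to be identified with those of
    \<open>UP R\<close>.\<close>
  have minus: "\<ominus>\<^bsub>A\<^esub> p = \<ominus>\<^bsub>UP R\<^esub> p" if p: "p \<in> carrier A" for p
  proof -
    have q: "\<ominus>\<^bsub>UP R\<^esub> p \<in> carrier A" using p additive_subgroup.a_inv_closed[OF ideal.axioms(1)[OF idl]] by (auto simp: A)
    have pc: "p \<in> carrier (UP R)" using p by (simp add: A)
    show ?thesis unfolding a_inv_def[of A] m_inv_def
    proof (rule the_equality)
      show "\<ominus>\<^bsub>UP R\<^esub> p \<in> carrier (add_monoid A) \<and> p \<otimes>\<^bsub>add_monoid A\<^esub> (\<ominus>\<^bsub>UP R\<^esub> p) = \<one>\<^bsub>add_monoid A\<^esub>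
          \<and> (\<ominus>\<^bsub>UP R\<^esub> p) \<otimes>\<^bsub>add_monoid A\<^esub> p = \<one>\<^bsub>add_monoid A\<^esub>"
        using q pc by (simp add: P.P.r_neg P.P.l_neg)
    next
      fix y assume "y \<in> carrier (add_monoid A) \<and> p \<otimes>\<^bsub>add_monoid A\<^esub> y = \<one>\<^bsub>add_monoid A\<^esub>
          \<and> y \<otimes>\<^bsub>add_monoid A\<^esub> p = \<one>\<^bsub>add_monoid A\<^esub>"
      then have "y \<in> carrier (UP R)" "y \<oplus>\<^bsub>UP R\<^esub> p = \<zero>\<^bsub>UP R\<^esub>" by (auto simp: A)
      then show "y = \<ominus>\<^bsub>UP R\<^esub> p" using P.P.minus_equality[of y p] pc by simp
    qed
  qed
  have main: "p \<in> carrier A \<and> (\<forall>n. gr R I D n (?c p n))"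
    if "p \<in> generate_ring A ((\<lambda>a. a \<odot>\<^bsub>A\<^esub> \<one>\<^bsub>A\<^esub>) ` carrier R \<union> F)" for p
    using that
  proof (induction rule: generate_ring.induct)
    case one
    then show ?case using I0 additive_subgroup.zero_closed[OF ideal.axioms(1)[OF idl]]
      by (auto simp: A intro: gr.base gr.null)
  next
    case (incl h)
    then show ?case
    proof
      assume "h \<in> (\<lambda>a. a \<odot>\<^bsub>A\<^esub> \<one>\<^bsub>A\<^esub>) ` carrier R"
      then show ?thesis using I0 additive_subgroup.zero_closed[OF ideal.axioms(1)[OF idl]]
        by (auto simp: A intro: gr.base gr.null)
    qed (use genF F in auto)
  next
    case (a_inv h)
    then have "h \<in> carrier (UP R)" by (simp add: A)
    then show ?case using a_inv additive_subgroup.a_inv_closed[OF ideal.axioms(1)[OF idl]]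
      by (auto simp: minus A intro: gr_minus)
  next
    case (eng_add h1 h2)
    then show ?case using additive_subgroup.a_closed[OF ideal.axioms(1)[OF idl]]
      by (auto simp: A intro: gr.add)
  next
    case (eng_mult h1 h2)
    then have c: "h1 \<in> carrier (UP R)" "h2 \<in> carrier (UP R)" by (auto simp: A)
    have "gr R I D n (?c (h1 \<otimes>\<^bsub>UP R\<^esub> h2) n)" for n
      unfolding P.coeff_mult[OF c]
    proof (rule gr_finsum)
      fix i assume "i \<in> {..n}"
      then show "gr R I D n (?c h1 i \<otimes> ?c h2 (n - i))"
        using gr_mult[of D i "?c h1 i" "n - i" "?c h2 (n - i)"] eng_mult by simp
    qed simp
    moreover have "?c (h1 \<otimes>\<^bsub>UP R\<^esub> h2) n \<in> I n" for n
      unfolding P.coeff_mult[OF c]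
    proof -
      have t: "?c h1 i \<otimes> ?c h2 (n - i) \<in> I n" if "i \<le> n" for i
        using eng_mult gradedI[of i "n - i"] that ideal_prod.prod[of "?c h1 i" "I i" "?c h2 (n - i)" "I (n - i)" R]
        by (auto simp: A)
      have "(\<Oplus>i\<in>B. ?c h1 i \<otimes> ?c h2 (n - i)) \<in> I n" if "finite B" "B \<subseteq> {..n}" for B
        using that
      proof (induction B rule: finite_induct)
        case empty
        then show ?case using additive_subgroup.zero_closed[OF ideal.axioms(1)[OF idl]] by simp
      next
        case (insert i B)
        then show ?case using t[of i] additive_subgroup.a_closed[OF ideal.axioms(1)[OF idl]] c
          by (subst finsum_insert) auto
      qed
      then show "(\<Oplus>i\<in>{..n}. ?c h1 i \<otimes> ?c h2 (n - i)) \<in> I n" by simp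
    qed
    ultimately show ?case using c by (simp add: A)
  qed
  have "gr R I D n a" if a: "a \<in> I n" for n a
  proof -
    let ?p = "up_ring.monom (UP R) a n"
    have "?p \<in> carrier A"
      using a I_carr additive_subgroup.zero_closed[OF ideal.axioms(1)[OF idl]] by (auto simp: A)
    then have "gr R I D n (?c ?p n)" using main F(3) by blast
    then show ?thesis using I_carr[OF a] by simp
  qed
  then show ?thesis by (intro exI[of _ D]) (auto simp: D_def)
qed

definition pl_prod :: "nat list \<Rightarrow> 'a set" where
  "pl_prod ws = foldr (\<lambda>w A. I w \<cdot> A) ws (carrier R)"

lemma pl_prod_ideal: "ideal (pl_prod ws) R"
  by (induction ws) (auto simp: pl_prod_def oneideal ideal_prod_is_ideal idl)

lemma pow_family_le: "I j [^]\<^bsub>ideals_set R\<^esub> k \<subseteq> I (j * k)"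
proof (induction k)
  case (Suc k)
  have "(I j [^]\<^bsub>ideals_set R\<^esub> k) \<cdot> I j \<subseteq> I (j * k) \<cdot> I j" by (intro ideal_prod_mono Suc order_refl)
  also have "\<dots> \<subseteq> I (j * Suc k)" using gradedI[of "j * k" j] by (simp add: add.commute)
  finally show ?case by (simp only: ideal_pow_Suc)
qed (simp add: I0)

lemma prod_one_l: "ideal A R \<Longrightarrow> carrier R \<cdot> A = A"
  by (simp add: ideal_prod_commute[of "carrier R"] oneideal ideal_prod_one)

text \<open>The factors of index j are collected into a power, and the grading merges all others
  into one ideal of the remaining degree.\<close>

lemma pl_prod_le:
  "pl_prod ws \<subseteq> (I j [^]\<^bsub>ideals_set R\<^esub> count_list ws j) \<cdot> I (sum_list ws - j * count_list ws j) \<and> j * count_list ws j \<le> sum_list ws"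
proof (induction ws)
  case Nil
  show ?case using prod_one_l[OF oneideal] by (simp add: pl_prod_def I0)
next
  case (Cons v ws)
  let ?c = "count_list ws j" and ?r = "sum_list ws - j * count_list ws j"
  have P: "ideal (I j [^]\<^bsub>ideals_set R\<^esub> ?c) R" using idl by simp
  have "pl_prod (v # ws) = I v \<cdot> pl_prod ws" by (simp add: pl_prod_def)
  also have "\<dots> \<subseteq> I v \<cdot> ((I j [^]\<^bsub>ideals_set R\<^esub> ?c) \<cdot> I ?r)" using Cons by (intro ideal_prod_mono) auto
  finally have le: "pl_prod (v # ws) \<subseteq> I v \<cdot> ((I j [^]\<^bsub>ideals_set R\<^esub> ?c) \<cdot> I ?r)" .
  show ?case
  proof (cases "v = j")
    case True
    have "I v \<cdot> ((I j [^]\<^bsub>ideals_set R\<^esub> ?c) \<cdot> I ?r) = (I j [^]\<^bsub>ideals_set R\<^esub> Suc ?c) \<cdot> I ?r"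
      using P idl True by (simp add: ideal_pow_Suc ideal_prod_assoc[symmetric] ideal_prod_commute[of "I j"])
    then show ?thesis using le True Cons by simp
  next
    case False
    have "I v \<cdot> ((I j [^]\<^bsub>ideals_set R\<^esub> ?c) \<cdot> I ?r) = (I j [^]\<^bsub>ideals_set R\<^esub> ?c) \<cdot> (I v \<cdot> I ?r)"
      using P idl by (metis ideal_prod_assoc ideal_prod_commute)
    also have "\<dots> \<subseteq> (I j [^]\<^bsub>ideals_set R\<^esub> ?c) \<cdot> I (v + ?r)" by (intro ideal_prod_mono gradedI order_refl)
    finally show ?thesis using le False Cons by auto
  qed
qed

lemma sum_list_count_le:
  assumes "set ws \<subseteq> {1..D}" shows "sum_list ws = (\<Sum>j\<in>{1..D}. j * count_list ws j)"
  using assms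
proof (induction ws)
  case (Cons v ws)
  have "(\<Sum>j\<in>{1..D}. j * count_list (v # ws) j) = (\<Sum>j\<in>{1..D}. j * count_list ws j + (if j = v then j else 0))"
    by (rule sum.cong) auto
  also have "\<dots> = (\<Sum>j\<in>{1..D}. j * count_list ws j) + v"
    using Cons.prems by (simp add: sum.distrib)
  finally show ?case using Cons by simp
qed simp

text \<open>The indices lie in 1..D, so a total degree of D times D! forces some j to contribute at
  least D!. Since j divides D!, exactly D!/j of these factors multiply into
  \<open>I (fact D)\<close>. The weight w that can be split off is therefore D!.\<close>

lemma pl_prod_pigeonhole:
  assumes D: "1 \<le> D" and ws: "set ws \<subseteq> {1..D}" and big: "D * fact D \<le> sum_list ws"
  shows "pl_prod ws \<subseteq> I (fact D) \<cdot> I (sum_list ws - fact D)"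
proof -
  have "\<exists>j\<in>{1..D}. fact D \<le> j * count_list ws j"
  proof (rule ccontr)
    assume "\<not> ?thesis"
    then have "(\<Sum>j\<in>{1..D}. j * count_list ws j) < (\<Sum>j\<in>{1..D}. fact D)"
      using D by (intro sum_strict_mono) (auto simp: not_le)
    then show False using big unfolding sum_list_count_le[OF ws] by simp
  qed
  then obtain j where j: "1 \<le> j" "j \<le> D" "fact D \<le> j * count_list ws j" by auto
  obtain q where q: "fact D = j * q" using dvd_fact[OF j(1,2)] by (metis dvdE)
  let ?c = "count_list ws j"
  have qc: "q \<le> ?c" using j q by simp
  have jc: "j * ?c \<le> sum_list ws" using pl_prod_le[of ws j] by simp
  note id = ideal_pow[OF idl[of j]] idl
  have "pl_prod ws \<subseteq> (I j [^]\<^bsub>ideals_set R\<^esub> (q + (?c - q))) \<cdot> I (sum_list ws - j * ?c)"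
    using pl_prod_le[of ws j] qc by simp
  also have "\<dots> = (I j [^]\<^bsub>ideals_set R\<^esub> q) \<cdot> ((I j [^]\<^bsub>ideals_set R\<^esub> (?c - q)) \<cdot> I (sum_list ws - j * ?c))"
    using id by (simp add: ideal_pow_add ideal_prod_assoc)
  also have "\<dots> \<subseteq> I (j * q) \<cdot> (I (j * (?c - q)) \<cdot> I (sum_list ws - j * ?c))"
    by (intro ideal_prod_mono pow_family_le order_refl)
  also have "\<dots> \<subseteq> I (j * q) \<cdot> I (j * (?c - q) + (sum_list ws - j * ?c))"
    by (intro ideal_prod_mono gradedI order_refl)
  also have "j * (?c - q) + (sum_list ws - j * ?c) = sum_list ws - fact D"
    using jc qc q by (simp add: diff_mult_distrib2)
  finally show ?thesis by (simp only: q)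
qed

text \<open>\<open>b\<close> accumulates the factors already met, with indices \<open>ws\<close>.
  The degree bound then concerns the total degree, which is unchanged when a further factor moves
  from \<open>a\<close> to \<open>b\<close>.\<close>

lemma gr_pigeonhole:
  assumes D: "1 \<le> D" and "gr R I D n a"
  shows "set ws \<subseteq> {1..D} \<Longrightarrow> b \<in> pl_prod ws \<Longrightarrow> D * fact D \<le> sum_list ws + n \<Longrightarrow>
    b \<otimes> a \<in> I (fact D) \<cdot> I (sum_list ws + n - fact D)"
  using assms(2)
proof (induction arbitrary: ws b rule: gr.induct)
  case (base r)
  then have "b \<in> I (fact D) \<cdot> I (sum_list ws - fact D)" using pl_prod_pigeonhole[OF D, of ws] by auto
  then show ?case using ideal.I_r_closed[OF ideal_prod_is_ideal[OF idl idl]] base by simp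
next
  case (null n)
  then show ?case
    using ideal.Icarr[OF pl_prod_ideal null(2)] additive_subgroup.zero_closed[OF ideal.axioms(1)[OF ideal_prod_is_ideal[OF idl idl]]]
    by simp
next
  case (mult a w n a')
  have c: "b \<in> carrier R" "a \<in> carrier R" "a' \<in> carrier R"
    using ideal.Icarr[OF pl_prod_ideal mult.prems(2)] I_carr[OF mult(1)] gr_carr[OF mult(4)] by auto
  have "a \<otimes> b \<in> pl_prod (w # ws)"
    using mult(1) mult.prems(2) by (auto simp: pl_prod_def intro: ideal_prod.prod)
  then have "(a \<otimes> b) \<otimes> a' \<in> I (fact D) \<cdot> I (sum_list (w # ws) + n - fact D)"
    using mult by (intro mult.IH) auto
  moreover have "(a \<otimes> b) \<otimes> a' = b \<otimes> (a \<otimes> a')" using c by (simp add: m_ac)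
  ultimately show ?case by (simp add: add_ac)
next
  case (add n a a')
  have c: "b \<in> carrier R" "a \<in> carrier R" "a' \<in> carrier R"
    using ideal.Icarr[OF pl_prod_ideal add.prems(2)] gr_carr[OF add(1)] gr_carr[OF add(2)] by auto
  then show ?case
    using additive_subgroup.a_closed[OF ideal.axioms(1)[OF ideal_prod_is_ideal[OF idl idl]] add.IH(1)[OF add.prems] add.IH(2)[OF add.prems]]
    by (simp add: r_distr)
qed

theorem noetherian_family_peel:
  assumes "noetherian_family R I"
  shows "\<exists>D w. 1 \<le> D \<and> 1 \<le> w \<and> (\<forall>n\<ge>D * w. I n \<subseteq> I w \<cdot> I (n - w))"
proof -
  obtain D where D: "1 \<le> D" "\<And>n a. a \<in> I n \<Longrightarrow> gr R I D n a" using noetherian_family_gr[OF assms] by blast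
  have "I n \<subseteq> I (fact D) \<cdot> I (n - fact D)" if "D * fact D \<le> n" for n
  proof
    fix a assume a: "a \<in> I n"
    have "\<one> \<otimes> a \<in> I (fact D) \<cdot> I (sum_list [] + n - fact D)"
      using that by (intro gr_pigeonhole[OF D(1) D(2)[OF a]]) (auto simp: pl_prod_def)
    then show "a \<in> I (fact D) \<cdot> I (n - fact D)" using I_carr[OF a] by simp
  qed
  then show ?thesis using D(1) by (intro exI[of _ D] exI[of _ "fact D"]) (auto simp: fact_ge_1)
qed

text \<open>The k-th factor is split off in degree n - (k - 1) w, which has to be at least D w. This
  is the first inequality, with the subtraction moved to the other side.\<close>

lemma family_le_pow:
  assumes "\<And>n. D * w \<le> n \<Longrightarrow> I n \<subseteq> I w \<cdot> I (n - w)"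
  shows "D * w + k * w \<le> n + w \<Longrightarrow> k * w \<le> n \<Longrightarrow> I n \<subseteq> (I w [^]\<^bsub>ideals_set R\<^esub> k) \<cdot> I (n - k * w)"
proof (induction k arbitrary: n)
  case 0
  then show ?case by (simp add: prod_one_l idl)
next
  case (Suc k)
  have "I n \<subseteq> (I w [^]\<^bsub>ideals_set R\<^esub> k) \<cdot> I (n - k * w)" using Suc by (intro Suc.IH) auto
  also have "\<dots> \<subseteq> (I w [^]\<^bsub>ideals_set R\<^esub> k) \<cdot> (I w \<cdot> I (n - k * w - w))"
    using Suc.prems by (intro ideal_prod_mono assms order_refl) auto
  also have "\<dots> = (I w [^]\<^bsub>ideals_set R\<^esub> Suc k) \<cdot> I (n - Suc k * w)"
    by (simp add: ideal_pow_Suc ideal_prod_assoc idl ideal_pow diff_diff_left add.commute)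
  finally show ?case .
qed

theorem noetherian_family_veronese:
  assumes "noetherian_family R I"
  shows "\<exists>c0\<ge>1. \<forall>c\<ge>1. c0 dvd c \<longrightarrow> (\<forall>m. I (c * m) = I c [^]\<^bsub>ideals_set R\<^esub> m) \<and>
      (\<forall>u n. c * Suc u \<le> n \<longrightarrow> I n \<subseteq> I c [^]\<^bsub>ideals_set R\<^esub> u)"
proof -
  obtain D w where D: "1 \<le> D" "1 \<le> w" and peel: "\<And>n. D * w \<le> n \<Longrightarrow> I n \<subseteq> I w \<cdot> I (n - w)"
    using noetherian_family_peel[OF assms] by blast
  show ?thesis
  proof (intro exI[of _ "D * w"] conjI allI impI)
    show "1 \<le> D * w" using D by simp
    fix c :: nat assume c1: "1 \<le> c" and dvd: "D * w dvd c"
    then obtain j where j: "c = D * w * j" by (metis dvdE)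
    define k where "k = D * j"
    have c: "c = k * w" "D * w \<le> c" using j c1 by (auto simp: k_def)
    have pk: "I w [^]\<^bsub>ideals_set R\<^esub> k \<subseteq> I c" using pow_family_le[of w k] by (simp add: c mult.commute)
    have step: "I (c * Suc m) \<subseteq> I c \<cdot> I (c * m)" if "1 \<le> m" for m
    proof -
      have le: "c \<le> c * m" using that by simp
      have "I (c * Suc m) \<subseteq> (I w [^]\<^bsub>ideals_set R\<^esub> k) \<cdot> I (c * Suc m - k * w)"
      proof (rule family_le_pow[OF peel])
        show "D * w + k * w \<le> c * Suc m + w" "k * w \<le> c * Suc m"
          unfolding c(1)[symmetric] mult_Suc_right using order_trans[OF c(2) le] by linarith+
      qed
      also have "\<dots> \<subseteq> I c \<cdot> I (c * m)" using pk by (intro ideal_prod_mono) (auto simp: c(1)[symmetric])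
      finally show ?thesis .
    qed
    show "I (c * m) = I c [^]\<^bsub>ideals_set R\<^esub> m" for m
    proof
      show "I c [^]\<^bsub>ideals_set R\<^esub> m \<subseteq> I (c * m)" by (rule pow_family_le)
      show "I (c * m) \<subseteq> I c [^]\<^bsub>ideals_set R\<^esub> m"
      proof (induction m)
        case (Suc m)
        show ?case
        proof (cases "m = 0")
          case False
          then have "I (c * Suc m) \<subseteq> I c \<cdot> I (c * m)" by (intro step) auto
          also have "\<dots> \<subseteq> I c \<cdot> (I c [^]\<^bsub>ideals_set R\<^esub> m)" by (intro ideal_prod_mono Suc order_refl)
          also have "\<dots> = I c [^]\<^bsub>ideals_set R\<^esub> Suc m"
            unfolding ideal_pow_Suc by (intro ideal_prod_commute idl ideal_pow)
          finally show ?thesis .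
        qed (simp add: idl prod_one_l)
      qed (simp add: I0)
    qed
    show "I n \<subseteq> I c [^]\<^bsub>ideals_set R\<^esub> u" if n: "c * Suc u \<le> n" for u n
    proof -
      have e: "k * u * w = c * u" by (simp add: c)
      have "I n \<subseteq> (I w [^]\<^bsub>ideals_set R\<^esub> (k * u)) \<cdot> I (n - (k * u) * w)"
        using n c(2) by (intro family_le_pow[OF peel]) (auto simp: e)
      also have "\<dots> \<subseteq> I w [^]\<^bsub>ideals_set R\<^esub> (k * u)" by (intro ideal_prod_le1 ideal_pow idl)
      also have "\<dots> = (I w [^]\<^bsub>ideals_set R\<^esub> k) [^]\<^bsub>ideals_set R\<^esub> u" by (simp add: ideal_pow_pow idl)
      also have "\<dots> \<subseteq> I c [^]\<^bsub>ideals_set R\<^esub> u" by (intro ideal_pow_mono pk)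
      finally show ?thesis .
    qed
  qed
qed

end

end

section \<open>Multiplicities\<close>

lemma tendsto_ratio_if_bounded_diff:
  fixes u :: "nat \<Rightarrow> real"
  assumes "eventually (\<lambda>m. \<bar>u m - real m * x\<bar> \<le> K) sequentially"
  shows "(\<lambda>m. u m / real m) \<longlonglongrightarrow> x"
proof -
  have z: "(\<lambda>m. K * (1 / real m)) \<longlonglongrightarrow> 0"
    using tendsto_mult[OF tendsto_const lim_1_over_n, of K] by simp
  have "(\<lambda>m. u m / real m - x) \<longlonglongrightarrow> 0"
  proof (rule tendsto_0_le[OF z])
    show "eventually (\<lambda>m. norm (u m / real m - x) \<le> norm (K * (1 / real m)) * 1) sequentially"
      using assms eventually_gt_at_top[of 0]
    proof eventually_elim
      case (elim m)
      have "u m / real m - x = (u m - real m * x) / real m" using elim by (simp add: field_simps)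
      then have "norm (u m / real m - x) \<le> K / real m" using elim by (simp add: abs_divide divide_right_mono)
      also have "\<dots> \<le> norm (K * (1 / real m)) * 1" by (simp add: abs_mult divide_right_mono)
      finally show ?case .
    qed
  qed
  then show ?thesis by (simp add: LIM_zero_iff)
qed

context cring
begin

lemma finprod_ideal:
  "(\<And>i. i \<in> K \<Longrightarrow> ideal (X i) R) \<Longrightarrow> ideal (\<Otimes>\<^bsub>ideals_set R\<^esub>i\<in>K. X i) R"
  using comm_monoid.finprod_closed[OF ideals_set_is_comm_monoid, of X K] by (auto simp: Pi_def)

lemma finprod_ideal_empty [simp]: "(\<Otimes>\<^bsub>ideals_set R\<^esub>i\<in>{}. X i) = carrier R"
  using comm_monoid.finprod_empty[OF ideals_set_is_comm_monoid, of X] by simp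

lemma finprod_ideal_insert:
  assumes "finite K" "i \<notin> K" "\<And>j. j \<in> insert i K \<Longrightarrow> ideal (X j) R"
  shows "(\<Otimes>\<^bsub>ideals_set R\<^esub>j\<in>insert i K. X j) = X i \<cdot> (\<Otimes>\<^bsub>ideals_set R\<^esub>j\<in>K. X j)"
  using comm_monoid.finprod_insert[OF ideals_set_is_comm_monoid, of K i X] assms by (auto simp: Pi_def)

lemma finprod_ideal_mono:
  assumes "finite K" "\<And>i. i \<in> K \<Longrightarrow> ideal (X i) R" "\<And>i. i \<in> K \<Longrightarrow> ideal (Y i) R" "\<And>i. i \<in> K \<Longrightarrow> X i \<subseteq> Y i"
  shows "(\<Otimes>\<^bsub>ideals_set R\<^esub>i\<in>K. X i) \<subseteq> (\<Otimes>\<^bsub>ideals_set R\<^esub>i\<in>K. Y i)"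
  using assms
proof (induction K rule: finite_induct)
  case empty
  show ?case by simp
next
  case (insert i K)
  have "X i \<cdot> (\<Otimes>\<^bsub>ideals_set R\<^esub>j\<in>K. X j) \<subseteq> Y i \<cdot> (\<Otimes>\<^bsub>ideals_set R\<^esub>j\<in>K. Y j)"
    using insert by (intro ideal_prod_mono) auto
  then show ?case
    using finprod_ideal_insert[of K i X, OF insert(1,2)] finprod_ideal_insert[of K i Y, OF insert(1,2)] insert.prems
    by auto
qed

lemma finprod_ideal_eq_multipow:
  fixes J :: "'k::finite \<Rightarrow> 'a set"
  assumes "finite K" and J: "\<And>i. ideal (J i) R"
  shows "(\<Otimes>\<^bsub>ideals_set R\<^esub>p\<in>K. J (f p)) = multipow R J (\<lambda>i. card {p \<in> K. f p = i})"
  using assms(1)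
proof (induction K rule: finite_induct)
  case empty
  show ?case by simp
next
  case (insert p K)
  have "(\<lambda>i. card {q \<in> insert p K. f q = i}) = (\<lambda>i. (if i = f p then 1 else 0) + card {q \<in> K. f q = i})"
  proof
    fix i
    have "{q \<in> insert p K. f q = i} = (if i = f p then insert p {q \<in> K. f q = i} else {q \<in> K. f q = i})" by auto
    then show "card {q \<in> insert p K. f q = i} = (if i = f p then 1 else 0) + card {q \<in> K. f q = i}"
      using insert by auto
  qed
  then show ?case
    using finprod_ideal_insert[of K p "\<lambda>p. J (f p)", OF insert(1,2) J] insert(3)
    by (simp only: multipow_add[OF J] multipow_unit[OF J])
qed

lemma finsum_ideal_le:
  assumes "finite K" "\<And>i. i \<in> K \<Longrightarrow> ideal (X i) R" "\<And>i. i \<in> K \<Longrightarrow> X i \<subseteq> C" "ideal C R"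
  shows "(\<Oplus>\<^bsub>ideals_set R\<^esub>i\<in>K. X i) \<subseteq> C \<and> ideal (\<Oplus>\<^bsub>ideals_set R\<^esub>i\<in>K. X i) R"
  using assms(1-3)
proof (induction K rule: finite_induct)
  have am: "abelian_monoid (ideals_set R)" using ideals_set_is_semiring semiring.axioms(1) by blast
  note z = additive_subgroup.zero_closed[OF ideal.axioms(1)[OF assms(4)]]
  {
    case empty
    show ?case using abelian_monoid.finsum_empty[OF am, of X] z zeroideal by (simp add: ideals_set_def)
  next
    case (insert i K)
    have "(\<Oplus>\<^bsub>ideals_set R\<^esub>j\<in>insert i K. X j) = X i <+>\<^bsub>R\<^esub> (\<Oplus>\<^bsub>ideals_set R\<^esub>j\<in>K. X j)"
      using abelian_monoid.finsum_insert[OF am insert(1,2), of X] insert by (simp add: Pi_def) (simp add: ideals_set_def)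
    moreover have IH: "(\<Oplus>\<^bsub>ideals_set R\<^esub>j\<in>K. X j) \<subseteq> C" "ideal (\<Oplus>\<^bsub>ideals_set R\<^esub>j\<in>K. X j) R" "X i \<subseteq> C" "ideal (X i) R"
      using insert by auto
    moreover have "X i <+>\<^bsub>R\<^esub> (\<Oplus>\<^bsub>ideals_set R\<^esub>j\<in>K. X j) \<subseteq> C"
      using IH(1,3) additive_subgroup.a_closed[OF ideal.axioms(1)[OF assms(4)]] by (auto simp: set_add_def' subset_iff)
    ultimately show ?case using add_ideals by auto
  }
qed

end

context module
begin

context
  fixes \<mm> :: "'a set"
  assumes nlr: "noetherian_local_ring R \<mm>" and fm: "finite_module R M"
begin

lemma nr: "noetherian_ring R" using nlr by (rule noetherian_local_ring.axioms(1))
lemma noeth_M: noeth by (rule noeth_if_finite_module[OF nr fm])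
lemma max_m: "maximalideal \<mm> R" using noetherian_local_ring.maximal[OF nlr] .
lemma ideal_m: "ideal \<mm> R" using max_m maximalideal.axioms(1) by blast

lemma gens_exist:
  assumes "\<And>i::'k. ideal (J i) R"
  obtains S where "\<And>i. finite (S i)" "\<And>i. S i \<subseteq> carrier R" "\<And>i. J i = Idl (S i)"
proof -
  have "\<forall>i. \<exists>S. finite S \<and> S \<subseteq> carrier R \<and> J i = Idl S"
    using noetherian_ring.finetely_gen[OF nr assms] by blast
  from choice[OF this] show thesis using that by blast
qed

text \<open>This is what a joint reduction with respect to \<open>M\<close> passes on to the ideal
  it generates (\<open>reduction_cof\<close>), and it suffices for finite colength
  (\<open>fin_cof\<close>).\<close>

definition cof :: "'a set \<Rightarrow> bool" where
  "cof J \<longleftrightarrow> ideal J R \<and> (\<exists>N::nat. ism (\<mm> [^]\<^bsub>ideals_set R\<^esub> N) (carrier M) \<subseteq> ism J (carrier M))"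

lemma cof_ideal: "cof J \<Longrightarrow> ideal J R" by (simp add: cof_def)

lemma sm_ismM [simp]: "ideal J R \<Longrightarrow> sm (ism J (carrier M))"
  by (simp add: ideal_carr)

lemma cof_superset: "cof K \<Longrightarrow> ideal J R \<Longrightarrow> ism K (carrier M) \<subseteq> ism J (carrier M) \<Longrightarrow> cof J"
  unfolding cof_def by blast

lemma cof_carrier: "cof (carrier R)"
  unfolding cof_def using R.oneideal by (auto intro!: exI[of _ 0])

lemma ism_swap:
  "ideal I R \<Longrightarrow> ideal J R \<Longrightarrow> sm A \<Longrightarrow> ism I (ism J A) = ism J (ism I A)"
  by (simp add: ism_prod[symmetric] R.ideal_prod_commute)

lemma cof_mult: assumes "cof I" "cof J" shows "cof (I \<cdot> J)"
proof -
  obtain N N' :: nat where N: "ism (\<mm> [^]\<^bsub>ideals_set R\<^esub> N) (carrier M) \<subseteq> ism I (carrier M)"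
    "ism (\<mm> [^]\<^bsub>ideals_set R\<^esub> N') (carrier M) \<subseteq> ism J (carrier M)" using assms by (auto simp: cof_def)
  note id = cof_ideal[OF assms(1)] cof_ideal[OF assms(2)] R.ideal_pow[OF ideal_m]
  have "ism (\<mm> [^]\<^bsub>ideals_set R\<^esub> (N + N')) (carrier M) = ism (\<mm> [^]\<^bsub>ideals_set R\<^esub> N) (ism (\<mm> [^]\<^bsub>ideals_set R\<^esub> N') (carrier M))"
    using id by (simp add: R.ideal_pow_add[OF ideal_m] ism_prod)
  also have "\<dots> \<subseteq> ism (\<mm> [^]\<^bsub>ideals_set R\<^esub> N) (ism J (carrier M))" by (intro ism_mono N order_refl)
  also have "\<dots> = ism J (ism (\<mm> [^]\<^bsub>ideals_set R\<^esub> N) (carrier M))" using id by (intro ism_swap) auto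
  also have "\<dots> \<subseteq> ism J (ism I (carrier M))" by (intro ism_mono N order_refl)
  also have "\<dots> = ism (I \<cdot> J) (carrier M)" using id by (subst ism_swap) (auto simp: ism_prod)
  finally show ?thesis unfolding cof_def using R.ideal_prod_is_ideal id by blast
qed

lemma cof_pow: "cof I \<Longrightarrow> cof (I [^]\<^bsub>ideals_set R\<^esub> (n::nat))"
  by (induction n) (auto simp: R.ideal_pow_Suc cof_carrier cof_mult simp del: R.ideal_pow_1)

lemma cof_finprod:
  assumes "finite K" "\<And>i. i \<in> K \<Longrightarrow> cof (X i)" shows "cof (\<Otimes>\<^bsub>ideals_set R\<^esub>i\<in>K. X i)"
  using assms
proof (induction K rule: finite_induct)
  case empty
  show ?case by (simp add: cof_carrier)
next
  case (insert i K)
  then show ?case using R.finprod_ideal_insert[of K i X] cof_mult cof_ideal by simp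
qed

lemma cof_multipow: "(\<And>i. cof (J i)) \<Longrightarrow> cof (multipow R J n)"
  unfolding multipow_def by (rule cof_finprod) (auto intro: cof_pow)

lemma fin_cof: assumes "cof J" shows "fin (ism J (carrier M)) (carrier M)"
proof -
  obtain N :: nat where N: "ism (\<mm> [^]\<^bsub>ideals_set R\<^esub> N) (carrier M) \<subseteq> ism J (carrier M)"
    using assms by (auto simp: cof_def)
  show ?thesis
    using N cof_ideal[OF assms] ideal_m
    by (intro fin_parts(2)[OF fin_maximal_pow[OF noeth_M max_m, of N]]) (auto intro!: sm_carr[THEN subsetD])
qed

definition colen :: "'a set \<Rightarrow> real" where
  "colen J = rl (ism J (carrier M)) (carrier M)"

lemma colength_eq_colen: "ideal J R \<Longrightarrow> colength R M J = colen J"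
  by (simp add: colen_def colength_eq_rl ideal_carr)

lemma colen_antimono:
  assumes "cof J" "ideal J' R" "ism J (carrier M) \<subseteq> ism J' (carrier M)" shows "colen J' \<le> colen J"
proof -
  have "colen J = rl (ism J (carrier M)) (ism J' (carrier M)) + colen J'"
    unfolding colen_def using assms cof_ideal[OF assms(1)] fin_cof[OF assms(1)]
    by (intro rl_add) (auto intro!: sm_carr[THEN subsetD])
  then show ?thesis by simp
qed

text \<open>The actions of ideals commute, so one factor at a time can be replaced next to M. For
  comparing colengths of powers, an inclusion IM \<subseteq> JM is thus as good as an inclusion of
  ideals.\<close>

lemma ism_pow_mono:
  assumes "ideal I R" "ideal J R" "ism I (carrier M) \<subseteq> ism J (carrier M)"
  shows "ism (I [^]\<^bsub>ideals_set R\<^esub> (t::nat)) (carrier M) \<subseteq> ism (J [^]\<^bsub>ideals_set R\<^esub> t) (carrier M)"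
proof (induction t)
  case (Suc t)
  note id = assms(1,2) R.ideal_pow[OF assms(1), of t] R.ideal_pow[OF assms(2), of t]
  have "ism (I [^]\<^bsub>ideals_set R\<^esub> Suc t) (carrier M) = ism (I [^]\<^bsub>ideals_set R\<^esub> t) (ism I (carrier M))"
    using id by (simp add: R.ideal_pow_Suc ism_prod del: R.ideal_pow_1)
  also have "\<dots> \<subseteq> ism (I [^]\<^bsub>ideals_set R\<^esub> t) (ism J (carrier M))" by (intro ism_mono assms order_refl)
  also have "\<dots> = ism J (ism (I [^]\<^bsub>ideals_set R\<^esub> t) (carrier M))" using id by (intro ism_swap) auto
  also have "\<dots> \<subseteq> ism J (ism (J [^]\<^bsub>ideals_set R\<^esub> t) (carrier M))" by (intro ism_mono Suc order_refl)
  also have "\<dots> = ism (J [^]\<^bsub>ideals_set R\<^esub> Suc t) (carrier M)"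
    using id by (simp add: R.ideal_pow_Suc ism_prod ism_swap del: R.ideal_pow_1)
  finally show ?case .
qed simp

lemma JM_nat: "JM J (\<lambda>i. int (n i)) = ism (multipow R J n) (carrier M)"
  by (simp add: JM_def)

lemma fin_JM:
  assumes "\<And>i. cof (J i)" shows "eventually (\<lambda>n. fin (JM J n) (carrier M)) big"
  unfolding eventually_big
proof (intro exI[of _ 0] allI impI)
  fix n :: "'e \<Rightarrow> int" assume "\<forall>i. 0 \<le> n i"
  then show "fin (JM J n) (carrier M)" using fin_cof[OF cof_multipow[of J, OF assms]] by (simp add: JM_def)
qed

text \<open>One family of coefficients for natural and for integral exponents: the former occur in
  the definitions of the multiplicities, the latter in iterated differences.\<close>

lemma hilbert_pfun:
  fixes J :: "'k::finite \<Rightarrow> 'a set"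
  assumes J: "\<And>i. cof (J i)"
  obtains c N where "finite {\<alpha>. c \<alpha> \<noteq> 0}"
    "\<And>n. (\<forall>i. N \<le> n i) \<Longrightarrow> colen (multipow R J n) = pfun c (\<lambda>i. real (n i))"
    "eventually (\<lambda>n. rl (JM J n) (carrier M) = pfun c (\<lambda>i. real_of_int (n i))) big"
proof -
  have id: "ideal (J i) R" for i using cof_ideal[OF J] .
  obtain S where S: "\<And>i. finite (S i)" "\<And>i. S i \<subseteq> carrier R" "\<And>i. J i = Idl (S i)"
    using gens_exist[of J, OF id] by blast
  have "EP (\<lambda>n. rl (JM J n) (carrier M))"
    by (rule JM_hilbert[OF noeth_M id S fin_JM[of J, OF J]])
  then obtain c where c: "finite {\<alpha>. c \<alpha> \<noteq> 0}"
    "eventually (\<lambda>n. rl (JM J n) (carrier M) = pfun c (\<lambda>i. real_of_int (n i))) big"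
    by (rule EP_pfun)
  then obtain N where N: "\<And>n. (\<forall>i. N \<le> n i) \<Longrightarrow> rl (JM J n) (carrier M) = pfun c (\<lambda>i. real_of_int (n i))"
    unfolding eventually_big by blast
  have "colen (multipow R J n) = pfun c (\<lambda>i. real (n i))" if "\<forall>i. nat N \<le> n i" for n
    using N[of "\<lambda>i. int (n i)"] that by (simp add: JM_nat colen_def nat_le_iff)
  then show thesis using that[OF c(1) _ c(2)] by blast
qed

subsection \<open>The ideal generated by a joint reduction\<close>

lemma multipow_unit_type: "ideal A R \<Longrightarrow> multipow R (\<lambda>_::unit. A) n = A [^]\<^bsub>ideals_set R\<^esub> n ()"
  using R.finprod_ideal_insert[of "{}" "()" "\<lambda>i. A [^]\<^bsub>ideals_set R\<^esub> n i"]
  by (simp add: multipow_def UNIV_unit R.ideal_prod_one)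

lemma unit_fun_eq: "(f :: unit \<Rightarrow> 'x) = (\<lambda>_. f ())"
  by (rule ext) (simp)

text \<open>Q^n M is generated by the a Q^(n-1) M with a in \<open>as\<close>, so \<open>as\<close>
  satisfies \<open>red\<close> for the single ideal Q, whose index type is \<open>unit\<close>. The
  d-th difference of the Hilbert function is then the constant \<open>chi\<close>. All higher
  differences vanish, so the polynomial has degree at most d, and its coefficient at t^d is
  \<open>chi\<close> divided by d!.\<close>

theorem parameter_ideal_asymp:
  assumes as: "set as \<subseteq> carrier R" "length as = d" and Q: "Q = Idl (set as)" "cof Q"
  shows "(\<lambda>t. colen (Q [^]\<^bsub>ideals_set R\<^esub> t) / real t ^ d) \<longlonglongrightarrow> chi as {\<zero>\<^bsub>M\<^esub>} (carrier M) / fact d"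
proof -
  define J where "J = (\<lambda>_::unit. Q)"
  have cJ: "\<And>i. cof (J i)" and id: "\<And>i. ideal (J i) R" using Q cof_ideal by (auto simp: J_def)
  obtain c N where c: "finite {\<alpha>. c \<alpha> \<noteq> 0}"
    and N: "\<And>n. (\<forall>i. N \<le> n i) \<Longrightarrow> colen (multipow R J n) = pfun c (\<lambda>i. real (n i))"
    and ev: "eventually (\<lambda>n. rl (JM J n) (carrier M) = pfun c (\<lambda>i. real_of_int (n i))) big"
    using hilbert_pfun[of J, OF cJ] by blast
  define xs where "xs = map (\<lambda>a. (a, ())) as"
  have xs: "map fst xs = as" "map (\<lambda>(x, k). unit k) xs = map unit (replicate d ())"
    using as(2) by (auto simp: xs_def comp_def map_replicate_const)
  have asQ: "set as \<subseteq> Q" unfolding Q(1) by (rule R.genideal_self[OF as(1)])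
  have red: "eventually (\<lambda>n. \<forall>B. sm B \<longrightarrow> (\<forall>(x, k)\<in>set xs. act x (JM J (n - unit k)) \<subseteq> B) \<longrightarrow> JM J n \<subseteq> B) big"
    unfolding eventually_big
  proof (intro exI[of _ 1] allI impI)
    fix n :: "unit \<Rightarrow> int" and B assume n: "\<forall>i. 1 \<le> n i" and B: "sm B"
      "\<forall>(x, k)\<in>set xs. act x (JM J (n - unit k)) \<subseteq> B"
    have n1: "\<forall>i. 0 \<le> (n - unit ()) i" using n by (simp add: fun_diff_def unit_def)
    have "JM J n = ism Q (JM J (n - unit ()))"
    proof -
      have "(\<lambda>i::unit. int (if i = () then 1 else 0)) = unit ()" by (auto simp: unit_def)
      then show ?thesis using JM_add_eq[of J "n - unit ()" "\<lambda>i. if i = () then 1 else 0", OF id n1]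
        R.multipow_unit[of J "()", OF id] by (simp add: J_def)
    qed
    also have "\<dots> \<subseteq> B" unfolding Q(1)
      using B as fam_JM[of J, OF id] by (subst ism_Idl_le_iff) (auto simp: xs_def)
    finally show "JM J n \<subseteq> B" .
  qed
  have "eventually (\<lambda>n. difs (map (\<lambda>(x, k). unit k) xs) (\<lambda>n. rl (JM J n) (carrier M)) n
     = chi (map fst xs) {\<zero>\<^bsub>M\<^esub>} (carrier M)) big"
  proof (rule joint_reduction_difs[OF noeth_M id, of "\<lambda>_. set as"])
    show "x \<in> J k" if "(x, k) \<in> set xs" for x k using that asQ by (auto simp: xs_def J_def)
  qed (use as Q red fin_JM[of J, OF cJ] in \<open>auto simp: J_def\<close>)
  then have chi: "eventually (\<lambda>n. difs (map unit (replicate d ())) (\<lambda>n. pfun c (\<lambda>i. real_of_int (n i))) n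
     = chi as {\<zero>\<^bsub>M\<^esub>} (carrier M)) big"
    using eventually_difs_cong[OF ev, of "map unit (replicate d ())"] unfolding xs
    by eventually_elim simp
  have cnt: "count_list (replicate D ()) i = D" for D and i :: unit by (induction D) auto
  have app: "difs (ds1 @ ds2) f = difs ds2 (difs ds1 f)" for ds1 ds2 and f :: "(unit \<Rightarrow> int) \<Rightarrow> real"
    by (induction ds1 arbitrary: f) auto
  have deg: "(\<Sum>i\<in>UNIV. \<alpha> i) \<le> d" if "c \<alpha> \<noteq> 0" for \<alpha>
  proof (rule ccontr)
    assume not: "\<not> ?thesis"
    define D where "D = Max ((\<lambda>\<alpha>. \<alpha> ()) ` {\<alpha>. c \<alpha> \<noteq> 0})"
    have le: "\<beta> () \<le> D" if "c \<beta> \<noteq> 0" for \<beta> using that c by (auto simp: D_def)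
    have "D \<in> (\<lambda>\<alpha>. \<alpha> ()) ` {\<alpha>. c \<alpha> \<noteq> 0}" unfolding D_def using c \<open>c \<alpha> \<noteq> 0\<close> by (intro Max_in) auto
    then obtain \<beta> where \<beta>: "c \<beta> \<noteq> 0" "\<beta> () = D" by auto
    have "d < D" using le[OF \<open>c \<alpha> \<noteq> 0\<close>] not by (simp add: UNIV_unit)
    then obtain e where e: "D = d + Suc e" using less_iff_Suc_add by auto
    have z: "difs (map unit (replicate D ())) (\<lambda>n. pfun c (\<lambda>i. 1 * real_of_int (n i))) n = fact D * c (\<lambda>_. D)" for n
      using difs_pfun[OF c, of "replicate D ()" "\<lambda>_. D" 1 n] le by (simp add: cnt UNIV_unit)
    have "eventually (\<lambda>n. difs (map unit (replicate (Suc e) ())) (difs (map unit (replicate d ())) (\<lambda>n. pfun c (\<lambda>i. real_of_int (n i)))) n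
        = difs (map unit (replicate (Suc e) ())) (\<lambda>_. chi as {\<zero>\<^bsub>M\<^esub>} (carrier M)) n) big"
      by (rule eventually_difs_cong[OF chi])
    moreover have "difs (map unit (replicate (Suc e) ())) (\<lambda>_. C) n = 0" for C n
    proof -
      have "difs (map unit (replicate e ())) (\<lambda>_. 0) n = 0"
        using difs_lincomb[of "{}" "map unit (replicate e ())" "\<lambda>_. 0" "\<lambda>_ _. 0" n] by simp
      then show ?thesis by (simp add: dif_def)
    qed
    moreover have "map unit (replicate D ()) = map unit (replicate d ()) @ map unit (replicate (Suc e) ())"
      unfolding e by (simp only: replicate_add map_append)
    ultimately have "eventually (\<lambda>n::unit \<Rightarrow> int. fact D * c (\<lambda>_. D) = 0) big"
      using z by (simp add: app)
    then have "c (\<lambda>_. D) = 0" by simp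
    moreover have "\<beta> = (\<lambda>_. D)" using \<beta>(2) by (subst unit_fun_eq) simp
    ultimately show False using \<beta> by simp
  qed
  have "difs (map unit (replicate d ())) (\<lambda>n. pfun c (\<lambda>i. real_of_int (n i))) n = fact d * c (\<lambda>_. d)" for n
    using difs_pfun[OF c, of "replicate d ()" "\<lambda>_. d" 1 n] deg by (simp add: cnt UNIV_unit)
  then have cd: "fact d * c (\<lambda>_. d) = chi as {\<zero>\<^bsub>M\<^esub>} (carrier M)" using chi by simp
  have "(\<lambda>t. pfun c (\<lambda>i. real t) / real t ^ d) \<longlonglongrightarrow> pfun (hpart d c) (\<lambda>_. 1)"
  proof (rule pfun_asymp[OF c deg])
    show "(\<lambda>t. real t / real t) \<longlonglongrightarrow> 1"
      by (rule Lim_transform_eventually[OF tendsto_const]) (auto intro!: eventually_mono[OF eventually_gt_at_top[of 0]])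
  qed
  moreover have "eventually (\<lambda>t. pfun c (\<lambda>i. real t) / real t ^ d = colen (Q [^]\<^bsub>ideals_set R\<^esub> t) / real t ^ d) sequentially"
    using eventually_ge_at_top[of N]
  proof eventually_elim
    case (elim t)
    then show ?case using N[of "\<lambda>_. t"] multipow_unit_type[OF cof_ideal[OF Q(2)], of "\<lambda>_. t"] by (simp add: J_def)
  qed
  moreover have "pfun (hpart d c) (\<lambda>_. 1) = c (\<lambda>_. d)"
  proof -
    have "pfun (hpart d c) (\<lambda>_. 1) = (\<Sum>\<alpha>\<in>{\<lambda>_. d}. hpart d c \<alpha> * monval \<alpha> (\<lambda>_. 1))"
    proof (rule pfun_superset)
      show "{\<alpha>. hpart d c \<alpha> \<noteq> 0} \<subseteq> {\<lambda>_. d}"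
        by (auto simp: hpart_def UNIV_unit fun_eq_iff split: if_splits)
    qed simp
    then show ?thesis by (simp add: hpart_def monval_def UNIV_unit)
  qed
  ultimately have "(\<lambda>t. colen (Q [^]\<^bsub>ideals_set R\<^esub> t) / real t ^ d) \<longlonglongrightarrow> c (\<lambda>_. d)"
    using Lim_transform_eventually[of _ _ _ "\<lambda>t. colen (Q [^]\<^bsub>ideals_set R\<^esub> t) / real t ^ d"] by simp
  moreover have "c (\<lambda>_. d) = chi as {\<zero>\<^bsub>M\<^esub>} (carrier M) / fact d" using cd by (simp add: field_simps)
  ultimately show ?thesis by simp
qed

end

end

lemma hpart_idem: "hpart d (hpart d c) = hpart d c"
  by (auto simp: hpart_def)

lemma tendsto_mult_ratio: "(\<lambda>t. real (t * u) / real t) \<longlonglongrightarrow> real u"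
  by (rule tendsto_ratio_if_bounded_diff[where K = 0]) simp

context module
begin

context
  fixes \<mm> :: "'a set" and d :: nat
  assumes nlr: "noetherian_local_ring R \<mm>" and fm: "finite_module R M" and dim: "the_enat (krull_dim R) = d"
begin

lemmas cof_rules = cof_ideal[OF nlr fm] cof_carrier[OF nlr fm] cof_superset[OF nlr fm] cof_mult[OF nlr fm]
  cof_pow[OF nlr fm] cof_finprod[OF nlr fm] cof_multipow[OF nlr fm] fin_cof[OF nlr fm]

text \<open>A parameter ideal bounds the degrees of all Hilbert polynomials by \<open>d\<close>; this replaces dimension
  theory.\<close>

context
  fixes Q :: "'a set" and as :: "'a list"
  assumes as: "set as \<subseteq> carrier R" "length as = d" and Q: "Q = Idl (set as)" "cof \<mm> Q" and Qm: "Q \<subseteq> \<mm>"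
begin

text \<open>Replacing A by \<mm> shows that the exponent depends on L alone. It is raised by 1 to
  make it positive.\<close>

lemma cof_le_pow:
  assumes "cof \<mm> L" shows "\<exists>b\<ge>1. \<forall>A. ideal A R \<longrightarrow> A \<subseteq> \<mm> \<longrightarrow>
    ism (A [^]\<^bsub>ideals_set R\<^esub> (b::nat)) (carrier M) \<subseteq> ism L (carrier M)"
proof -
  obtain N :: nat where N: "ism (\<mm> [^]\<^bsub>ideals_set R\<^esub> N) (carrier M) \<subseteq> ism L (carrier M)"
    using assms by (auto simp: cof_def[OF nlr fm])
  show ?thesis
  proof (intro exI[of _ "Suc N"] conjI allI impI)
    fix A assume A: "ideal A R" "A \<subseteq> \<mm>"
    have "A [^]\<^bsub>ideals_set R\<^esub> Suc N \<subseteq> A [^]\<^bsub>ideals_set R\<^esub> N" by (rule R.ideal_pow_antimono[OF A(1)]) simp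
    also have "\<dots> \<subseteq> \<mm> [^]\<^bsub>ideals_set R\<^esub> N" by (rule R.ideal_pow_mono[OF A(2)])
    finally show "ism (A [^]\<^bsub>ideals_set R\<^esub> Suc N) (carrier M) \<subseteq> ism L (carrier M)"
      using ism_mono[OF _ order_refl] N by blast
  qed simp
qed

text \<open>For L = J^u some Q^b M lies in LM, hence Q^(bt) M in L^t M. The length of M/L^t M is
  therefore at most that of M/Q^(bt) M, which is bounded by a multiple of t^d.\<close>

lemma hilbert_degree_le:
  fixes J :: "'k::finite \<Rightarrow> 'a set"
  assumes J: "\<And>i. cof \<mm> (J i)" and c: "finite {\<alpha>. c \<alpha> \<noteq> 0}"
    and N: "\<And>n. (\<forall>i. N \<le> n i) \<Longrightarrow> colen (multipow R J n) = pfun c (\<lambda>i. real (n i))"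
    and "c \<alpha> \<noteq> 0"
  shows "(\<Sum>i\<in>UNIV. \<alpha> i) \<le> d"
proof (rule pfun_degree_le[OF c _ \<open>c \<alpha> \<noteq> 0\<close>])
  fix u :: "'k \<Rightarrow> nat" assume u: "\<And>i. 1 \<le> u i"
  have id: "ideal (J i) R" for i using cof_rules(1)[OF J] .
  have idQ: "ideal Q R" using cof_rules(1)[OF Q(2)] .
  define L where "L = multipow R J u"
  have L: "cof \<mm> L" "ideal L R" unfolding L_def using cof_rules(7)[of J, OF J] id by auto
  obtain b :: nat where b: "1 \<le> b" "ism (Q [^]\<^bsub>ideals_set R\<^esub> b) (carrier M) \<subseteq> ism L (carrier M)"
    using cof_le_pow[OF L(1)] idQ Qm by blast
  have "Bseq (\<lambda>t. colen (Q [^]\<^bsub>ideals_set R\<^esub> t) / real t ^ d)"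
    using convergent_imp_Bseq convergentI[OF parameter_ideal_asymp[OF nlr fm as Q]] by blast
  then obtain K where K: "0 < K" "\<And>t. norm (colen (Q [^]\<^bsub>ideals_set R\<^esub> t) / real t ^ d) \<le> K" by (auto simp: Bseq_def)
  show "\<exists>C. eventually (\<lambda>t. \<bar>pfun c (\<lambda>i. real (t * u i))\<bar> \<le> C * real t ^ d) sequentially"
  proof (intro exI)
    show "eventually (\<lambda>t. \<bar>pfun c (\<lambda>i. real (t * u i))\<bar> \<le> (K * real b ^ d) * real t ^ d) sequentially"
      using eventually_ge_at_top[of N] eventually_gt_at_top[of 0]
    proof eventually_elim
      case (elim t)
      have "\<forall>i. N \<le> t * u i" using elim u by (metis le_trans mult_le_mono2 nat_mult_1_right)
      then have "pfun c (\<lambda>i. real (t * u i)) = colen (L [^]\<^bsub>ideals_set R\<^esub> t)"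
        using N[of "\<lambda>i. t * u i"] R.multipow_pow[of J u t, OF id] by (simp add: L_def)
      also have "\<bar>\<dots>\<bar> \<le> colen (Q [^]\<^bsub>ideals_set R\<^esub> (b * t))"
      proof -
        have "ism (Q [^]\<^bsub>ideals_set R\<^esub> (b * t)) (carrier M) \<subseteq> ism (L [^]\<^bsub>ideals_set R\<^esub> t) (carrier M)"
          using ism_pow_mono[OF nlr fm R.ideal_pow[OF idQ] L(2) b(2), of t] by (simp add: R.ideal_pow_pow[OF idQ])
        from colen_antimono[OF nlr fm cof_rules(5)[OF Q(2)] R.ideal_pow[OF L(2)] this]
        show ?thesis by (simp add: colen_def[OF nlr fm])
      qed
      also have "\<dots> \<le> K * real (b * t) ^ d"
        using K(2)[of "b * t"] elim b(1) by (simp add: divide_le_eq colen_def[OF nlr fm] abs_divide)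
      finally show ?case by (simp add: power_mult_distrib mult.assoc)
    qed
  qed
qed

lemma hilbert_asymp:
  fixes J :: "'k::finite \<Rightarrow> 'a set"
  assumes J: "\<And>i. cof \<mm> (J i)" and c: "finite {\<alpha>. c \<alpha> \<noteq> 0}"
    and N: "\<And>n. (\<forall>i. N \<le> n i) \<Longrightarrow> colen (multipow R J n) = pfun c (\<lambda>i. real (n i))"
    and u: "\<And>i. 1 \<le> u i"
  shows "(\<lambda>t. colen (multipow R J (\<lambda>i. t * u i)) / real t ^ d) \<longlonglongrightarrow> pfun (hpart d c) (\<lambda>i. real (u i))"
proof -
  have "(\<lambda>t. pfun c (\<lambda>i. real (t * u i)) / real t ^ d) \<longlonglongrightarrow> pfun (hpart d c) (\<lambda>i. real (u i))"
    by (rule pfun_asymp[OF c hilbert_degree_le[of J c N, OF J c N]]) (auto intro: tendsto_mult_ratio simp del: of_nat_mult)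
  moreover have "eventually (\<lambda>t. pfun c (\<lambda>i. real (t * u i)) / real t ^ d
      = colen (multipow R J (\<lambda>i. t * u i)) / real t ^ d) sequentially"
    using eventually_ge_at_top[of N]
  proof eventually_elim
    case (elim t)
    have "\<forall>i. N \<le> t * u i" using elim u by (metis le_trans mult_le_mono2 nat_mult_1_right)
    then show ?case using N[of "\<lambda>i. t * u i"] by simp
  qed
  ultimately show ?thesis by (rule Lim_transform_eventually)
qed

section \<open>Hilbert-Samuel multiplicities and their comparison\<close>

lemma hs_mult_lim:
  assumes A: "cof \<mm> A"
  shows "(\<lambda>t. colen (A [^]\<^bsub>ideals_set R\<^esub> t) / real t ^ d) \<longlonglongrightarrow> hs_mult R M A / fact d"
proof -
  define J where "J = (\<lambda>_::unit. A)"
  have J: "\<And>i. cof \<mm> (J i)" using A by (simp add: J_def)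
  have id: "ideal A R" using cof_rules(1)[OF A] .
  obtain c N where c: "finite {\<alpha>. c \<alpha> \<noteq> 0}"
    and N: "\<And>n. (\<forall>i. N \<le> n i) \<Longrightarrow> colen (multipow R J n) = pfun c (\<lambda>i. real (n i))"
    using hilbert_pfun[OF nlr fm, of J, OF J] by blast
  define l where "l = pfun (hpart d c) (\<lambda>i. real (1::nat))"
  have l: "(\<lambda>t. colen (A [^]\<^bsub>ideals_set R\<^esub> t) / real t ^ d) \<longlonglongrightarrow> l"
    using hilbert_asymp[of J c N "\<lambda>_. 1", OF J c N] multipow_unit_type[OF nlr fm id]
    by (simp add: J_def l_def)
  have "(\<lambda>t. fact d * (colen (A [^]\<^bsub>ideals_set R\<^esub> t) / real t ^ d)) \<longlonglongrightarrow> fact d * l"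
    by (intro tendsto_mult tendsto_const l)
  moreover have "hs_mult R M A = lim (\<lambda>t. fact d * (colen (A [^]\<^bsub>ideals_set R\<^esub> t) / real t ^ d))"
    using id by (simp add: hs_mult_def dim colength_eq_colen[OF nlr fm])
  ultimately have "hs_mult R M A = fact d * l" by (simp add: limI)
  then show ?thesis using l by simp
qed

lemma hs_mult_parameter: "hs_mult R M Q = chi as {\<zero>\<^bsub>M\<^esub>} (carrier M)"
  using LIMSEQ_unique[OF hs_mult_lim[OF Q(2)] parameter_ideal_asymp[OF nlr fm as Q]] by simp

lemma hs_mult_carrier: "1 \<le> d \<Longrightarrow> hs_mult R M (carrier R) = 0"
proof -
  have "carrier R [^]\<^bsub>ideals_set R\<^esub> t = carrier R" for t :: nat
    by (induction t) (auto simp: R.ideal_pow_Suc R.oneideal R.ideal_prod_one simp del: R.ideal_pow_1)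
  then have "(\<lambda>t::nat. colen (carrier R [^]\<^bsub>ideals_set R\<^esub> t) / real t ^ d) = (\<lambda>t. 0)"
    by (simp add: colen_def[OF nlr fm])
  then have "(\<lambda>t::nat. colen (carrier R [^]\<^bsub>ideals_set R\<^esub> t) / real t ^ d) \<longlonglongrightarrow> 0" by simp
  from LIMSEQ_unique[OF hs_mult_lim[OF cof_rules(2)] this]
  have "hs_mult R M (carrier R) / fact d = 0" .
  then show ?thesis by simp
qed

text \<open>d! times the form of degree d at u is the multiplicity of J^u, by
  \<open>hilbert_asymp\<close>. Positive exponents are required because the Hilbert polynomial is
  attained only where all coordinates of tu are large.\<close>

lemma hs_mult_sandwich:
  fixes J :: "'k::finite \<Rightarrow> 'a set"
  assumes J: "\<And>i. cof \<mm> (J i)" and c: "finite {\<alpha>. c \<alpha> \<noteq> 0}"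
    and N: "\<And>n. (\<forall>i. N \<le> n i) \<Longrightarrow> colen (multipow R J n) = pfun c (\<lambda>i. real (n i))"
    and uv: "\<And>i. 1 \<le> u i" "\<And>i. 1 \<le> v i" and A: "ideal A R"
    and le: "ism (multipow R J v) (carrier M) \<subseteq> ism A (carrier M)"
      "ism A (carrier M) \<subseteq> ism (multipow R J u) (carrier M)"
  shows "fact d * pfun (hpart d c) (\<lambda>i. real (u i)) \<le> hs_mult R M A"
    "hs_mult R M A \<le> fact d * pfun (hpart d c) (\<lambda>i. real (v i))"
proof -
  have id: "ideal (J i) R" for i using cof_rules(1)[OF J] .
  have cofJ: "cof \<mm> (multipow R J n)" for n by (rule cof_rules(7)[of J, OF J])
  have idJ: "ideal (multipow R J n) R" for n using cof_rules(1)[OF cofJ] .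
  have cofA: "cof \<mm> A" by (rule cof_rules(3)[OF cofJ A le(1)])
  have "pfun (hpart d c) (\<lambda>i. real (u i)) \<le> hs_mult R M A / fact d"
  proof (rule LIMSEQ_le[OF hilbert_asymp[of J c N u, OF J c N uv(1)] hs_mult_lim[OF cofA]])
    show "\<exists>k. \<forall>t\<ge>k. colen (multipow R J (\<lambda>i. t * u i)) / real t ^ d \<le> colen (A [^]\<^bsub>ideals_set R\<^esub> t) / real t ^ d"
    proof (intro exI allI impI divide_right_mono)
      fix t :: nat
      show "colen (multipow R J (\<lambda>i. t * u i)) \<le> colen (A [^]\<^bsub>ideals_set R\<^esub> t)"
        using colen_antimono[OF nlr fm cof_rules(5)[OF cofA] R.ideal_pow[OF idJ] ism_pow_mono[OF nlr fm A idJ le(2)], of t]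
        by (simp add: R.multipow_pow[of J, OF id])
    qed simp
  qed
  then show "fact d * pfun (hpart d c) (\<lambda>i. real (u i)) \<le> hs_mult R M A" by (simp add: field_simps)
  have "hs_mult R M A / fact d \<le> pfun (hpart d c) (\<lambda>i. real (v i))"
  proof (rule LIMSEQ_le[OF hs_mult_lim[OF cofA] hilbert_asymp[of J c N v, OF J c N uv(2)]])
    show "\<exists>k. \<forall>t\<ge>k. colen (A [^]\<^bsub>ideals_set R\<^esub> t) / real t ^ d \<le> colen (multipow R J (\<lambda>i. t * v i)) / real t ^ d"
    proof (intro exI allI impI divide_right_mono)
      fix t :: nat
      show "colen (A [^]\<^bsub>ideals_set R\<^esub> t) \<le> colen (multipow R J (\<lambda>i. t * v i))"
        using colen_antimono[OF nlr fm cof_rules(5)[OF cofJ] R.ideal_pow[OF A] ism_pow_mono[OF nlr fm idJ A le(1)], of t]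
        by (simp add: R.multipow_pow[of J, OF id])
    qed simp
  qed
  then show "hs_mult R M A \<le> fact d * pfun (hpart d c) (\<lambda>i. real (v i))" by (simp add: field_simps)
qed

subsection \<open>Mixed multiplicities of families\<close>

context
  fixes I :: "'k::finite \<Rightarrow> nat \<Rightarrow> 'a set" and c :: nat
  assumes fI: "\<And>i. graded_primary_family R \<mm> (I i)" and c1: "1 \<le> c" and d1: "1 \<le> d"
    and ver: "\<And>i m. I i (c * m) = I i c [^]\<^bsub>ideals_set R\<^esub> m"
    and upper: "\<And>i u n. c * Suc u \<le> n \<Longrightarrow> I i n \<subseteq> I i c [^]\<^bsub>ideals_set R\<^esub> u"
begin

lemma fam_ideal: "ideal (I i n) R"
  using fI[of i] primary_to_facts(1)[OF nlr] R.oneideal by (cases "n = 0") (auto simp: graded_primary_family_def)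

lemma fam_facts: "I i 0 = carrier R" "I i m \<cdot> I i n \<subseteq> I i (m + n)"
  "0 < n \<Longrightarrow> I i n \<subseteq> \<mm>" "0 < n \<Longrightarrow> \<exists>N::nat. \<mm> [^]\<^bsub>ideals_set R\<^esub> N \<subseteq> I i n"
  using fI[of i] primary_to_facts(2,3)[OF nlr] by (auto simp: graded_primary_family_def)

lemma fam_cof: "0 < n \<Longrightarrow> cof \<mm> (I i n)"
proof -
  assume "0 < n"
  then obtain N :: nat where "\<mm> [^]\<^bsub>ideals_set R\<^esub> N \<subseteq> I i n" using fam_facts(4) by blast
  from ism_mono[OF this order_refl] show "cof \<mm> (I i n)" using fam_ideal by (auto simp: cof_def[OF nlr fm])
qed

text \<open>Write n = cq + \<rho> with c \<le> \<rho> < 2c, so that \<rho> is positive and has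
  finitely many values. For a common b, the power I_c^b lies in a power of \<mm> contained in
  I_\<rho>; multiplying by I_(cq) = I_c^q gives the inclusion.\<close>

lemma lower: "\<exists>b. \<forall>i n. c \<le> n \<longrightarrow> I i c [^]\<^bsub>ideals_set R\<^esub> (n div c + b) \<subseteq> I i n"
proof -
  have cpos: "0 < c" using c1 by simp
  have "\<forall>i \<rho>. \<exists>N::nat. 0 < \<rho> \<longrightarrow> \<mm> [^]\<^bsub>ideals_set R\<^esub> N \<subseteq> I i \<rho>" using fam_facts(4) by blast
  then obtain N :: "'k \<Rightarrow> nat \<Rightarrow> nat" where N: "\<And>i \<rho>. 0 < \<rho> \<Longrightarrow> \<mm> [^]\<^bsub>ideals_set R\<^esub> N i \<rho> \<subseteq> I i \<rho>" by metis
  define b where "b = (\<Sum>i\<in>UNIV. \<Sum>\<rho>\<in>{c..<2*c}. N i \<rho>)"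
  have Nb: "N i \<rho> \<le> b" if "\<rho> \<in> {c..<2*c}" for i \<rho>
  proof -
    have "N i \<rho> \<le> (\<Sum>\<rho>\<in>{c..<2*c}. N i \<rho>)" using that by (intro member_le_sum) auto
    also have "\<dots> \<le> b" unfolding b_def by (rule member_le_sum) auto
    finally show ?thesis .
  qed
  have "I i c [^]\<^bsub>ideals_set R\<^esub> (n div c + b) \<subseteq> I i n" if n: "c \<le> n" for i n
  proof -
    define q where "q = n div c - 1"
    define \<rho> where "\<rho> = c + n mod c"
    have dq: "1 \<le> n div c" using n cpos by (simp add: div_greater_zero_iff Suc_leI)
    have nq: "n = c * q + \<rho>"
      using dq mult_div_mod_eq[of c n] by (simp add: q_def \<rho>_def diff_mult_distrib2)
    have \<rho>: "\<rho> \<in> {c..<2*c}" using cpos by (simp add: \<rho>_def)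
    have le: "I i c [^]\<^bsub>ideals_set R\<^esub> b \<subseteq> I i \<rho>"
    proof -
      have "I i c [^]\<^bsub>ideals_set R\<^esub> b \<subseteq> I i c [^]\<^bsub>ideals_set R\<^esub> N i \<rho>"
        by (rule R.ideal_pow_antimono[OF fam_ideal Nb[OF \<rho>]])
      also have "\<dots> \<subseteq> \<mm> [^]\<^bsub>ideals_set R\<^esub> N i \<rho>" using fam_facts(3)[OF cpos] by (intro R.ideal_pow_mono)
      also have "\<dots> \<subseteq> I i \<rho>" using N \<rho> cpos by auto
      finally show ?thesis .
    qed
    have "I i c [^]\<^bsub>ideals_set R\<^esub> (n div c + b) \<subseteq> I i c [^]\<^bsub>ideals_set R\<^esub> (q + b)"
      by (rule R.ideal_pow_antimono[OF fam_ideal]) (simp add: q_def)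
    also have "\<dots> = I i (c * q) \<cdot> (I i c [^]\<^bsub>ideals_set R\<^esub> b)" by (simp add: R.ideal_pow_add fam_ideal ver)
    also have "\<dots> \<subseteq> I i (c * q) \<cdot> I i \<rho>" by (intro R.ideal_prod_mono le order_refl)
    also have "\<dots> \<subseteq> I i n" unfolding nq by (rule fam_facts(2))
    finally show ?thesis .
  qed
  then show ?thesis by blast
qed

text \<open>I_(mn) lies between powers of I_c whose exponents differ from mn/c by a bounded amount,
  and such errors disappear after division by m^d. The denominator c^d comes from the homogeneity of
  the limit.\<close>

lemma family_mult_fun_eq:
  assumes p: "finite {\<alpha>. p \<alpha> \<noteq> 0}"
    and N: "\<And>n. (\<forall>i. N \<le> n i) \<Longrightarrow> colen (multipow R (\<lambda>i. I i c) n) = pfun p (\<lambda>i. real (n i))"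
  shows "family_mult_fun R M I n = fact d * pfun (hpart d p) (\<lambda>i. real (n i)) / real c ^ d"
proof -
  define J where "J = (\<lambda>i. I i c)"
  have cpos: "0 < c" using c1 by simp
  have J: "\<And>i. cof \<mm> (J i)" using fam_cof[OF cpos] by (simp add: J_def)
  have id: "ideal (J i) R" for i using fam_ideal by (simp add: J_def)
  note N' = N[folded J_def]
  define A where "A m = (\<Otimes>\<^bsub>ideals_set R\<^esub>i\<in>UNIV. I i (m * n i))" for m
  have idA: "ideal (A m) R" for m unfolding A_def by (rule R.finprod_ideal) (rule fam_ideal)
  define T where "T u = fact d * pfun (hpart d p) u" for u
  have Tsc: "T (\<lambda>i. a * u i) = a ^ d * T u" for a u by (simp add: T_def pfun_hpart_scale)
  have "(\<lambda>m. hs_mult R M (A m) / real m ^ d) \<longlonglongrightarrow> T (\<lambda>i. real (n i)) / real c ^ d"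
  \<comment> \<open>For n = 0 all ideals are R and both sides are 0, by d \<ge> 1. Otherwise some
    direction i0 supplies arbitrarily large exponents, on which the upper bound relies.\<close>
  proof (cases "\<forall>i. n i = 0")
    case True
    have "A m = carrier R" for m
      using True R.multipow_0[where J = J] by (simp add: A_def multipow_def fam_facts(1))
    then have "hs_mult R M (A m) = 0" for m using hs_mult_carrier[OF d1] by simp
    moreover have "T (\<lambda>i. real (n i)) = 0" using True Tsc[of 0 "\<lambda>_. 0"] d1 by (simp add: zero_power)
    ultimately show ?thesis by simp
  next
    case False
    then obtain i0 where i0: "n i0 \<noteq> 0" by blast
    obtain b where b: "\<And>i n. c \<le> n \<Longrightarrow> J i [^]\<^bsub>ideals_set R\<^esub> (n div c + b) \<subseteq> I i n"
      using lower unfolding J_def by blast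
    have cL: "cof \<mm> (multipow R J (\<lambda>_. 1))" by (rule cof_rules(7)[of J, OF J])
    obtain e :: nat where e: "1 \<le> e" "\<And>A. ideal A R \<Longrightarrow> A \<subseteq> \<mm> \<Longrightarrow>
        ism (A [^]\<^bsub>ideals_set R\<^esub> e) (carrier M) \<subseteq> ism (multipow R J (\<lambda>_. 1)) (carrier M)"
      using cof_le_pow[OF cL] by blast
    define v where "v m i = m * n i div c + b + 1" for m i
    \<comment> \<open>The subtracted 1 is the factor given away in \<open>upper\<close>.\<close>
    define w where "w m i = m * n i div c - 1" for m i
    \<comment> \<open>The sandwich needs positive exponents, but \<open>w m i\<close> is 0 wherever
      n i = 0. Since J_(i0)^e M is contained in the product of all J i applied to M, e factors
      J_(i0) are traded for one more factor of every J i.\<close>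
    define u where "u m i = (if i = i0 then w m i - e else w m i) + 1" for m i
    have lowA: "multipow R J (v m) \<subseteq> A m" if m: "c \<le> m" for m
      unfolding multipow_def A_def
    proof (rule R.finprod_ideal_mono)
      fix i
      show "J i [^]\<^bsub>ideals_set R\<^esub> v m i \<subseteq> I i (m * n i)"
      proof (cases "n i = 0")
        case True
        then show ?thesis using ideal_carr[OF R.ideal_pow[OF id]] by (simp add: fam_facts(1))
      next
        case False
        then have "c \<le> m * n i" using m by (metis le_trans less_one linorder_not_less mult_le_mono2 nat_mult_1_right)
        from b[OF this] show ?thesis
          using R.ideal_pow_antimono[OF id, of "m * n i div c + b" "v m i" i] by (auto simp: v_def)
      qed
    qed (auto intro: R.ideal_pow id fam_ideal)
    have upA: "A m \<subseteq> multipow R J (w m)" for m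
      unfolding multipow_def A_def
    proof (rule R.finprod_ideal_mono)
      fix i
      show "I i (m * n i) \<subseteq> J i [^]\<^bsub>ideals_set R\<^esub> w m i"
      proof (cases "w m i = 0")
        case True
        then show ?thesis using ideal_carr[OF fam_ideal] by simp
      next
        case False
        then have "Suc (w m i) = m * n i div c" by (simp add: w_def)
        then have "c * Suc (w m i) \<le> m * n i" by (simp add: mult.commute[of c] div_times_less_eq_dividend del: mult_Suc mult_Suc_right)
        then show ?thesis unfolding J_def by (rule upper)
      qed
    qed (auto intro: R.ideal_pow id fam_ideal)
    have wbig: "e \<le> w m i0" if m: "c * Suc e \<le> m" for m
    proof -
      have "c * Suc e \<le> m * n i0" using m i0 by (metis le_trans less_one linorder_not_less mult_le_mono2 nat_mult_1_right)
      then have "Suc e \<le> m * n i0 div c" using cpos by (simp add: less_eq_div_iff_mult_less_eq mult.commute del: mult_Suc mult_Suc_right)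
      then show ?thesis by (simp add: w_def)
    qed
    have upM: "ism (multipow R J (w m)) (carrier M) \<subseteq> ism (multipow R J (u m)) (carrier M)" if m: "c * Suc e \<le> m" for m
    proof -
      define w' where "w' i = (if i = i0 then w m i - e else w m i)" for i
      define ei where "ei = (\<lambda>i. e * (if i = i0 then 1 else 0))"
      have "w m = (\<lambda>i. w' i + ei i)" using wbig[OF m] by (auto simp: w'_def ei_def)
      then have "multipow R J (w m) = multipow R J w' \<cdot> (J i0 [^]\<^bsub>ideals_set R\<^esub> e)"
        using R.multipow_add[of J w' ei, OF id] R.multipow_pow[of J "\<lambda>i. if i = i0 then 1 else 0" e, OF id]
          R.multipow_unit[of J i0, OF id] by (simp add: ei_def)
      then have "ism (multipow R J (w m)) (carrier M) = ism (multipow R J w') (ism (J i0 [^]\<^bsub>ideals_set R\<^esub> e) (carrier M))"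
        using id by (simp add: ism_prod)
      also have "\<dots> \<subseteq> ism (multipow R J w') (ism (multipow R J (\<lambda>_. 1)) (carrier M))"
      proof (rule ism_mono[OF order_refl e(2)[OF id]])
        show "J i0 \<subseteq> \<mm>" using fam_facts(3)[OF cpos] by (simp add: J_def)
      qed
      also have "\<dots> = ism (multipow R J (\<lambda>i. w' i + 1)) (carrier M)"
        using id R.multipow_add[of J w' "\<lambda>_. 1", OF id] by (simp add: ism_prod)
      also have "(\<lambda>i. w' i + 1) = u m" by (auto simp: u_def w'_def)
      finally show ?thesis .
    qed
    have ratio: "(\<lambda>m. real (m * n i div c) / real m) \<longlonglongrightarrow> real (n i) / real c" for i
    proof (rule tendsto_ratio_if_bounded_diff[where K = 1], intro always_eventually allI)
      fix m
      have "real (m * n i) = real c * real (m * n i div c) + real (m * n i mod c)"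
        by (metis mult_div_mod_eq of_nat_add of_nat_mult)
      moreover have "real (m * n i mod c) \<le> real c" using cpos by (simp add: less_imp_le)
      ultimately have "\<bar>real c * real (m * n i div c) - real (m * n i)\<bar> \<le> real c" by simp
      then have "\<bar>real c * (real (m * n i div c) - real m * (real (n i) / real c))\<bar> \<le> real c * 1"
        using cpos by (simp add: right_diff_distrib)
      then show "\<bar>real (m * n i div c) - real m * (real (n i) / real c)\<bar> \<le> 1"
        using cpos by (simp add: abs_mult)
    qed
    have close: "(\<lambda>m. real (f m) / real m) \<longlonglongrightarrow> real (n i) / real c"
      if f: "\<And>m. \<bar>real (f m) - real (m * n i div c)\<bar> \<le> K" for f :: "nat \<Rightarrow> nat" and K i
    proof -
      have "(\<lambda>m. (real (f m) - real (m * n i div c)) / real m) \<longlonglongrightarrow> 0"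
        by (rule tendsto_ratio_if_bounded_diff[where K = K]) (use f in simp)
      from tendsto_add[OF this ratio[of i]] show ?thesis by (simp add: diff_divide_distrib)
    qed
    have vl: "(\<lambda>m. real (v m i) / real m) \<longlonglongrightarrow> real (n i) / real c" for i
      by (rule close[of "\<lambda>m. v m i" i "real b + 1"]) (simp add: v_def)
    have ul: "(\<lambda>m. real (u m i) / real m) \<longlonglongrightarrow> real (n i) / real c" for i
    proof (rule close[of "\<lambda>m. u m i" i "real e + 2"])
      fix m
      have "u m i \<le> m * n i div c + 1" "m * n i div c \<le> u m i + e" by (auto simp: u_def w_def)
      then have "real (u m i) \<le> real (m * n i div c + 1)" "real (m * n i div c) \<le> real (u m i + e)" by (simp_all only: of_nat_mono)
      then show "\<bar>real (u m i) - real (m * n i div c)\<bar> \<le> real e + 2" unfolding of_nat_add by linarith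
    qed
    have Tl: "(\<lambda>m. T (\<lambda>i. real (f m i)) / real m ^ d) \<longlonglongrightarrow> T (\<lambda>i. real (n i)) / real c ^ d"
      if f: "\<And>i. (\<lambda>m. real (f m i) / real m) \<longlonglongrightarrow> real (n i) / real c" for f :: "nat \<Rightarrow> 'k \<Rightarrow> nat"
    proof -
      have "(\<lambda>m. pfun (hpart d p) (\<lambda>i. real (f m i)) / real m ^ d) \<longlonglongrightarrow> pfun (hpart d (hpart d p)) (\<lambda>i. real (n i) / real c)"
        by (rule pfun_asymp[OF hpart_finite[OF p]]) (auto simp: hpart_def f split: if_splits)
      then have "(\<lambda>m. fact d * (pfun (hpart d p) (\<lambda>i. real (f m i)) / real m ^ d)) \<longlonglongrightarrow> T (\<lambda>i. real (n i) / real c)"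
        unfolding T_def hpart_idem by (intro tendsto_mult tendsto_const)
      moreover have "T (\<lambda>i. real (n i) / real c) = T (\<lambda>i. real (n i)) / real c ^ d"
        using Tsc[of "1 / real c" "\<lambda>i. real (n i)"] by (simp add: power_one_over)
      ultimately show ?thesis by (simp add: T_def)
    qed
    have sand: "eventually (\<lambda>m. T (\<lambda>i. real (u m i)) / real m ^ d \<le> hs_mult R M (A m) / real m ^ d
        \<and> hs_mult R M (A m) / real m ^ d \<le> T (\<lambda>i. real (v m i)) / real m ^ d) sequentially"
      using eventually_ge_at_top[of "c * Suc e"]
    proof eventually_elim
      case (elim m)
      have "c \<le> m" using elim by simp
      have l: "ism (multipow R J (v m)) (carrier M) \<subseteq> ism (A m) (carrier M)"
        by (rule ism_mono[OF lowA[OF \<open>c \<le> m\<close>] order_refl])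
      have r: "ism (A m) (carrier M) \<subseteq> ism (multipow R J (u m)) (carrier M)"
        by (rule subset_trans[OF ism_mono[OF upA order_refl] upM[OF elim]])
      have "1 \<le> u m i" "1 \<le> v m i" for i by (simp_all add: u_def v_def)
      from hs_mult_sandwich[of J p N "u m" "v m", OF J p N' this idA l r]
      have "T (\<lambda>i. real (u m i)) \<le> hs_mult R M (A m)" "hs_mult R M (A m) \<le> T (\<lambda>i. real (v m i))"
        by (simp_all add: T_def)
      then show ?case by (simp add: divide_right_mono)
    qed
    show ?thesis
      by (rule tendsto_sandwich[OF _ _ Tl[of u, OF ul] Tl[of v, OF vl]])
        (use sand in \<open>auto elim: eventually_mono\<close>)
  qed
  from limI[OF this] show ?thesis by (simp add: family_mult_fun_def dim A_def T_def)
qed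

end

end

end

end

section \<open>Joint reductions compute mixed multiplicities\<close>

lemma count_list_map_distinct: "distinct ls \<Longrightarrow> count_list (map f ls) i = card {p \<in> set ls. f p = i}"
proof (induction ls)
  case (Cons p ls)
  have "{q \<in> set (p # ls). f q = i} = (if f p = i then insert p {q \<in> set ls. f q = i} else {q \<in> set ls. f q = i})"
    by auto
  then show ?case using Cons by auto
qed simp

context module
begin

context
  fixes \<mm> :: "'a set"
  assumes nlr: "noetherian_local_ring R \<mm>" and fm: "finite_module R M"
begin

context
  fixes J :: "'k::finite \<Rightarrow> 'a set" and K :: "'i set" and f :: "'i \<Rightarrow> 'k" and x :: "'i \<Rightarrow> 'a"
  assumes J: "\<And>k. cof \<mm> (J k)" and K: "finite K" and jr: "joint_reduction R M K x (\<lambda>p. J (f p))"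
begin

lemma J_ideal: "ideal (J k) R" using cof_ideal[OF nlr fm J] .

lemma x_in: "p \<in> K \<Longrightarrow> x p \<in> J (f p)" "p \<in> K \<Longrightarrow> x p \<in> carrier R"
  using jr ideal.Icarr[OF J_ideal] by (auto simp: joint_reduction_def)

text \<open>The exponent vector of the product of the ideals listed by K', which turns the products
  in \<open>joint_reduction\<close> into multi-index powers.\<close>

definition kap :: "'i set \<Rightarrow> 'k \<Rightarrow> nat" where
  "kap K' = (\<lambda>i. card {p \<in> K'. f p = i})"

definition Hid :: "'a set" where
  "Hid = (\<Oplus>\<^bsub>ideals_set R\<^esub>p\<in>K. (PIdl (x p)) \<cdot> multipow R J (kap (K - {p})))"

lemma Hid_le:
  assumes "ideal C R" "\<And>p. p \<in> K \<Longrightarrow> (PIdl (x p)) \<cdot> multipow R J (kap (K - {p})) \<subseteq> C"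
  shows "Hid \<subseteq> C" "ideal Hid R"
proof -
  have "ideal ((PIdl (x p)) \<cdot> multipow R J (kap (K - {p}))) R" if "p \<in> K" for p
    using x_in(2)[OF that] J_ideal by (intro R.ideal_prod_is_ideal R.cgenideal_ideal R.multipow_ideal)
  from R.finsum_ideal_le[OF K this assms(2,1)] show "Hid \<subseteq> C" "ideal Hid R" by (simp_all add: Hid_def)
qed

lemma Hid_ideal: "ideal Hid R"
proof (rule Hid_le(2)[OF R.oneideal])
  fix p assume "p \<in> K"
  then show "(PIdl (x p)) \<cdot> multipow R J (kap (K - {p})) \<subseteq> carrier R"
    using x_in(2) J_ideal by (intro ideal_carr R.ideal_prod_is_ideal R.cgenideal_ideal R.multipow_ideal)
qed

lemma kap_remove: "p \<in> K \<Longrightarrow> kap K i = (if i = f p then 1 else 0) + kap (K - {p}) i"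
proof -
  assume p: "p \<in> K"
  have "{q \<in> K. f q = i} = (if i = f p then insert p {q \<in> K - {p}. f q = i} else {q \<in> K - {p}. f q = i})"
    using p by auto
  then show ?thesis using K by (simp add: kap_def)
qed

lemma reduction_eq:
  obtains r :: nat where "ism (Hid \<cdot> (multipow R J (kap K) [^]\<^bsub>ideals_set R\<^esub> r)) (carrier M)
    = ism (multipow R J (kap K) [^]\<^bsub>ideals_set R\<^esub> Suc r) (carrier M)"
proof -
  have e: "(\<Otimes>\<^bsub>ideals_set R\<^esub>p\<in>K'. J (f p)) = multipow R J (kap K')" if "finite K'" for K'
    unfolding kap_def by (rule R.finprod_ideal_eq_multipow[OF that J_ideal])
  have "(\<Oplus>\<^bsub>ideals_set R\<^esub>p\<in>K. (PIdl (x p)) \<cdot> (\<Otimes>\<^bsub>ideals_set R\<^esub>q\<in>K - {p}. J (f q))) = Hid"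
    unfolding Hid_def using e K by simp
  then show thesis using jr e[OF K] that unfolding joint_reduction_def Let_def ideal_smult_eq_ism by auto
qed

text \<open>Each summand of H is a multiple of some x p, so H lies in the ideal generated by the
  tuple. Hence L^(r+1) M = H L^r M is contained in that ideal times M, and powers of L are
  \<open>cof\<close>.\<close>

lemma reduction_cof: "cof \<mm> (Idl (x ` K))"
proof -
  obtain r :: nat where r: "ism (Hid \<cdot> (multipow R J (kap K) [^]\<^bsub>ideals_set R\<^esub> r)) (carrier M)
    = ism (multipow R J (kap K) [^]\<^bsub>ideals_set R\<^esub> Suc r) (carrier M)" by (rule reduction_eq)
  have xK: "x ` K \<subseteq> carrier R" using x_in by auto
  have Q: "ideal (Idl (x ` K)) R" by (rule R.genideal_ideal[OF xK])
  have L: "cof \<mm> (multipow R J (kap K) [^]\<^bsub>ideals_set R\<^esub> n)" for n :: nat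
    by (intro cof_pow[OF nlr fm] cof_multipow[OF nlr fm] J)
  have "Hid \<subseteq> Idl (x ` K)"
  proof (rule Hid_le(1)[OF Q])
    fix p assume p: "p \<in> K"
    have "(PIdl (x p)) \<cdot> multipow R J (kap (K - {p})) \<subseteq> PIdl (x p)"
      using x_in(2)[OF p] J_ideal by (intro R.ideal_prod_le1 R.cgenideal_ideal R.multipow_ideal)
    also have "\<dots> \<subseteq> Idl (x ` K)" using R.genideal_self[OF xK] p by (intro R.cgenideal_minimal[OF Q]) auto
    finally show "(PIdl (x p)) \<cdot> multipow R J (kap (K - {p})) \<subseteq> Idl (x ` K)" .
  qed
  then have "Hid \<cdot> (multipow R J (kap K) [^]\<^bsub>ideals_set R\<^esub> r) \<subseteq> Idl (x ` K)"
    using R.ideal_prod_le1[OF Hid_ideal cof_ideal[OF nlr fm L[of r]]] by blast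
  then have "ism (multipow R J (kap K) [^]\<^bsub>ideals_set R\<^esub> Suc r) (carrier M) \<subseteq> ism (Idl (x ` K)) (carrier M)"
    unfolding r[symmetric] by (rule ism_mono[OF _ order_refl])
  then show ?thesis by (rule cof_superset[OF nlr fm L Q])
qed

text \<open>Multiplication by J^y extends H L^r M = L^(r+1) M from powers of L to all large
  multidegrees: J^n M = HZM with Z = L^r J^y. The summand of H that belongs to p contributes x p
  times \<open>JM J (n - unit (f p))\<close>.\<close>

lemma reduction_red:
  "eventually (\<lambda>n. \<forall>B. sm B \<longrightarrow> (\<forall>p\<in>K. act (x p) (JM J (n - unit (f p))) \<subseteq> B) \<longrightarrow> JM J n \<subseteq> B) big"
proof -
  obtain r :: nat where r: "ism (Hid \<cdot> (multipow R J (kap K) [^]\<^bsub>ideals_set R\<^esub> r)) (carrier M)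
    = ism (multipow R J (kap K) [^]\<^bsub>ideals_set R\<^esub> Suc r) (carrier M)" by (rule reduction_eq)
  note mi = R.multipow_ideal[of J, OF J_ideal]
  show ?thesis
    unfolding eventually_big
  \<comment> \<open>The sum over i dominates every single \<open>Suc r * kap K i\<close>; the
    truncated subtraction in y is therefore exact.\<close>
  proof (intro exI[of _ "int (\<Sum>i\<in>UNIV. Suc r * kap K i)"] allI impI)
    fix n :: "'k \<Rightarrow> int" and B
    assume n: "\<forall>i. int (\<Sum>i\<in>UNIV. Suc r * kap K i) \<le> n i" and B: "sm B"
      "\<forall>p\<in>K. act (x p) (JM J (n - unit (f p))) \<subseteq> B"
    define y where "y i = nat (n i) - Suc r * kap K i" for i
    have ny: "n i = int (y i + Suc r * kap K i)" for i
    proof -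
      have "Suc r * kap K i \<le> (\<Sum>i\<in>UNIV. Suc r * kap K i)" by (rule member_le_sum) auto
      then have "int (Suc r * kap K i) \<le> n i" using n by (meson of_nat_mono order_trans)
      then show ?thesis unfolding y_def by linarith
    qed
    then have n_eq: "n = (\<lambda>i. int (y i + Suc r * kap K i))" by auto
    define Y where "Y = multipow R J y"
    define L where "L = multipow R J (kap K)"
    define Z where "Z = (L [^]\<^bsub>ideals_set R\<^esub> r) \<cdot> Y"
    have id: "ideal Y R" "ideal L R" "ideal (L [^]\<^bsub>ideals_set R\<^esub> r) R" "ideal (L [^]\<^bsub>ideals_set R\<^esub> Suc r) R" "ideal Z R"
      using mi by (auto simp: Y_def L_def Z_def intro!: R.ideal_prod_is_ideal R.ideal_pow)
    have Zeq: "Z = multipow R J (\<lambda>i. r * kap K i + y i)"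
      by (simp add: Z_def L_def Y_def R.multipow_pow[of J, OF J_ideal] R.multipow_add[of J, OF J_ideal])
    have smZ: "sm (ism Z (carrier M))" using id by (simp add: ideal_carr)
    \<comment> \<open>The conductor of ZM into B is an ideal, so the inclusion of H needs to be
      verified only for its summands.\<close>
    have "Hid \<subseteq> {a \<in> carrier R. act a (ism Z (carrier M)) \<subseteq> B}"
    proof (rule Hid_le(1)[OF conductor_ideal[OF smZ B(1)]])
      fix p assume p: "p \<in> K"
      note xp = x_in(2)[OF p]
      let ?P = "multipow R J (kap (K - {p}))"
      have "?P \<cdot> Z = multipow R J (\<lambda>i. kap (K - {p}) i + (r * kap K i + y i))"
        unfolding Zeq by (rule R.multipow_add[of J, OF J_ideal, symmetric])
      moreover have "n - unit (f p) = (\<lambda>i. int (kap (K - {p}) i + (r * kap K i + y i)))"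
        by (rule ext) (auto simp: n_eq fun_diff_def unit_def kap_remove[OF p])
      ultimately have JMe: "JM J (n - unit (f p)) = ism (?P \<cdot> Z) (carrier M)"
        by (simp only: JM_nat[OF nlr fm])
      have "ism ((PIdl (x p)) \<cdot> ?P) (ism Z (carrier M)) = ism (PIdl (x p)) (ism (?P \<cdot> Z) (carrier M))"
        using xp mi id smZ by (simp add: ism_prod R.cgenideal_ideal ideal_carr)
      also have "\<dots> = ism (Idl {x p}) (JM J (n - unit (f p)))"
        using R.cgenideal_eq_genideal[OF xp] by (simp add: JMe)
      also have "\<dots> \<subseteq> B"
        using B p xp fam_JM[of J, OF J_ideal] by (subst ism_Idl_le_iff) auto
      finally show "(PIdl (x p)) \<cdot> ?P \<subseteq> {a \<in> carrier R. act a (ism Z (carrier M)) \<subseteq> B}"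
        using ism_le_iff_conductor[OF B(1) ideal_carr[OF R.ideal_prod_is_ideal[OF R.cgenideal_ideal[OF xp] mi]]] by blast
    qed
    then have HB: "ism Hid (ism Z (carrier M)) \<subseteq> B"
      using B(1) ideal_carr[OF Hid_ideal] by (simp add: ism_le_iff_conductor)
    have "JM J n = ism (Y \<cdot> (L [^]\<^bsub>ideals_set R\<^esub> Suc r)) (carrier M)"
      unfolding n_eq JM_nat[OF nlr fm] Y_def L_def
      by (simp only: R.multipow_pow[of J, OF J_ideal] R.multipow_add[of J, OF J_ideal])
    also have "\<dots> = ism Y (ism (Hid \<cdot> (L [^]\<^bsub>ideals_set R\<^esub> r)) (carrier M))"
      using id by (simp add: ism_prod r[folded L_def] del: R.ideal_pow_1)
    also have "\<dots> = ism Y (ism Hid (ism (L [^]\<^bsub>ideals_set R\<^esub> r) (carrier M)))"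
      using id Hid_ideal by (simp add: ism_prod)
    also have "\<dots> = ism Hid (ism Y (ism (L [^]\<^bsub>ideals_set R\<^esub> r) (carrier M)))"
      using id Hid_ideal by (intro ism_swap[OF nlr fm]) (auto simp: ideal_carr)
    also have "ism Y (ism (L [^]\<^bsub>ideals_set R\<^esub> r) (carrier M)) = ism Z (carrier M)"
      unfolding Z_def using id by (subst ism_swap[OF nlr fm]) (auto simp: ism_prod)
    finally show "JM J n \<subseteq> B" using HB by simp
  qed
qed

theorem reduction_chi:
  assumes ls: "distinct ls" "set ls = K"
  shows "eventually (\<lambda>n. difs (map unit (map f ls)) (\<lambda>n. rl (JM J n) (carrier M)) n
     = chi (map x ls) {\<zero>\<^bsub>M\<^esub>} (carrier M)) big"
proof -
  obtain S where S: "\<And>i. finite (S i)" "\<And>i. S i \<subseteq> carrier R" "\<And>i. J i = Idl (S i)"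
    using gens_exist[OF nlr fm, of J, OF J_ideal] by blast
  define xs where "xs = map (\<lambda>p. (x p, f p)) ls"
  have e: "map (\<lambda>(x, k). unit k) xs = map unit (map f ls)" "map fst xs = map x ls" by (simp_all add: xs_def)
  show ?thesis unfolding e[symmetric]
  proof (rule joint_reduction_difs[OF noeth_M[OF nlr fm] J_ideal S _ _ fin_JM[OF nlr fm, of J, OF J]])
    show "a \<in> J k" if "(a, k) \<in> set xs" for a k using that x_in ls by (auto simp: xs_def)
    have eq: "(\<forall>(a, k)\<in>set xs. act a (JM J (n - unit k)) \<subseteq> B) \<longleftrightarrow> (\<forall>p\<in>K. act (x p) (JM J (n - unit (f p))) \<subseteq> B)" for n B
      using ls by (auto simp: xs_def)
    show "eventually (\<lambda>n. \<forall>B. sm B \<longrightarrow> (\<forall>(x, k)\<in>set xs. act x (JM J (n - unit k)) \<subseteq> B) \<longrightarrow> JM J n \<subseteq> B) big"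
      unfolding eq by (rule reduction_red)
  qed
qed

end

end

end

section \<open>Conclusion for Noetherian families\<close>

theorem corollary3p7:
  fixes R :: "('a, 'r) ring_scheme"
    and M :: "('a, 'b, 'm) module_scheme"
    and \<mm> :: "'a set"
    and d n0 :: nat
    and I :: "'k::finite \<Rightarrow> nat \<Rightarrow> 'a set"
    and ds :: "'k \<Rightarrow> nat"
    and x :: "nat \<Rightarrow> 'k \<times> nat \<Rightarrow> 'a"
    and Q :: "nat \<Rightarrow> 'a set"
  assumes "noetherian_local_ring R \<mm>"
    and "krull_dim R = enat d" and "d \<ge> 1"
    and "finite_module R M" and "module_dim R M = enat d"
    and "\<And>i. graded_primary_family R \<mm> (I i)"
    and "\<And>i. noetherian_family R (I i)"
    and "(\<Sum>i\<in>UNIV. ds i) = d"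
    and "weak_asymp_joint_reduction R M I ds n0 x"
    and Q_def: "\<And>n. Q n = Idl\<^bsub>R\<^esub> (x n ` type_index ds)"
  shows "\<exists>c\<ge>1.
    (\<forall>i m. I i (c * m) = I i c [^]\<^bsub>ideals_set R\<^esub> m) \<and>
    (\<forall>\<^sub>F m in sequentially.
       hs_mult R M (Q (c * m)) = real m ^ d * mixed_mult R M (\<lambda>i. I i c) ds) \<and>
    family_mixed_mult R M I ds = 1 / real c ^ d * mixed_mult R M (\<lambda>i. I i c) ds \<and>
    (\<forall>\<^sub>F m in sequentially.
       hs_mult R M (Q (c * m)) / real (c * m) ^ d = family_mixed_mult R M I ds)"
proof -
  note nlr = assms(1) and fm = assms(4) and fI = assms(6)
  interpret module R M using fm by (simp add: finite_module_def)
  have dim: "the_enat (krull_dim R) = d" using assms(2) by simp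
  have idI: "ideal (I i n) R" for i n
    using fI[of i] primary_to_facts(1)[OF nlr] R.oneideal by (cases "n = 0") (auto simp: graded_primary_family_def)
  have gI: "I i m \<cdot>\<^bsub>R\<^esub> I i n \<subseteq> I i (m + n)" "I i 0 = carrier R" for i m n
    using fI[of i] by (auto simp: graded_primary_family_def)
  have "\<exists>c0\<ge>1. \<forall>c\<ge>1. c0 dvd c \<longrightarrow> (\<forall>m. I i (c * m) = I i c [^]\<^bsub>ideals_set R\<^esub> m) \<and>
      (\<forall>u n. c * Suc u \<le> n \<longrightarrow> I i n \<subseteq> I i c [^]\<^bsub>ideals_set R\<^esub> u)" for i
    by (rule R.noetherian_family_veronese[OF gI(2) idI gI(1) assms(7)])
  then have "\<forall>i. \<exists>c0. c0 \<ge> 1 \<and> (\<forall>c\<ge>1. c0 dvd c \<longrightarrow> (\<forall>m. I i (c * m) = I i c [^]\<^bsub>ideals_set R\<^esub> m) \<and>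
      (\<forall>u n. c * Suc u \<le> n \<longrightarrow> I i n \<subseteq> I i c [^]\<^bsub>ideals_set R\<^esub> u))" by blast
  from choice[OF this] obtain c0 :: "'k \<Rightarrow> nat" where c0': "\<forall>i. c0 i \<ge> 1 \<and> (\<forall>c\<ge>1. c0 i dvd c \<longrightarrow>
      (\<forall>m. I i (c * m) = I i c [^]\<^bsub>ideals_set R\<^esub> m) \<and>
      (\<forall>u n. c * Suc u \<le> n \<longrightarrow> I i n \<subseteq> I i c [^]\<^bsub>ideals_set R\<^esub> u))" by (elim exE)
  have c0: "1 \<le> c0 i"
    "1 \<le> c \<Longrightarrow> c0 i dvd c \<Longrightarrow> I i (c * m) = I i c [^]\<^bsub>ideals_set R\<^esub> m"
    "1 \<le> c \<Longrightarrow> c0 i dvd c \<Longrightarrow> c * Suc u \<le> n \<Longrightarrow> I i n \<subseteq> I i c [^]\<^bsub>ideals_set R\<^esub> u" for i c m u n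
    using c0'[THEN spec, of i] by (blast, blast, blast)
  \<comment> \<open>A common multiple of all c0 i serves every family at once.\<close>
  define c where "c = (\<Prod>i\<in>UNIV. c0 i)"
  have c1: "1 \<le> c" using c0(1) by (simp add: c_def Suc_le_eq)
  have dvd: "c0 i dvd c" for i unfolding c_def by (rule dvd_prodI) auto
  note ver = c0(2)[OF c1 dvd] and upper = c0(3)[OF c1 dvd]
  have cofI: "cof \<mm> (I i n)" if "0 < n" for i n
  proof -
    have "primary_to R \<mm> (I i n)" using fI[of i] that by (simp add: graded_primary_family_def)
    then obtain N :: nat where "\<mm> [^]\<^bsub>ideals_set R\<^esub> N \<subseteq> I i n"
      using primary_to_facts(3)[OF nlr] by blast
    from ism_mono[OF this order_refl] show ?thesis using idI by (auto simp: cof_def[OF nlr fm])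
  qed
  have Im: "I i n \<subseteq> \<mm>" if "0 < n" for i n
    using primary_to_facts(2)[OF nlr] fI[of i] that by (auto simp: graded_primary_family_def)

  define K where "K = type_index ds"
  have K: "finite K" by (simp add: K_def type_index_def)
  have Kcard: "card {p \<in> K. fst p = i} = ds i" for i
  proof -
    have "{p \<in> K. fst p = i} = {i} \<times> {1..ds i}" by (auto simp: K_def type_index_def)
    then show ?thesis by (simp add: card_cartesian_product)
  qed
  obtain ls where ls: "distinct ls" "set ls = K" using finite_distinct_list[OF K] by blast
  have cnt: "count_list (map fst ls) i = ds i" for i using count_list_map_distinct[OF ls(1), of fst i] Kcard ls by simp
  have len: "length ls = d" using sum_count_list[of "map fst ls"] assms(8) by (simp add: cnt)

  define J where "J = (\<lambda>i. I i c)"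
  have J: "\<And>i. cof \<mm> (J i)" using cofI c1 by (simp add: J_def)
  have idJ: "ideal (J i) R" for i using idI by (simp add: J_def)
  obtain p N where p: "finite {\<alpha>. p \<alpha> \<noteq> 0}"
    and N: "\<And>n. (\<forall>i. N \<le> n i) \<Longrightarrow> colen (multipow R J n) = pfun p (\<lambda>i. real (n i))"
    using hilbert_pfun[OF nlr fm, of J, OF J] by blast

  define as where "as n = map (x n) ls" for n
  have Qn: "set (as n) \<subseteq> carrier R" "length (as n) = d" "Q n = Idl\<^bsub>R\<^esub> (set (as n))" "cof \<mm> (Q n)" "Q n \<subseteq> \<mm>"
    and chin: "eventually (\<lambda>\<nu>. difs (map unit (map fst ls)) (\<lambda>\<nu>. rl (JM (\<lambda>i. I i n) \<nu>) (carrier M)) \<nu>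
       = chi (as n) {\<zero>\<^bsub>M\<^esub>} (carrier M)) big"
    if n: "n0 \<le> n" "0 < n" for n
  proof -
    have Jn: "\<And>i. cof \<mm> (I i n)" using cofI n by simp
    have e: "(\<lambda>(i, j). I i n) = (\<lambda>p. I (fst p) n)" by auto
    have jr: "joint_reduction R M K (x n) (\<lambda>p. I (fst p) n)"
      using assms(9)[unfolded weak_asymp_joint_reduction_def, rule_format, OF n(1)] unfolding K_def e .
    note xin = x_in[OF nlr fm, of "\<lambda>i. I i n", OF Jn K jr]
    show as_carr: "set (as n) \<subseteq> carrier R" "length (as n) = d" using xin ls len by (auto simp: as_def)
    show Qe: "Q n = Idl\<^bsub>R\<^esub> (set (as n))" by (simp add: Q_def as_def ls K_def)
    show "cof \<mm> (Q n)"
      using reduction_cof[OF nlr fm, of "\<lambda>i. I i n", OF Jn K jr] by (simp add: Q_def K_def)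
    show "Q n \<subseteq> \<mm>" unfolding Qe
    proof (rule R.genideal_minimal)
      show "ideal \<mm> R" by (rule ideal_m[OF nlr fm])
      show "set (as n) \<subseteq> \<mm>" using xin(1) Im[OF n(2)] ls by (auto simp: as_def)
    qed
    show "eventually (\<lambda>\<nu>. difs (map unit (map fst ls)) (\<lambda>\<nu>. rl (JM (\<lambda>i. I i n) \<nu>) (carrier M)) \<nu>
       = chi (as n) {\<zero>\<^bsub>M\<^esub>} (carrier M)) big"
      unfolding as_def by (rule reduction_chi[OF nlr fm, of "\<lambda>i. I i n", OF Jn K jr ls])
  qed
  \<comment> \<open>Degree bounds and limits need one \<open>cof\<close> ideal inside \<mm>
    generated by d elements. The tuple at \<open>Suc n0\<close> provides it; the successor ensures a
    positive index.\<close>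
  have q0: "n0 \<le> Suc n0" "0 < Suc n0" by auto
  note Q0 = Qn[OF q0]
  have deg: "(\<Sum>i\<in>UNIV. \<alpha> i) \<le> d" if "p \<alpha> \<noteq> 0" for \<alpha>
    by (rule hilbert_degree_le[OF nlr fm dim Q0, of J p N, OF J p N that])

  define e where "e = (\<Prod>i\<in>UNIV. fact (ds i)) * p ds"
  have mixed: "mixed_mult R M (\<lambda>i. I i c) ds = e"
  proof -
    have col: "colength R M (\<Otimes>\<^bsub>ideals_set R\<^esub>i\<in>UNIV. I i c [^]\<^bsub>ideals_set R\<^esub> n i) = colen (multipow R J n)" for n
      using colength_eq_colen[OF nlr fm R.multipow_ideal[of J n, OF idJ]] by (simp add: multipow_def J_def)
    have "mixed_hilbert_coeffs R M (\<lambda>i. I i c) = p"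
      unfolding mixed_hilbert_coeffs_def col poly_fun_eq_pfun
    proof (rule the_equality)
      show "finite {\<alpha>. p \<alpha> \<noteq> 0} \<and> (\<exists>N. \<forall>n. (\<forall>i. N \<le> n i) \<longrightarrow> colen (multipow R J n) = pfun p (\<lambda>i. real (n i)))"
        using p N by blast
      fix p' assume "finite {\<alpha>. p' \<alpha> \<noteq> 0} \<and> (\<exists>N. \<forall>n. (\<forall>i. N \<le> n i) \<longrightarrow> colen (multipow R J n) = pfun p' (\<lambda>i. real (n i)))"
      then obtain N' where p': "finite {\<alpha>. p' \<alpha> \<noteq> 0}"
        "\<And>n. (\<forall>i. N' \<le> n i) \<Longrightarrow> colen (multipow R J n) = pfun p' (\<lambda>i. real (n i))" by blast
      show "p' = p"
      proof (rule pfun_unique[OF p'(1) p, of "max N N'"])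
        fix n :: "'k \<Rightarrow> nat" assume "\<forall>i. max N N' \<le> n i"
        then show "pfun p' (\<lambda>i. real (n i)) = pfun p (\<lambda>i. real (n i))" using N[of n] p'(2)[of n] by simp
      qed
    qed
    then show ?thesis by (simp add: mixed_mult_def e_def)
  qed

  \<comment> \<open>I_(cm) = J^m, so its Hilbert polynomial is that of J with the argument dilated
    by m. Its difference of type \<open>ds\<close> is m^d e by \<open>difs_pfun\<close>, and the
    joint reduction identifies the same difference with \<open>chi\<close>, which is e(Q_(cm);
    M).\<close>
  have hsQ: "hs_mult R M (Q (c * m)) = real m ^ d * e" if m: "n0 < m" for m
  proof -
    have cm: "n0 \<le> c * m" "0 < c * m" using c1 m by (auto intro: le_trans[of n0 m])
    define J' where "J' = (\<lambda>i. J i [^]\<^bsub>ideals_set R\<^esub> m)"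
    have J'I: "(\<lambda>i. I i (c * m)) = J'" using ver by (simp add: J'_def J_def)
    have ev: "eventually (\<lambda>\<nu>. rl (JM J' \<nu>) (carrier M) = pfun p (\<lambda>i. real m * real_of_int (\<nu> i))) big"
      unfolding eventually_big
    proof (intro exI[of _ "int N"] allI impI)
      fix \<nu> :: "'k \<Rightarrow> int" assume \<nu>: "\<forall>i. int N \<le> \<nu> i"
      then have pos: "\<forall>i. 0 \<le> \<nu> i" by (meson of_nat_0_le_iff order_trans)
      have ge: "\<forall>i. N \<le> m * nat (\<nu> i)"
      proof
        fix i
        have "N \<le> nat (\<nu> i)" using \<nu> by (metis nat_int nat_mono)
        also have "\<dots> \<le> m * nat (\<nu> i)" using m by simp
        finally show "N \<le> m * nat (\<nu> i)" .
      qed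
      have "rl (JM J' \<nu>) (carrier M) = colen (multipow R J (\<lambda>i. m * nat (\<nu> i)))"
        using pos R.multipow_of_pow[of J m, OF idJ] by (simp add: JM_def colen_def[OF nlr fm] J'_def)
      also have "\<dots> = pfun p (\<lambda>i. real m * real_of_int (\<nu> i))"
        using N[OF ge] pos by simp
      finally show "rl (JM J' \<nu>) (carrier M) = pfun p (\<lambda>i. real m * real_of_int (\<nu> i))" .
    qed
    have dl: "difs (map unit (map fst ls)) (\<lambda>\<nu>. pfun p (\<lambda>i. real m * real_of_int (\<nu> i))) \<nu> = real m ^ d * e" for \<nu>
      using difs_pfun[OF p, of "map fst ls" ds "real m" \<nu>] deg by (simp add: len cnt e_def)
    have "eventually (\<lambda>\<nu>::'k \<Rightarrow> int. real m ^ d * e = chi (as (c * m)) {\<zero>\<^bsub>M\<^esub>} (carrier M)) big"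
      using chin[OF cm, unfolded J'I] eventually_difs_cong[OF ev, of "map unit (map fst ls)"]
    proof eventually_elim
      case (elim \<nu>)
      then show ?case by (simp only: dl)
    qed
    then have "real m ^ d * e = chi (as (c * m)) {\<zero>\<^bsub>M\<^esub>} (carrier M)" by simp
    also have "\<dots> = hs_mult R M (Q (c * m))"
      by (rule hs_mult_parameter[OF nlr fm dim Qn[OF cm], symmetric])
    finally show ?thesis by simp
  qed

  have fam: "family_mixed_mult R M I ds = 1 / real c ^ d * e"
  proof -
    have fmf: "family_mult_fun R M I n = fact d * pfun (hpart d p) (\<lambda>i. real (n i)) / real c ^ d" for n
      by (rule family_mult_fun_eq[OF nlr fm dim Q0, of I c p N n, OF fI c1 assms(3) ver upper p N[unfolded J_def]])
    \<comment> \<open>The coefficients of the polynomial attached to the families; the summand 0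
      gives P the shape of \<open>pfun_add\<close>. The factor d! cancels against the normalization
      in \<open>family_mixed_mult\<close>, and e/c^d is left.\<close>
    define P where "P = (\<lambda>\<alpha>. 0 + (fact d / real c ^ d) * hpart d p \<alpha>)"
    have f0: "finite {\<alpha>::'k \<Rightarrow> nat. (0::real) \<noteq> 0}" by simp
    have P: "finite {\<alpha>. P \<alpha> \<noteq> 0}" "pfun P u = (fact d / real c ^ d) * pfun (hpart d p) u" for u
      unfolding P_def using pfun_add[OF f0 hpart_finite[OF p], where s = "fact d / real c ^ d"]
      by (auto simp: pfun_def[of "\<lambda>_. 0"])
    have "family_mult_coeffs R M I = P"
      unfolding family_mult_coeffs_def poly_fun_eq_pfun dim fmf
    proof (rule the_equality)
      show "finite {\<alpha>. P \<alpha> \<noteq> 0} \<and> (\<forall>\<alpha>. P \<alpha> \<noteq> 0 \<longrightarrow> (\<Sum>i\<in>UNIV. \<alpha> i) = d) \<and>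
        (\<forall>n. fact d * pfun (hpart d p) (\<lambda>i. real (n i)) / real c ^ d = pfun P (\<lambda>i. real (n i)))"
        using P by (auto simp: P_def hpart_def split: if_splits)
      fix P' assume P': "finite {\<alpha>. P' \<alpha> \<noteq> 0} \<and> (\<forall>\<alpha>. P' \<alpha> \<noteq> 0 \<longrightarrow> (\<Sum>i\<in>UNIV. \<alpha> i) = d) \<and>
        (\<forall>n. fact d * pfun (hpart d p) (\<lambda>i. real (n i)) / real c ^ d = pfun P' (\<lambda>i. real (n i)))"
      show "P' = P"
        by (rule pfun_unique[of P' P 0]) (use P P' in auto)
    qed
    then show ?thesis
      using assms(8) by (simp add: family_mixed_mult_def dim P_def hpart_def e_def)
  qed

  have ev: "eventually (\<lambda>m. hs_mult R M (Q (c * m)) = real m ^ d * e) sequentially"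
    using eventually_gt_at_top[of n0] by eventually_elim (rule hsQ)
  have ev2: "eventually (\<lambda>m. hs_mult R M (Q (c * m)) / real (c * m) ^ d = 1 / real c ^ d * e) sequentially"
    using ev eventually_gt_at_top[of 0]
  proof eventually_elim
    case (elim m)
    then show ?case using c1 by (simp add: power_mult_distrib)
  qed
  show ?thesis
    by (intro exI[of _ c] conjI allI) (simp_all only: c1 ver mixed fam ev ev2)
qed

end
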